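(* Let $X$ be a random vector in $\mathbb{R}^d$. Let $b\in\mathbb{R}^d$ and let $\nu$ be a Lévy measure on $\mathbb{R}^d$ with polar decomposition $$\nu(du)=\mathbf 1_{(0,+\infty)}(r)\mathbf 1_{\mathbb{S}^{d-1}}(x)\frac{k_x(r)}{r}\,dr\,\sigma(dx),$$ where $\sigma$ is a finite positive measure on $\mathbb{S}^{d-1}$ and where $k_x(r)$ is a nonnegative continuous function decreasing in $r\in(0,+\infty)$, continuous in $x\in\mathbb{S}^{d-1}$, and such that $$\lim_{\varepsilon\to0^+}\varepsilon k_x(\varepsilon)=k_x(1),\quad \lim_{R\to+\infty}k_x(R)=0,\quad x\in\mathbb{S}^{d-1},\qquad \int_0^{+\infty}(1\wedge r^2)\max_{x\in\mathbb{S}^{d-1}}k_x(r)\,\frac{dr}{r}<+\infty.$$ Moreover, assume that for all sequences $(x_n)_{n\ge1}$ in $\mathbb{S}^{d-1}$ converging to $x\in\mathbb{S}^{d-1}$, $$\lim_{n\to+\infty}\lim_{R\to+\infty}V_a^R(k_{x_n}-k_x)=0,\quad a>0.$$ Let $\tilde\nu$ be the positive measure on $\mathbb{R}^d$ defined by $\tilde\nu(du)=\mathbf 1_{(0,+\infty)}(r)\mathbf 1_{\mathbb{S}^{d-1}}(x)(-dk_x(r))\sigma(dx)$, and assume $\int_{\mathbb{R}^d}(1\wedge\|u\|^2)\tilde\nu(du)<+\infty$. Then $$\mathbb{E}\langle X;\nabla f(X)\rangle=\mathbb{E}\langle b;\nabla f(X)\rangle-\mathbb{E}\int_{\mathbb{S}^{d-1}}\langle\nabla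 f(X);x\rangle k_x(1)\,\sigma(dx)+\mathbb{E}\int_{\mathbb{R}^d}\big(f(X+u)-f(X)-\langle\nabla f(X);u\rangle\mathbf 1_{\|u\|\le1}\big)\tilde\nu(du)$$ holds for all $f\in\mathcal{S}(\mathbb{R}^d)$ if and only if $X$ is self-decomposable with parameter $b$, $\Sigma=0$ and Lévy measure $\nu$.
   Context: $\|\cdot\|$, $\langle\cdot;\cdot\rangle$ are the Euclidean norm and inner product on $\mathbb{R}^d$; $\mathbb{S}^{d-1}$ is the Euclidean unit sphere; $\mathcal{S}(\mathbb{R}^d)$ is the Schwartz space of real-valued functions. A Lévy measure is a positive Borel measure $\nu$ on $\mathbb{R}^d$ with $\nu(\{0\})=0$ and $\int(1\wedge\|u\|^2)\nu(du)<+\infty$. Polar decompositions are in coordinates $u=rx$, $r>0$, $x\in\mathbb{S}^{d-1}$. "Decreasing" means non-increasing, and $-dk_x(r)$ is the positive Lebesgue–Stieltjes measure on $(0,+\infty)$ associated with the decreasing function $r\mapsto k_x(r)$. $V_a^R(g)=\sup\sum_{i=1}^n|g(x_i)-g(x_{i-1})|$ (supremum over all subdivisions $a=x_0<\dots<x_n=R$) is the variation of $g$ on $[a,R]$. "$X$ is self-decomposable with parameter $b$, $\Sigma=0$ and Lévy measure $\nu$" means that $X$ has characteristic function $\varphi(\xi)=\exp\big(i\langle b;\xi\rangle+\int_{\mathbb{R}^d}(e^{i\langle\xi;u\rangle}-1-i\langle\xi;u\rangle\mathbf 1_{\|u\|\le1})\nu(du)\big)$, where $\nu$ has the polar decomposition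 $\nu(du)=\mathbf 1_{(0,+\infty)}(r)\mathbf 1_{\mathbb{S}^{d-1}}(x)\frac{k_x(r)}{r}\,dr\,\sigma(dx)$, with $\sigma$ a finite positive measure on $\mathbb{S}^{d-1}$ and $k_x(r)\ge0$ decreasing in $r$ and measurable in $x$. *)

theory Defs
  imports "HOL-Probability.Probability"
begin

definition gradient :: "('a::euclidean_space \<Rightarrow> real) \<Rightarrow> 'a \<Rightarrow> 'a" where
  "gradient f x = (THE D. GDERIV f x :> D)"

lemma gradient_eqI:
  assumes "GDERIV f x :> D"
  shows "gradient f x = D"
  unfolding gradient_def
proof (rule the_equality)
  show "GDERIV f x :> D" by fact
next
  fix E assume "GDERIV f x :> E"
  with assms have "(\<lambda>h. h \<bullet> E) = (\<lambda>h. h \<bullet> D)"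
    unfolding gderiv_def by (rule has_derivative_unique[rotated])
  then show "E = D"
    by (metis vector_eq_ldot)
qed

text \<open>The derivative of \<open>f\<close> along the directions in the list \<open>bs\<close>; for lists of basis vectors these
  are the partial derivatives indexed by multi-indices.\<close>

primrec partial_derivs :: "'a list \<Rightarrow> ('a::euclidean_space \<Rightarrow> real) \<Rightarrow> 'a \<Rightarrow> real" where
  "partial_derivs [] f = f"
| "partial_derivs (b # bs) f = (\<lambda>x. frechet_derivative (partial_derivs bs f) (at x) b)"

text \<open>Differentiability of all iterated partial derivatives is smoothness.\<close>

definition schwartz_space :: "('a::euclidean_space \<Rightarrow> real) set" where
  "schwartz_space = {f.
     (\<forall>bs\<in>lists Basis. \<forall>x. partial_derivs bs f differentiable (at x)) \<and>
     (\<forall>bs\<in>lists Basis. \<forall>m::nat. bounded (range (\<lambda>x. (1 + norm x) ^ m * partial_derivs bs f x)))}"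

definition levy_measure :: "'a::euclidean_space measure \<Rightarrow> bool" where
  "levy_measure \<nu> \<longleftrightarrow> sets \<nu> = sets borel \<and> emeasure \<nu> {0} = 0 \<and>
     (\<integral>\<^sup>+u. ennreal (min 1 ((norm u)\<^sup>2)) \<partial>\<nu>) < \<infinity>"

text \<open>\<open>M\<close> is the image of the measure \<open>\<rho>\<^sub>x(dr) \<sigma>(dx)\<close> on the product of the half-line and the sphere
  under \<open>(r, x) \<mapsto> r x\<close>. This determines \<open>M\<close> from \<open>\<sigma>\<close> and \<open>\<rho>\<close>.\<close>

definition has_polar_decomposition ::
    "'a::euclidean_space measure \<Rightarrow> 'a measure \<Rightarrow> ('a \<Rightarrow> real measure) \<Rightarrow> bool" where
  "has_polar_decomposition M \<sigma> \<rho> \<longleftrightarrow> sets M = sets borel \<and>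
     (\<forall>B\<in>sets borel. emeasure M B = (\<integral>\<^sup>+x. emeasure (\<rho> x) {r. 0 < r \<and> r *\<^sub>R x \<in> B} \<partial>\<sigma>))"

text \<open>The measure \<open>g(r)/r dr\<close> on the open half-line.\<close>

definition radial_measure :: "(real \<Rightarrow> real) \<Rightarrow> real measure" where
  "radial_measure g = density (restrict_space lborel {0<..}) (\<lambda>r. ennreal (g r / r))"

text \<open>The Lebesgue--Stieltjes measure \<open>-dg\<close> on the open half-line of a decreasing right-continuous
  function \<open>g\<close>, which may be unbounded at \<open>0\<close>; this is the analogue of \<open>interval_measure\<close>.\<close>

definition decreasing_stieltjes_measure :: "(real \<Rightarrow> real) \<Rightarrow> real measure" where
  "decreasing_stieltjes_measure g =
     extend_measure {0<..} {(a, b). 0 < a \<and> a \<le> b} (\<lambda>(a, b). {a<..b}) (\<lambda>(a, b). ennreal (g a - g b))"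

lemma sets_decreasing_stieltjes_measure:
  "sets (decreasing_stieltjes_measure g) = sets (restrict_space borel {0<..})"
proof -
  let ?I = "{{a<..b} |a b::real. 0 < a \<and> a \<le> b}"
  have I: "(\<lambda>(a, b). {a<..b}) ` {(a, b). 0 < a \<and> a \<le> b} = ?I"
    by auto
  have 1: "sets (decreasing_stieltjes_measure g) = sigma_sets {0<..} ?I"
    unfolding decreasing_stieltjes_measure_def by (subst sets_extend_measure) (auto simp: I)
  have borel: "sets borel = sigma_sets UNIV (range (\<lambda>(a, b). {a<..b::real}))"
    using arg_cong[OF borel_sigma_sets_Ioc, of sets] by simp
  have Ioc: "{0<..} \<inter> {c<..d} \<in> sigma_sets {0<..} ?I" for c d :: real
  proof -
    have "{0<..} \<inter> {c<..d} = (\<Union>n. {max c (inverse (real (Suc n)))<..d})"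
    proof (intro equalityI subsetI)
      fix r assume "r \<in> {0<..} \<inter> {c<..d}"
      moreover from this obtain n where "inverse (real (Suc n)) < r"
        using reals_Archimedean[of r] by auto
      ultimately show "r \<in> (\<Union>n. {max c (inverse (real (Suc n)))<..d})"
        by auto
    next
      fix r assume "r \<in> (\<Union>n. {max c (inverse (real (Suc n)))<..d})"
      then obtain n where n: "inverse (real (Suc n)) < r" "c < r" "r \<le> d"
        by auto
      have "0 < inverse (real (Suc n))"
        by simp
      then have "0 < r"
        using n(1) by (rule order_less_trans)
      then show "r \<in> {0<..} \<inter> {c<..d}"
        using n by simp
    qed
    moreover have "{max c (inverse (real (Suc n)))<..d} \<in> sigma_sets {0<..} ?I" for n
    proof (cases "max c (inverse (real (Suc n))) \<le> d")
      case True
      moreover have "0 < max c (inverse (real (Suc n)))"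
        by (simp add: less_max_iff_disj)
      ultimately show ?thesis
        by (intro sigma_sets.Basic) blast
    next
      case False
      then have "{max c (inverse (real (Suc n)))<..d} = {}"
        by (simp only: greaterThanAtMost_empty_iff)
      then show ?thesis
        by (simp only: sigma_sets.Empty)
    qed
    ultimately show ?thesis
      by (simp only: sigma_sets.Union)
  qed
  have "{0::real<..} \<in> sigma_sets UNIV (range (\<lambda>(a, b). {a<..b}))"
    unfolding borel[symmetric] by simp
  then have "sets (restrict_space borel {0::real<..}) =
      sigma_sets {0<..} ((\<inter>) {0<..} ` range (\<lambda>(a, b). {a<..b}))"
    unfolding sets_restrict_space borel by (rule sigma_sets_Int) simp
  also have "\<dots> = sigma_sets {0<..} ?I"
  proof (rule sigma_sets_eqI)
    fix A assume "A \<in> (\<inter>) {0::real<..} ` range (\<lambda>(a, b). {a<..b})"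
    then show "A \<in> sigma_sets {0<..} ?I"
      using Ioc by auto
  next
    fix A assume "A \<in> ?I"
    then obtain c d :: real where "A = {c<..d}" "0 < c"
      by blast
    then have "A = {0<..} \<inter> {c<..d}"
      by auto
    then show "A \<in> sigma_sets {0<..} ((\<inter>) {0<..} ` range (\<lambda>(a, b). {a<..b}))"
      by (intro sigma_sets.Basic) auto
  qed
  finally show ?thesis
    using 1 by simp
qed

lemma emeasure_decreasing_stieltjes_measure_Ioc:
  assumes dec: "antimono_on {0<..} g" and cont: "continuous_on {0<..} g" and ab: "0 < a" "a \<le> b"
  shows "emeasure (decreasing_stieltjes_measure g) {a<..b} = ennreal (g a - g b)"
proof -
  define F where "F t = - g (exp t)" for t
  define N where "N = distr (interval_measure F) borel exp"
  have F_mono: "F s \<le> F t" if "s \<le> t" for s t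
    using that dec by (auto simp: F_def monotone_on_def)
  have "continuous_on UNIV F"
    unfolding F_def by (intro continuous_intros continuous_on_compose2[OF cont]) auto
  then have F_cont: "continuous (at_right t) F" for t
    by (meson UNIV_I continuous_at_imp_continuous_within continuous_on_eq_continuous_at open_UNIV)
  have N: "emeasure N {c<..d} = ennreal (g c - g d)" if "0 < c \<and> c \<le> d" for c d
  proof -
    have "c < exp t \<longleftrightarrow> ln c < t" "exp t \<le> d \<longleftrightarrow> t \<le> ln d" for t
      using that exp_less_cancel_iff[of "ln c" t] exp_le_cancel_iff[of t "ln d"] by simp_all
    then have "exp -` {c<..d} = {ln c<..ln d}"
      by auto
    then have "emeasure N {c<..d} = emeasure (interval_measure F) {ln c<..ln d}"
      by (simp add: N_def emeasure_distr)
    also have "\<dots> = ennreal (g c - g d)"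
      using that by (subst emeasure_interval_measure_Ioc[OF _ F_mono F_cont]) (auto simp: F_def)
    finally show ?thesis .
  qed
  have sub: "sets (decreasing_stieltjes_measure g) \<subseteq> sets N"
    by (auto simp: sets_decreasing_stieltjes_measure sets_restrict_space N_def)
  have "countably_additive (sets N) (emeasure N)"
    by (rule emeasure_countably_additive)
  with sub have ca: "countably_additive (sets (decreasing_stieltjes_measure g)) (emeasure N)"
    unfolding countably_additive_def by blast
  show ?thesis
    by (rule emeasure_extend_measure_Pair[OF decreasing_stieltjes_measure_def,
          where \<mu>' = "emeasure N"])
      (use ab N ca in \<open>auto simp: positive_def\<close>)
qed

text \<open>\<open>V\<^sub>a\<^sup>R(g)\<close>, the supremum over all subdivisions \<open>a = t 0 < \<dots> < t n = R\<close>.\<close>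

definition total_variation :: "real \<Rightarrow> real \<Rightarrow> (real \<Rightarrow> real) \<Rightarrow> ennreal" where
  "total_variation a R g =
     (SUP (n, t)\<in>{(n::nat, t). t 0 = a \<and> t n = R \<and> strict_mono_on {..n} t}.
        \<Sum>i=1..n. ennreal \<bar>g (t i) - g (t (i - 1))\<bar>)"

definition characteristic_function ::
    "'w measure \<Rightarrow> ('w \<Rightarrow> 'a::euclidean_space) \<Rightarrow> 'a \<Rightarrow> complex" where
  "characteristic_function M X \<xi> = (CLINT \<omega>|M. iexp (\<xi> \<bullet> X \<omega>))"

text \<open>\<open>X\<close> is self-decomposable with parameter \<open>b\<close>, without Gaussian part, and with Levy measure \<open>\<nu>\<close>.\<close>

definition self_decomposable ::
    "'w measure \<Rightarrow> ('w \<Rightarrow> 'a::euclidean_space) \<Rightarrow> 'a \<Rightarrow> 'a measure \<Rightarrow> bool" where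
  "self_decomposable M X b \<nu> \<longleftrightarrow>
     levy_measure \<nu> \<and>
     (\<exists>\<sigma> k. finite_measure \<sigma> \<and> sets \<sigma> = sets (restrict_space borel (sphere 0 1)) \<and>
        (\<forall>x\<in>sphere 0 1. \<forall>r>0. 0 \<le> k x r) \<and>
        (\<forall>x\<in>sphere 0 1. antimono_on {0<..} (k x)) \<and>
        (\<forall>r>0. (\<lambda>x. k x r) \<in> borel_measurable \<sigma>) \<and>
        has_polar_decomposition \<nu> \<sigma> (\<lambda>x. radial_measure (k x))) \<and>
     (\<forall>\<xi>. characteristic_function M X \<xi> =
        exp (\<i> * complex_of_real (b \<bullet> \<xi>) +
          (CLINT u|\<nu>. iexp (\<xi> \<bullet> u) - 1 -
             \<i> * complex_of_real (\<xi> \<bullet> u) * indicator {u. norm u \<le> 1} u)))"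

end

theory Submission
  imports Defs
begin

text \<open>
Let \<open>c = b - \<integral> k\<^sub>x(1) x \<sigma>(dx)\<close>, and let \<open>\<Psi>\<close> and \<open>\<psi>\<close> be the Levy exponents with drift and jump measure \<open>(c, \<nu>')\<close>
and \<open>(b, \<nu>)\<close>. The functional in the Stein identity, applied to \<open>exp (i\<langle>\<xi>; \<cdot>\<rangle>)\<close>, is
multiplication by \<open>\<Psi>(\<xi>)\<close>. Since \<open>k\<^sub>x(r)\<close> is the mass that \<open>-dk\<^sub>x\<close> gives to \<open>(r, \<infinity>)\<close>, Tonelli's theorem shows that \<open>\<nu>\<close> is the
image of \<open>\<nu>' \<otimes> dt/t\<close> on \<open>0 < t < 1\<close> under \<open>(u, t) \<mapsto> t u\<close>, whence
\<open>t \<cdot> d/dt \<psi>(t \<xi>) = \<Psi>(t \<xi>)\<close>. So the law of \<open>X\<close> has characteristic function \<open>\<phi> = exp \<psi>\<close> if and only if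
\<open>t \<cdot> d/dt \<phi>(t \<xi>) = \<Psi>(t \<xi>) \<phi>(t \<xi>)\<close>, which is the Stein identity for \<open>exp (i\<langle>\<xi>; \<cdot>\<rangle>)\<close>.

As \<open>X\<close> need not have a first moment, both directions pass through mixtures of exponentials. If \<open>\<phi> = exp \<psi>\<close>,
a Schwartz function convolved with a small Gaussian is such a mixture, because the Gaussian is its own
Fourier transform up to scaling; differentiate \<open>E f(t X)\<close> at \<open>t = 1\<close> in two ways and remove the smoothing.
Conversely, the identity for \<open>cos (\<langle>\<xi>; x\<rangle> + \<theta>) exp (- s\<^sup>2 \<bar>x\<bar>\<^sup>2 / 2)\<close>, which is a mixture of exponentials with
frequencies \<open>\<xi> + s Z\<close> for a standard Gaussian \<open>Z\<close>, yields the differential equation of \<open>\<phi>\<close> as \<open>s \<rightarrow> 0\<close>.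
\<close>

section \<open>Stieltjes measures as images of Lebesgue measure\<close>

text \<open>The polar formulas integrate a family of measures over \<open>x\<close>, and nothing is
  known beforehand about its measurability in \<open>x\<close>. Each \<open>-dk_x\<close> is
  therefore written as the image of Lebesgue measure under the generalized inverse of
  \<open>k_x\<close>. This inverse is jointly measurable, so \<open>\<nu>'\<close> is the image of
  an ordinary product measure, and Tonelli's theorem applies there.

  The correction in the drift \<open>c\<close> is a change of truncation. The conditions
  \<open>|u| \<le> 1\<close> and \<open>|t u| \<le> 1\<close> differ exactly for
  \<open>|u| > 1\<close> and \<open>t \<le> 1/|u|\<close>; integrating \<open>t\<close> against
  \<open>dt/t\<close> over this range gives \<open>1/|u|\<close>, so the compensator shifts by the
  integral of \<open>u/|u|\<close> over \<open>|u| > 1\<close>.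

  Differentiating \<open>E f(t X)\<close> needs only that \<open><x; grad f(x)>\<close> is bounded,
  which stands in for the missing first moment. Exponents grow quadratically in the frequency, hence
  the second moments required of mixtures.

  In the converse a derivative cannot be passed through the limit \<open>s \<rightarrow> 0\<close>
  directly: the equation is integrated over compact intervals of \<open>t > 0\<close>, passed to the
  limit and differentiated again. The singular point \<open>t = 0\<close> is reached by continuity
  alone.\<close>

lemma decreasing_stieltjes_measure_Ioi:
  assumes dec: "antimono_on {0<..} g" and cont: "continuous_on {0<..} g"
    and lim: "(g \<longlongrightarrow> 0) at_top" and a: "0 < a"
  shows "emeasure (decreasing_stieltjes_measure g) {a<..} = ennreal (g a)"
proof -
  let ?A = "\<lambda>n. {a<..a + real n}"
  have sets: "?A n \<in> sets (decreasing_stieltjes_measure g)" for n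
    using a by (auto simp: sets_decreasing_stieltjes_measure sets_restrict_space_iff)
  have U: "(\<Union>n. ?A n) = {a<..}"
  proof (intro equalityI subsetI)
    fix x assume "x \<in> {a<..}"
    moreover obtain n where "x - a \<le> real n" using real_arch_simple by blast
    ultimately show "x \<in> (\<Union>n. ?A n)" by (auto intro!: exI[of _ n])
  qed auto
  have "(\<lambda>n. emeasure (decreasing_stieltjes_measure g) (?A n)) \<longlonglongrightarrow>
      emeasure (decreasing_stieltjes_measure g) (\<Union>n. ?A n)"
    using sets by (intro Lim_emeasure_incseq) (auto simp: incseq_def)
  moreover have "emeasure (decreasing_stieltjes_measure g) (?A n) = ennreal (g a - g (a + real n))" for n
    using a by (intro emeasure_decreasing_stieltjes_measure_Ioc dec cont) auto
  moreover have "(\<lambda>n. g (a + real n)) \<longlonglongrightarrow> 0"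
    by (rule filterlim_compose[OF lim])
      (intro filterlim_tendsto_add_at_top[OF tendsto_const] filterlim_real_sequentially)
  then have "(\<lambda>n. ennreal (g a - g (a + real n))) \<longlonglongrightarrow> ennreal (g a - 0)"
    by (intro tendsto_ennrealI tendsto_intros)
  ultimately show ?thesis
    using U LIMSEQ_unique by fastforce
qed

text \<open>The generalized inverse of a decreasing \<open>g\<close>; it is \<open>0\<close> where \<open>g\<close> does not exceed \<open>y\<close>, and for \<open>y \<le> 0\<close>.\<close>

definition radial_quantile :: "(real \<Rightarrow> real) \<Rightarrow> real \<Rightarrow> real" where
  "radial_quantile g y = (if 0 < y then Sup (insert 0 {r. 0 < r \<and> y < g r}) else 0)"

text \<open>Monotonicity gives one direction. For the other, right continuity carries
  \<open>y < g a\<close> to some \<open>r > a\<close>, which makes the supremum strictly larger than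
  \<open>a\<close>. The limit at infinity bounds the set above, so that the supremum is meaningful.
  Consequently the superlevel set at \<open>a\<close> is an open interval of length
  \<open>g a\<close>, the mass of \<open>(a, \<infinity>)\<close>.\<close>

lemma less_radial_quantile_iff:
  assumes dec: "antimono_on {0<..} g" and cont: "continuous_on {0<..} g"
    and lim: "(g \<longlongrightarrow> 0) at_top" and a: "0 < a" and g: "0 \<le> g a"
  shows "a < radial_quantile g y \<longleftrightarrow> 0 < y \<and> y < g a"
proof (cases "0 < y")
  case y: True
  let ?S = "insert 0 {r. 0 < r \<and> y < g r}"
  from order_tendstoD(2)[OF lim y] obtain R where R: "\<And>r. r \<ge> R \<Longrightarrow> g r < y"
    by (auto simp: eventually_at_top_linorder)
  have bdd: "bdd_above ?S"
    using R by (intro bdd_aboveI[of _ "max 0 R"]) (smt (verit) insert_iff mem_Collect_eq)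
  have "a < Sup ?S \<longleftrightarrow> (\<exists>r>a. y < g r)"
  proof (subst less_cSup_iff[OF _ bdd])
    show "(\<exists>x\<in>?S. a < x) = (\<exists>r>a. y < g r)"
      using less_trans[OF a] by auto
  qed simp
  also have "\<dots> \<longleftrightarrow> y < g a"
  proof
    assume "\<exists>r>a. y < g r"
    then show "y < g a" using dec a unfolding monotone_on_def
      by (smt (verit) greaterThan_iff)
  next
    assume "y < g a"
    moreover have "isCont g a" using cont a by (simp add: continuous_on_eq_continuous_at)
    then have "(g \<longlongrightarrow> g a) (at_right a)"
      by (simp add: continuous_at filterlim_at_split)
    ultimately have "\<forall>\<^sub>F r in at_right a. y < g r"
      by (simp add: order_tendsto_iff)
    then show "\<exists>r>a. y < g r"
      using eventually_happens[OF eventually_conj[OF _ eventually_at_right_less[of a]]] by auto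
  qed
  finally show ?thesis using y by (simp add: radial_quantile_def)
qed (use a in \<open>auto simp: radial_quantile_def\<close>)

lemma radial_quantile_nonneg:
  assumes lim: "(g \<longlongrightarrow> 0) at_top"
  shows "0 \<le> radial_quantile g y"
proof (cases "0 < y")
  case y: True
  from order_tendstoD(2)[OF lim y] obtain R where R: "\<And>r. r \<ge> R \<Longrightarrow> g r < y"
    by (auto simp: eventually_at_top_linorder)
  have bdd: "bdd_above (insert 0 {r. 0 < r \<and> y < g r})"
    using R by (intro bdd_aboveI[of _ "max 0 R"]) (smt (verit) insert_iff mem_Collect_eq)
  then show ?thesis using y by (auto simp: radial_quantile_def intro!: cSup_upper)
qed (auto simp: radial_quantile_def)

text \<open>For \<open>a > 0\<close> the superlevel set is \<open>0 < y < k x a\<close>, which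
  involves \<open>k\<close> at the single radius \<open>a\<close> only; thus measurability in
  \<open>x\<close> at each fixed radius yields joint measurability in \<open>(x, y)\<close>. The
  level \<open>0\<close> is a countable union of such sets, and negative levels give the whole
  space.\<close>

lemma radial_quantile_borel_measurable:
  assumes dec: "\<And>x. x \<in> space S \<Longrightarrow> antimono_on {0<..} (k x)"
    and cont: "\<And>x. x \<in> space S \<Longrightarrow> continuous_on {0<..} (k x)"
    and lim: "\<And>x. x \<in> space S \<Longrightarrow> (k x \<longlongrightarrow> 0) at_top"
    and nonneg: "\<And>x r. x \<in> space S \<Longrightarrow> 0 < r \<Longrightarrow> 0 \<le> k x r"
    and meas: "\<And>r. 0 < r \<Longrightarrow> (\<lambda>x. k x r) \<in> borel_measurable S"
  shows "(\<lambda>(x, y). radial_quantile (k x) y) \<in> borel_measurable (S \<Otimes>\<^sub>M borel)"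
proof (rule borel_measurableI_greater)
  have pos: "{w \<in> space (S \<Otimes>\<^sub>M borel). a < (case w of (x, y) \<Rightarrow> radial_quantile (k x) y)}
      \<in> sets (S \<Otimes>\<^sub>M borel)" if a: "0 < a" for a
  proof -
    have [measurable]: "(\<lambda>x. k x a) \<in> borel_measurable S" by (rule meas[OF a])
    have "{w \<in> space (S \<Otimes>\<^sub>M borel). a < (case w of (x, y) \<Rightarrow> radial_quantile (k x) y)} =
        {w \<in> space (S \<Otimes>\<^sub>M borel). 0 < snd w \<and> snd w < k (fst w) a}"
      using a less_radial_quantile_iff[OF dec cont lim a nonneg]
      by (auto simp: space_pair_measure)
    also have "\<dots> \<in> sets (S \<Otimes>\<^sub>M borel)" by measurable
    finally show ?thesis .
  qed
  fix a :: real
  consider "a > 0" | "a = 0" | "a < 0" by linarith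
  then show "{w \<in> space (S \<Otimes>\<^sub>M borel). a < (case w of (x, y) \<Rightarrow> radial_quantile (k x) y)}
      \<in> sets (S \<Otimes>\<^sub>M borel)"
  proof cases
    case 2
    have "{w \<in> space (S \<Otimes>\<^sub>M borel). a < (case w of (x, y) \<Rightarrow> radial_quantile (k x) y)} =
      (\<Union>n. {w \<in> space (S \<Otimes>\<^sub>M borel).
         inverse (real (Suc n)) < (case w of (x, y) \<Rightarrow> radial_quantile (k x) y)})"
      unfolding 2
    proof (intro equalityI subsetI)
      fix w assume w: "w \<in> (\<Union>n. {w \<in> space (S \<Otimes>\<^sub>M borel).
         inverse (real (Suc n)) < (case w of (x, y) \<Rightarrow> radial_quantile (k x) y)})"
      then obtain n where "inverse (real (Suc n)) < (case w of (x, y) \<Rightarrow> radial_quantile (k x) y)" by blast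
      moreover have "0 < inverse (real (Suc n))" by simp
      ultimately have "0 < (case w of (x, y) \<Rightarrow> radial_quantile (k x) y)" by (rule less_trans[rotated])
      with w show "w \<in> {w \<in> space (S \<Otimes>\<^sub>M borel). 0 < (case w of (x, y) \<Rightarrow> radial_quantile (k x) y)}"
        by blast
    qed (use reals_Archimedean in blast)
    then show ?thesis using pos[of "inverse (real (Suc _))"] by auto
  next
    case 3
    have "{w \<in> space (S \<Otimes>\<^sub>M borel). a < (case w of (x, y) \<Rightarrow> radial_quantile (k x) y)} =
        space (S \<Otimes>\<^sub>M borel)"
    proof (intro equalityI subsetI CollectI conjI)
      fix w assume "w \<in> space (S \<Otimes>\<^sub>M (borel :: real measure))"
      then have "0 \<le> radial_quantile (k (fst w)) (snd w)"
        by (intro radial_quantile_nonneg lim) (auto simp: space_pair_measure)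
      with 3 show "a < (case w of (x, y) \<Rightarrow> radial_quantile (k x) y)"
        by (simp add: split_beta)
    qed auto
    then show ?thesis by simp
  qed (rule pos)
qed

lemma borel_measurable_radial_quantile[measurable]:
  assumes "antimono_on {0<..} g" "continuous_on {0<..} g" "(g \<longlongrightarrow> 0) at_top"
    "\<And>r. 0 < r \<Longrightarrow> 0 \<le> g r"
  shows "radial_quantile g \<in> borel_measurable borel"
proof -
  have "(\<lambda>(x, y). radial_quantile g y) \<in> borel_measurable (borel \<Otimes>\<^sub>M borel :: (real \<times> real) measure)"
    using assms by (intro radial_quantile_borel_measurable) auto
  from measurable_compose[OF measurable_Pair1'[of "0::real" borel borel] this]
  show ?thesis by simp
qed

text \<open>Inverse transform sampling for a measure of possibly infinite mass near
  \<open>0\<close>: both sides give every half-line \<open>(a, \<infinity>)\<close> with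
  \<open>a > 0\<close> the finite mass \<open>g a\<close>.\<close>

lemma emeasure_decreasing_stieltjes_measure:
  assumes dec: "antimono_on {0<..} g" and cont: "continuous_on {0<..} g"
    and lim: "(g \<longlongrightarrow> 0) at_top" and nonneg: "\<And>r. 0 < r \<Longrightarrow> 0 \<le> g r"
    and B: "B \<in> sets borel" "B \<subseteq> {0<..}"
  shows "emeasure (decreasing_stieltjes_measure g) B =
    emeasure lborel {y. radial_quantile g y \<in> B}"
proof -
  let ?\<rho> = "decreasing_stieltjes_measure g" and ?q = "radial_quantile g"
  have space: "space ?\<rho> = {0<..}"
    using sets_eq_imp_space_eq[OF sets_decreasing_stieltjes_measure[of g]]
    by (simp add: space_restrict_space)
  note [measurable] = borel_measurable_radial_quantile[OF dec cont lim nonneg]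
  \<comment> \<open>The quantile vanishes on all \<open>y \<le> 0\<close>, a set of infinite
    Lebesgue measure. It is cut off here, which is harmless because \<open>B\<close> lies in the
    open half-line and because \<open>ln\<close> is only of interest at positive arguments.\<close>
  let ?L = "restrict_space lborel {y. 0 < ?q y}"
  have ln1: "ln \<in> borel_measurable ?\<rho>"
    by (subst measurable_cong_sets[OF sets_decreasing_stieltjes_measure refl])
      (intro measurable_restrict_space1 borel_measurable_ln measurable_ident_sets refl)
  have qL: "?q \<in> borel_measurable ?L"
    by (intro measurable_restrict_space1) simp
  have ln2: "(\<lambda>y. ln (?q y)) \<in> borel_measurable ?L"
    using qL by measurable
  have inv: "(\<lambda>y. ln (?q y)) -` C \<inter> {y. 0 < ?q y} = {y. 0 < ?q y \<and> ln (?q y) \<in> C}" for C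
    by auto
  have posq: "{y. 0 < ?q y} \<in> sets lborel"
    by measurable
  have ER: "emeasure ?L {y. 0 < ?q y \<and> P y} = emeasure lborel {y. 0 < ?q y \<and> P y}" for P
    using posq by (subst emeasure_restrict_space) auto
  have less_ln: "c < ln y \<longleftrightarrow> exp c < y" if "0 < y" for c y :: real
    using that by (metis exp_less_cancel_iff exp_ln)
  have vimage: "ln -` {c<..} \<inter> {0<..} = {exp c<..}" for c :: real
    using less_ln[of _ c] by (auto intro: less_trans[OF exp_gt_zero])
  \<comment> \<open>after \<open>ln\<close>, all half-lines \<open>(c, \<infinity>)\<close> have finite mass, so they determine the measure\<close>
  have "distr ?\<rho> borel ln = distr ?L borel (\<lambda>y. ln (?q y))"
  proof (rule measure_eqI_lessThan)
    fix c :: real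
    have "emeasure (distr ?\<rho> borel ln) {c<..} = emeasure ?\<rho> {exp c<..}"
      using ln1 by (subst emeasure_distr) (simp_all add: space vimage)
    also have "\<dots> = ennreal (g (exp c))"
      by (intro decreasing_stieltjes_measure_Ioi dec cont lim) simp
    finally have 1: "emeasure (distr ?\<rho> borel ln) {c<..} = ennreal (g (exp c))" .
    have "emeasure (distr ?L borel (\<lambda>y. ln (?q y))) {c<..} = emeasure lborel {y. 0 < ?q y \<and> c < ln (?q y)}"
      using ln2 by (subst emeasure_distr)
        (simp_all add: space_restrict_space inv ER)
    also have "{y. 0 < ?q y \<and> c < ln (?q y)} = {y. exp c < ?q y}"
      using less_ln less_trans[OF exp_gt_zero[of c]] by (intro Collect_cong) blast
    also have "\<dots> = {0<..<g (exp c)}"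
      by (auto simp: less_radial_quantile_iff[OF dec cont lim exp_gt_zero nonneg[OF exp_gt_zero]])
    finally have 2: "emeasure (distr ?L borel (\<lambda>y. ln (?q y))) {c<..} = ennreal (g (exp c))"
      using nonneg[of "exp c"] by simp
    show "emeasure (distr ?\<rho> borel ln) {c<..} < \<infinity>"
      "emeasure (distr ?\<rho> borel ln) {c<..} = emeasure (distr ?L borel (\<lambda>y. ln (?q y))) {c<..}"
      using 1 2 by auto
  qed auto
  then have *: "emeasure (distr ?\<rho> borel ln) {t. exp t \<in> B} = emeasure (distr ?L borel (\<lambda>y. ln (?q y))) {t. exp t \<in> B}"
    by simp
  have C: "{t. exp t \<in> B} \<in> sets borel" using B(1) by measurable
  have "emeasure (distr ?\<rho> borel ln) {t. exp t \<in> B} = emeasure ?\<rho> B"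
    using B ln1 C by (subst emeasure_distr) (auto simp: space intro!: arg_cong2[where f=emeasure])
  moreover have "emeasure (distr ?L borel (\<lambda>y. ln (?q y))) {t. exp t \<in> B} = emeasure lborel {y. ?q y \<in> B}"
    using B ln2 C by (subst emeasure_distr)
      (auto simp: space_restrict_space inv emeasure_restrict_space intro!: arg_cong2[where f=emeasure])
  ultimately show ?thesis using * by simp
qed

section \<open>Polar decompositions and dilations\<close>

definition dilation_measure :: "real measure" where
  "dilation_measure = density lborel (\<lambda>t. ennreal (indicator {0<..<1} t / t))"

lemma sets_dilation_measure[measurable_cong, simp]: "sets dilation_measure = sets borel"
  by (simp add: dilation_measure_def)

lemma space_dilation_measure[simp]: "space dilation_measure = UNIV"
  by (simp add: dilation_measure_def)

lemma sigma_finite_dilation_measure: "sigma_finite_measure dilation_measure"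
  unfolding dilation_measure_def
  by (subst sigma_finite_measure.sigma_finite_iff_density_finite[OF lborel.sigma_finite_measure_axioms]) auto

text \<open>Scale invariance of \<open>dt/t\<close>: the substitution \<open>s = t q\<close> keeps
  the density \<open>1/s\<close> and only moves the interval \<open>(0, 1)\<close> to
  \<open>(0, q)\<close>.\<close>

lemma nn_integral_dilation_measure_ray:
  fixes x :: "'a::euclidean_space"
  assumes q: "0 < q" and B: "B \<in> sets borel"
  shows "(\<integral>\<^sup>+t. indicator B (t *\<^sub>R q *\<^sub>R x) \<partial>dilation_measure) =
    (\<integral>\<^sup>+s. ennreal (indicator {0<..<q} s / s) * indicator B (s *\<^sub>R x) \<partial>lborel)"
proof -
  have [measurable]: "B \<in> sets borel" by fact
  have "(\<integral>\<^sup>+t. indicator B (t *\<^sub>R q *\<^sub>R x) \<partial>dilation_measure) =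
      (\<integral>\<^sup>+t. ennreal (indicator {0<..<1} t / t) * indicator B ((t * q) *\<^sub>R x) \<partial>lborel)"
    unfolding dilation_measure_def by (subst nn_integral_density) auto
  also have "\<dots> = ennreal q * (\<integral>\<^sup>+t. ennreal (indicator {0<..<q} (0 + q * t) / (0 + q * t)) * indicator B ((0 + q * t) *\<^sub>R x) \<partial>lborel)"
    using q by (subst nn_integral_cmult[symmetric])
      (auto intro!: nn_integral_cong split: split_indicator simp: mult.assoc[symmetric] ennreal_mult'[symmetric] mult.commute zero_less_mult_iff)
  also have "\<dots> = (\<integral>\<^sup>+s. ennreal (indicator {0<..<q} s / s) * indicator B (s *\<^sub>R x) \<partial>lborel)"
    using q by (subst (2) nn_integral_real_affine[where c=q and t=0]) auto
  finally show ?thesis .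
qed

section \<open>Quantile representation of \<open>\<nu>'\<close>\<close>

locale polar_levy =
  fixes \<sigma> \<nu>' :: "'a::euclidean_space measure" and k :: "'a \<Rightarrow> real \<Rightarrow> real"
  assumes finite_\<sigma>: "finite_measure \<sigma>" and sets_\<sigma>: "sets \<sigma> = sets (restrict_space borel (sphere 0 1))"
    and k_nonneg: "\<And>x r. x \<in> sphere 0 1 \<Longrightarrow> r > 0 \<Longrightarrow> 0 \<le> k x r"
    and k_cont: "\<And>x. x \<in> sphere 0 1 \<Longrightarrow> continuous_on {0<..} (k x)"
    and k_dec: "\<And>x. x \<in> sphere 0 1 \<Longrightarrow> antimono_on {0<..} (k x)"
    and k_meas: "\<And>r. r > 0 \<Longrightarrow> (\<lambda>x. k x r) \<in> borel_measurable \<sigma>"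
    and k_lim: "\<And>x. x \<in> sphere 0 1 \<Longrightarrow> (k x \<longlongrightarrow> 0) at_top"
    and polar': "has_polar_decomposition \<nu>' \<sigma> (\<lambda>x. decreasing_stieltjes_measure (k x))"
    and levy': "(\<integral>\<^sup>+u. ennreal (min 1 ((norm u)\<^sup>2)) \<partial>\<nu>') < \<infinity>"
begin

abbreviation "q \<equiv> \<lambda>x. radial_quantile (k x)"

lemma space_\<sigma>: "space \<sigma> = sphere 0 1"
  using sets_eq_imp_space_eq[OF sets_\<sigma>] by (simp add: space_restrict_space)

lemma sets_\<nu>'[measurable_cong]: "sets \<nu>' = sets borel"
  using polar' by (simp add: has_polar_decomposition_def)

lemma q_measurable[measurable]: "(\<lambda>(x, y). q x y) \<in> borel_measurable (\<sigma> \<Otimes>\<^sub>M lborel)"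
proof -
  have "(\<lambda>(x, y). q x y) \<in> borel_measurable (\<sigma> \<Otimes>\<^sub>M borel)"
    by (rule radial_quantile_borel_measurable) (use k_nonneg k_cont k_dec k_meas k_lim space_\<sigma> in auto)
  then show ?thesis
    by (simp cong: measurable_cong_sets sets_pair_measure_cong)
qed

lemma ident_\<sigma>: "(\<lambda>x. x) \<in> borel_measurable \<sigma>"
  by (subst measurable_cong_sets[OF sets_\<sigma> refl]) (intro measurable_restrict_space1 measurable_ident_sets refl)

lemma q_section[measurable]: "x \<in> sphere 0 1 \<Longrightarrow> q x \<in> borel_measurable borel"
  by (intro borel_measurable_radial_quantile k_dec k_cont k_lim k_nonneg)

lemma less_q_iff: "x \<in> sphere 0 1 \<Longrightarrow> 0 < s \<Longrightarrow> s < q x y \<longleftrightarrow> 0 < y \<and> y < k x s"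
  by (intro less_radial_quantile_iff k_dec k_cont k_lim k_nonneg)

definition "quantile_space = restrict_space (\<sigma> \<Otimes>\<^sub>M lborel) {w \<in> space (\<sigma> \<Otimes>\<^sub>M lborel). 0 < (case w of (x, y) \<Rightarrow> q x y)}"

lemma Q_measurable: "(\<lambda>(x, y). q x y *\<^sub>R x) \<in> borel_measurable (\<sigma> \<Otimes>\<^sub>M lborel)"
proof -
  note [measurable] = measurable_compose[OF measurable_fst ident_\<sigma>]
  have "(\<lambda>w. (\<lambda>(x, y). q x y) w *\<^sub>R fst w) \<in> borel_measurable (\<sigma> \<Otimes>\<^sub>M lborel)" by measurable
  then show ?thesis by (simp add: split_beta')
qed

sublocale \<sigma>: finite_measure \<sigma> by (rule finite_\<sigma>)
sublocale P: pair_sigma_finite \<sigma> lborel ..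

text \<open>For fixed \<open>x\<close> the Stieltjes mass is the Lebesgue measure of a section of
  one measurable set in the product of \<open>\<sigma>\<close> and Lebesgue measure; integrating the
  sections gives the product measure of that set. This replaces the family of measures indexed by
  \<open>x\<close> by a single sigma-finite product.\<close>

lemma distr_quantile_space: "\<nu>' = distr quantile_space borel (\<lambda>(x, y). q x y *\<^sub>R x)"
proof (rule measure_eqI)
  fix B assume "B \<in> sets \<nu>'"
  then have B[measurable]: "B \<in> sets borel" by (simp add: sets_\<nu>')
  note [measurable] = Q_measurable
  let ?W = "{w \<in> space (\<sigma> \<Otimes>\<^sub>M lborel). 0 < (case w of (x, y) \<Rightarrow> q x y) \<and> (case w of (x, y) \<Rightarrow> q x y *\<^sub>R x) \<in> B}"
  have W: "?W \<in> sets (\<sigma> \<Otimes>\<^sub>M lborel)" by measurable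
  have \<Omega>: "{w \<in> space (\<sigma> \<Otimes>\<^sub>M lborel). 0 < (case w of (x, y) \<Rightarrow> q x y)} \<in> sets (\<sigma> \<Otimes>\<^sub>M lborel)" by measurable
  have "emeasure \<nu>' B = (\<integral>\<^sup>+x. emeasure (decreasing_stieltjes_measure (k x)) {r. 0 < r \<and> r *\<^sub>R x \<in> B} \<partial>\<sigma>)"
    using polar' B by (auto simp: has_polar_decomposition_def)
  also have "\<dots> = (\<integral>\<^sup>+x. emeasure lborel (Pair x -` ?W) \<partial>\<sigma>)"
  proof (rule nn_integral_cong)
    fix x assume "x \<in> space \<sigma>"
    then have x: "x \<in> sphere 0 1" by (simp add: space_\<sigma>)
    have "{r. 0 < r \<and> r *\<^sub>R x \<in> B} \<in> sets borel" by measurable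
    then have "emeasure (decreasing_stieltjes_measure (k x)) {r. 0 < r \<and> r *\<^sub>R x \<in> B}
      = emeasure lborel {y. radial_quantile (k x) y \<in> {r. 0 < r \<and> r *\<^sub>R x \<in> B}}"
      by (intro emeasure_decreasing_stieltjes_measure k_dec k_cont k_lim k_nonneg x) auto
    also have "{y. radial_quantile (k x) y \<in> {r. 0 < r \<and> r *\<^sub>R x \<in> B}} = Pair x -` ?W"
      using x by (auto simp: space_pair_measure space_\<sigma>)
    finally show "emeasure (decreasing_stieltjes_measure (k x)) {r. 0 < r \<and> r *\<^sub>R x \<in> B} = emeasure lborel (Pair x -` ?W)" .
  qed
  also have "\<dots> = emeasure (\<sigma> \<Otimes>\<^sub>M lborel) ?W"
    using W by (simp add: lborel.emeasure_pair_measure_alt)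
  also have "\<dots> = emeasure (distr quantile_space borel (\<lambda>(x, y). q x y *\<^sub>R x)) B"
    unfolding quantile_space_def
    apply (subst emeasure_distr)
      apply (rule measurable_restrict_space1[OF Q_measurable]) apply (rule B)
    apply (subst emeasure_restrict_space) using \<Omega>
    by (auto simp: space_restrict_space intro!: arg_cong2[where f=emeasure])
  finally show "emeasure \<nu>' B = emeasure (distr quantile_space borel (\<lambda>(x, y). q x y *\<^sub>R x)) B" .
qed (simp add: sets_\<nu>')

lemma nn_integral_\<nu>':
  assumes H[measurable]: "H \<in> borel_measurable borel"
  shows "(\<integral>\<^sup>+u. H u \<partial>\<nu>') = (\<integral>\<^sup>+x. \<integral>\<^sup>+y. H (q x y *\<^sub>R x) * indicator {y. 0 < q x y} y \<partial>lborel \<partial>\<sigma>)"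
proof -
  note [measurable] = Q_measurable
  have \<Omega>: "{w \<in> space (\<sigma> \<Otimes>\<^sub>M lborel). 0 < (case w of (x, y) \<Rightarrow> q x y)} \<in> sets (\<sigma> \<Otimes>\<^sub>M lborel)" by measurable
  have "(\<integral>\<^sup>+u. H u \<partial>\<nu>') = (\<integral>\<^sup>+w. H (case w of (x, y) \<Rightarrow> q x y *\<^sub>R x) \<partial>quantile_space)"
  proof (subst distr_quantile_space, rule nn_integral_distr)
    show "(\<lambda>(x, y). q x y *\<^sub>R x) \<in> quantile_space \<rightarrow>\<^sub>M borel"
      unfolding quantile_space_def by (intro measurable_restrict_space1 Q_measurable)
  qed simp
  also have "\<dots> = (\<integral>\<^sup>+w. H (case w of (x, y) \<Rightarrow> q x y *\<^sub>R x) *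
      indicator {w \<in> space (\<sigma> \<Otimes>\<^sub>M lborel). 0 < (case w of (x, y) \<Rightarrow> q x y)} w \<partial>(\<sigma> \<Otimes>\<^sub>M lborel))"
    unfolding quantile_space_def using \<Omega> by (subst nn_integral_restrict_space) auto
  also have "\<dots> = (\<integral>\<^sup>+x. \<integral>\<^sup>+y. H (case (x, y) of (x, y) \<Rightarrow> q x y *\<^sub>R x) *
      indicator {w \<in> space (\<sigma> \<Otimes>\<^sub>M lborel). 0 < (case w of (x, y) \<Rightarrow> q x y)} (x, y) \<partial>lborel \<partial>\<sigma>)"
  proof (rule lborel.nn_integral_fst[symmetric])
    show "(\<lambda>w. H (case w of (x, y) \<Rightarrow> q x y *\<^sub>R x) *
        indicator {w \<in> space (\<sigma> \<Otimes>\<^sub>M lborel). 0 < (case w of (x, y) \<Rightarrow> q x y)} w)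
      \<in> borel_measurable (\<sigma> \<Otimes>\<^sub>M lborel)"
      using \<Omega> measurable_compose[OF Q_measurable H]
      by (intro borel_measurable_times_ennreal borel_measurable_indicator)
  qed
  also have "\<dots> = (\<integral>\<^sup>+x. \<integral>\<^sup>+y. H (q x y *\<^sub>R x) * indicator {y. 0 < q x y} y \<partial>lborel \<partial>\<sigma>)"
    by (intro nn_integral_cong) (auto simp: space_pair_measure split: split_indicator)
  finally show ?thesis .
qed

text \<open>Points \<open>q x y *\<^sub>R x\<close> with positive quantile and unit \<open>x\<close>
  avoid the origin. The weight \<open>min 1 ((norm u)\<^sup>2)\<close> does not control an atom
  there, so this is what completes sigma-finiteness of \<open>\<nu>'\<close> in
  \<open>levy_jumps\<close>.\<close>

lemma emeasure_\<nu>'_0: "emeasure \<nu>' {0} = 0"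
proof -
  have "emeasure \<nu>' {0} = (\<integral>\<^sup>+u. indicator {0} u \<partial>\<nu>')"
    by (simp add: sets_\<nu>')
  also have "\<dots> = (\<integral>\<^sup>+x. \<integral>\<^sup>+y. indicator {0} (q x y *\<^sub>R x) * indicator {y. 0 < q x y} y \<partial>lborel \<partial>\<sigma>)"
    by (rule nn_integral_\<nu>') simp
  also have "\<dots> = (\<integral>\<^sup>+x. \<integral>\<^sup>+y. 0 \<partial>(lborel :: real measure) \<partial>\<sigma>)"
    by (rule nn_integral_cong, rule nn_integral_cong) (auto simp: space_\<sigma> split: split_indicator)
  finally show ?thesis by simp
qed

text \<open>On the ray through \<open>x\<close> the image has density \<open>1/s\<close> times the
  Lebesgue measure of those \<open>y\<close> with \<open>s < q x y\<close>. By
  \<open>less_q_iff\<close> they form the interval from \<open>0\<close> to \<open>k x s\<close>,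
  which leaves the radial density \<open>k x s / s\<close> of \<open>\<nu>\<close>.\<close>

lemma dilation_image:
  assumes polar: "has_polar_decomposition \<nu> \<sigma> (\<lambda>x. radial_measure (k x))"
  shows "\<nu> = distr (\<nu>' \<Otimes>\<^sub>M dilation_measure) borel (\<lambda>(u, t). t *\<^sub>R u)"
proof (rule measure_eqI)
  show sets_eq: "sets \<nu> = sets (distr (\<nu>' \<Otimes>\<^sub>M dilation_measure) borel (\<lambda>(u, t). t *\<^sub>R u))"
    using polar by (simp add: has_polar_decomposition_def)
  interpret D: sigma_finite_measure dilation_measure by (rule sigma_finite_dilation_measure)
  fix B assume "B \<in> sets \<nu>"
  then have B[measurable]: "B \<in> sets borel" using sets_eq by simp
  define h where "h u = (\<integral>\<^sup>+t. indicator B (t *\<^sub>R u) \<partial>dilation_measure)" for u :: 'a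
  have h[measurable]: "h \<in> borel_measurable borel" unfolding h_def by measurable
  have "emeasure (distr (\<nu>' \<Otimes>\<^sub>M dilation_measure) borel (\<lambda>(u, t). t *\<^sub>R u)) B =
    (\<integral>\<^sup>+w. indicator B (case w of (u, t) \<Rightarrow> t *\<^sub>R u) \<partial>(\<nu>' \<Otimes>\<^sub>M dilation_measure))"
  proof -
    have "emeasure (distr (\<nu>' \<Otimes>\<^sub>M dilation_measure) borel (\<lambda>(u, t). t *\<^sub>R u)) B =
      (\<integral>\<^sup>+v. indicator B v \<partial>distr (\<nu>' \<Otimes>\<^sub>M dilation_measure) borel (\<lambda>(u, t). t *\<^sub>R u))"
      by simp
    also have "\<dots> = (\<integral>\<^sup>+w. indicator B (case w of (u, t) \<Rightarrow> t *\<^sub>R u) \<partial>(\<nu>' \<Otimes>\<^sub>M dilation_measure))"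
      by (rule nn_integral_distr) measurable
    finally show ?thesis .
  qed
  also have "\<dots> = (\<integral>\<^sup>+u. h u \<partial>\<nu>')"
    unfolding h_def by (subst D.nn_integral_fst[symmetric]) simp_all
  also have "\<dots> = (\<integral>\<^sup>+x. \<integral>\<^sup>+y. h (q x y *\<^sub>R x) * indicator {y. 0 < q x y} y \<partial>lborel \<partial>\<sigma>)"
    by (rule nn_integral_\<nu>') fact
  also have "\<dots> = (\<integral>\<^sup>+x. emeasure (radial_measure (k x)) {r. 0 < r \<and> r *\<^sub>R x \<in> B} \<partial>\<sigma>)"
  proof (rule nn_integral_cong)
    fix x assume "x \<in> space \<sigma>"
    then have x: "x \<in> sphere 0 1" by (simp add: space_\<sigma>)
    note [measurable] = q_section[OF x]
    have kx: "k x \<in> borel_measurable (restrict_space borel {0<..})"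
      by (rule borel_measurable_continuous_on_restrict[OF k_cont[OF x]])
    have "(\<integral>\<^sup>+y. h (q x y *\<^sub>R x) * indicator {y. 0 < q x y} y \<partial>lborel) =
        (\<integral>\<^sup>+y. \<integral>\<^sup>+s. (ennreal (indicator {0<..} s / s) * indicator B (s *\<^sub>R x)) * indicator {(s, y). s < q x y} (s, y) \<partial>lborel \<partial>lborel)"
    proof (rule nn_integral_cong)
      fix y
      show "h (q x y *\<^sub>R x) * indicator {y. 0 < q x y} y = (\<integral>\<^sup>+s. (ennreal (indicator {0<..} s / s) * indicator B (s *\<^sub>R x)) * indicator {(s, y). s < q x y} (s, y) \<partial>lborel)"
      proof (cases "0 < q x y")
        case True
        then show ?thesis unfolding h_def
          by (subst nn_integral_dilation_measure_ray[OF True B]) (auto intro!: nn_integral_cong split: split_indicator)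
      next
        case False
        then have "(\<integral>\<^sup>+s. (ennreal (indicator {0<..} s / s) * indicator B (s *\<^sub>R x)) * indicator {(s, y). s < q x y} (s, y) \<partial>lborel) = (\<integral>\<^sup>+s. 0 \<partial>lborel)"
          by (subst nn_integral_cong[where v="\<lambda>_. 0"]) (auto split: split_indicator)
        then show ?thesis using False by simp
      qed
    qed
    \<comment> \<open>The upper limit \<open>q x y\<close> of the radial integral has been encoded
      as the indicator of \<open>s < q x y\<close>, so that after the exchange it restricts
      \<open>y\<close> for fixed \<open>s\<close>.\<close>
    also have "\<dots> = (\<integral>\<^sup>+s. \<integral>\<^sup>+y. (ennreal (indicator {0<..} s / s) * indicator B (s *\<^sub>R x)) * indicator {(s, y). s < q x y} (s, y) \<partial>lborel \<partial>lborel)"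
      by (rule lborel_pair.Fubini') measurable
    also have "\<dots> = (\<integral>\<^sup>+s. ennreal (k x s / s) * indicator {r. 0 < r \<and> r *\<^sub>R x \<in> B} s * indicator {0<..} s \<partial>lborel)"
    proof (rule nn_integral_cong)
      fix s :: real
      show "(\<integral>\<^sup>+y. (ennreal (indicator {0<..} s / s) * indicator B (s *\<^sub>R x)) * indicator {(s, y). s < q x y} (s, y) \<partial>lborel) = ennreal (k x s / s) * indicator {r. 0 < r \<and> r *\<^sub>R x \<in> B} s * indicator {0<..} s"
      proof (cases "0 < s")
        case s: True
        have "(\<integral>\<^sup>+y. (ennreal (indicator {0<..} s / s) * indicator B (s *\<^sub>R x)) * indicator {(s, y). s < q x y} (s, y) \<partial>lborel) =
          (ennreal (indicator {0<..} s / s) * indicator B (s *\<^sub>R x)) * (\<integral>\<^sup>+y. indicator {0<..<k x s} y \<partial>lborel)"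
          by (subst nn_integral_cmult[symmetric]) (auto intro!: nn_integral_cong simp: less_q_iff[OF x s] split: split_indicator)
        also have "\<dots> = (ennreal (1 / s) * indicator B (s *\<^sub>R x)) * ennreal (k x s)"
          using s k_nonneg[OF x s] by simp
        also have "\<dots> = ennreal (k x s / s) * indicator {r. 0 < r \<and> r *\<^sub>R x \<in> B} s * indicator {0<..} s"
          using s k_nonneg[OF x s] by (auto split: split_indicator simp: ennreal_mult'[symmetric])
        finally show ?thesis .
      qed simp
    qed
    also have "\<dots> = emeasure (radial_measure (k x)) {r. 0 < r \<and> r *\<^sub>R x \<in> B}"
    proof -
      have R: "{r. 0 < r \<and> r *\<^sub>R x \<in> B} \<in> sets (restrict_space lborel {0<..})"
        by (subst sets_restrict_space_iff) auto
      have "(\<lambda>r. ennreal (k x r / r)) \<in> borel_measurable (restrict_space borel {0<..})"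
        by (intro measurable_compose[OF _ measurable_ennreal] borel_measurable_divide kx
            measurable_restrict_space1 measurable_ident_sets refl)
      then have m: "(\<lambda>r. ennreal (k x r / r)) \<in> borel_measurable (restrict_space lborel {0<..})"
        by (simp add: measurable_def space_restrict_space sets_restrict_space)
      show ?thesis unfolding radial_measure_def
        by (subst emeasure_density[OF m R], subst nn_integral_restrict_space) auto
    qed
    finally show "(\<integral>\<^sup>+y. h (q x y *\<^sub>R x) * indicator {y. 0 < q x y} y \<partial>lborel) = emeasure (radial_measure (k x)) {r. 0 < r \<and> r *\<^sub>R x \<in> B}" .
  qed
  also have "\<dots> = emeasure \<nu> B"
    using polar B by (auto simp: has_polar_decomposition_def)
  finally show "emeasure \<nu> B = emeasure (distr (\<nu>' \<Otimes>\<^sub>M dilation_measure) borel (\<lambda>(u, t). t *\<^sub>R u)) B" by simp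
qed

text \<open>This identifies the truncation correction with the surface term of the Stein identity:
  in direction \<open>x\<close> the jumps longer than \<open>1\<close> have mass
  \<open>k x 1\<close>, and normalizing a jump retains only its direction.\<close>

lemma integral_direction:
  "(LINT u|\<nu>'. (indicator {u. 1 < norm u} u / norm u) *\<^sub>R u) = (LINT x|\<sigma>. k x 1 *\<^sub>R x)"
proof -
  define \<rho> where "\<rho> = distr (restrict_space \<nu>' {u. 1 < norm u}) borel (\<lambda>u. (1 / norm u) *\<^sub>R u)"
  have A: "{u. 1 < norm u} \<in> sets \<nu>'" by (simp add: sets_\<nu>')
  have "(LINT u|\<nu>'. (indicator {u. 1 < norm u} u / norm u) *\<^sub>R u) = (LINT u|restrict_space \<nu>' {u. 1 < norm u}. (1 / norm u) *\<^sub>R u)"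
    using A by (subst integral_restrict_space) (auto intro!: Bochner_Integration.integral_cong split: split_indicator)
  also have "\<dots> = (LINT x|\<rho>. x)"
    unfolding \<rho>_def by (subst integral_distr) (auto intro!: measurable_restrict_space1 simp: sets_\<nu>' cong: measurable_cong_sets)
  \<comment> \<open>The law of the directions of long jumps has density \<open>k x 1\<close> with
    respect to \<open>\<sigma>\<close>, because \<open>1 < q x y\<close> holds exactly for
    \<open>y\<close> between \<open>0\<close> and \<open>k x 1\<close>.\<close>
  also have "\<rho> = distr (density \<sigma> (\<lambda>x. ennreal (k x 1))) borel (\<lambda>x. x)"
  proof (rule measure_eqI)
    fix B assume "B \<in> sets \<rho>"
    then have B[measurable]: "B \<in> sets borel" by (simp add: \<rho>_def)
    have [measurable]: "(\<lambda>x. k x 1) \<in> borel_measurable \<sigma>" by (rule k_meas) simp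
    have C: "{u. 1 < norm u \<and> (1 / norm u) *\<^sub>R u \<in> B} \<in> sets borel" by measurable
    have "emeasure \<rho> B = emeasure \<nu>' {u. 1 < norm u \<and> (1 / norm u) *\<^sub>R u \<in> B}"
      unfolding \<rho>_def
      apply (subst emeasure_distr)
        apply (rule measurable_restrict_space1) apply measurable
      apply (subst emeasure_restrict_space) using A
      by (auto simp: space_restrict_space sets_eq_imp_space_eq[OF sets_\<nu>'] intro!: arg_cong2[where f=emeasure])
    also have "\<dots> = (\<integral>\<^sup>+u. indicator {u. 1 < norm u \<and> (1 / norm u) *\<^sub>R u \<in> B} u \<partial>\<nu>')"
      using C by (simp add: sets_\<nu>')
    also have "\<dots> = (\<integral>\<^sup>+x. \<integral>\<^sup>+y. indicator B x * indicator {0<..<k x 1} y \<partial>lborel \<partial>\<sigma>)"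
      apply (subst nn_integral_\<nu>') using C apply measurable
    proof (intro nn_integral_cong)
      fix x y assume "x \<in> space \<sigma>"
      then have x: "norm x = 1" by (simp add: space_\<sigma>)
      then have "1 < q x y \<longleftrightarrow> 0 < y \<and> y < k x 1" using less_q_iff[of x 1 y] by simp
      moreover have "1 < norm (q x y *\<^sub>R x) \<longleftrightarrow> 1 < q x y" if "0 < q x y" using that x by simp
      moreover have "0 < q x y" if "1 < q x y" using that by linarith
      ultimately show "indicator {u. 1 < norm u \<and> (1 / norm u) *\<^sub>R u \<in> B} (q x y *\<^sub>R x) * indicator {y. 0 < q x y} y
        = (indicator B x * indicator {0<..<k x 1} y :: ennreal)"
        using x by (auto split: split_indicator)
    qed
    also have "\<dots> = (\<integral>\<^sup>+x. ennreal (k x 1) * indicator B x \<partial>\<sigma>)"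
      by (intro nn_integral_cong, subst nn_integral_cmult) (auto simp: space_\<sigma> k_nonneg mult.commute)
    also have "\<dots> = emeasure (distr (density \<sigma> (\<lambda>x. ennreal (k x 1))) borel (\<lambda>x. x)) B"
      using measurable_sets[OF ident_\<sigma> B]
      by (subst emeasure_distr, use ident_\<sigma> in simp, simp, subst emeasure_density)
        (auto intro!: nn_integral_cong split: split_indicator)
    finally show "emeasure \<rho> B = emeasure (distr (density \<sigma> (\<lambda>x. ennreal (k x 1))) borel (\<lambda>x. x)) B" .
  qed (simp add: \<rho>_def)
  also have "(LINT x|distr (density \<sigma> (\<lambda>x. ennreal (k x 1))) borel (\<lambda>x. x). x) = (LINT x|\<sigma>. k x 1 *\<^sub>R x)"
    using ident_\<sigma> by (subst integral_distr, simp, simp, subst integral_density) (auto simp: space_\<sigma> k_nonneg k_meas)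
  finally show ?thesis .
qed

end

section \<open>Levy exponents and mixtures of exponentials\<close>

text \<open>The mean value inequality bounds the difference quotients by \<open>w\<close>, so
  dominated convergence applies along every sequence tending to \<open>t0\<close>. Measurability of
  \<open>f' t0\<close> is not assumed; it is inherited from the difference quotients as their
  pointwise limit.\<close>

lemma DERIV_integral:
  fixes f :: "real \<Rightarrow> 'w \<Rightarrow> real"
  assumes int: "\<And>t. t \<in> {a<..<b} \<Longrightarrow> integrable M (f t)"
    and der: "\<And>t x. t \<in> {a<..<b} \<Longrightarrow> x \<in> space M \<Longrightarrow> ((\<lambda>t. f t x) has_real_derivative f' t x) (at t)"
    and bd: "\<And>t x. t \<in> {a<..<b} \<Longrightarrow> x \<in> space M \<Longrightarrow> \<bar>f' t x\<bar> \<le> w x"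
    and w: "integrable M w" and t0: "t0 \<in> {a<..<b}"
  shows "((\<lambda>t. LINT x|M. f t x) has_real_derivative (LINT x|M. f' t0 x)) (at t0)"
proof -
  have "((\<lambda>t. LINT x|M. f t x) has_real_derivative (LINT x|M. f' t0 x)) (at t0 within {a<..<b})"
    unfolding has_field_derivative_iff tendsto_at_iff_sequentially
  proof (intro allI impI)
    fix X :: "nat \<Rightarrow> real" assume X: "\<forall>i. X i \<in> {a<..<b} - {t0}" "X \<longlonglongrightarrow> t0"
    let ?s = "\<lambda>i x. (f (X i) x - f t0 x) / (X i - t0)"
    have lim: "(\<lambda>i. ?s i x) \<longlonglongrightarrow> f' t0 x" if "x \<in> space M" for x
    proof -
      have "((\<lambda>t. (f t x - f t0 x) / (t - t0)) \<longlongrightarrow> f' t0 x) (at t0)"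
        using der[OF t0 that] by (simp add: has_field_derivative_iff)
      from this[unfolded tendsto_at_iff_sequentially] X show ?thesis
        by (auto simp: comp_def)
    qed
    have meas: "?s i \<in> borel_measurable M" for i
      using int[of "X i"] int[OF t0] X(1) by (intro borel_measurable_divide borel_measurable_diff) auto
    have "(\<lambda>i. LINT x|M. ?s i x) \<longlonglongrightarrow> (LINT x|M. f' t0 x)"
    proof (rule integral_dominated_convergence[OF _ meas w])
      show "f' t0 \<in> borel_measurable M"
        by (rule borel_measurable_LIMSEQ_real[OF lim meas])
      show "AE x in M. (\<lambda>i. ?s i x) \<longlonglongrightarrow> f' t0 x" using lim by auto
      show "AE x in M. norm (?s i x) \<le> w x" for i
      proof (rule AE_I2)
        fix x assume x: "x \<in> space M"
        have "norm (f (X i) x - f t0 x) \<le> w x * norm (X i - t0)"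
        proof (rule field_differentiable_bound[where S="{a<..<b}" and f="\<lambda>t. f t x" and f'="\<lambda>t. f' t x"])
          show "((\<lambda>t. f t x) has_field_derivative f' z x) (at z within {a<..<b})" if "z \<in> {a<..<b}" for z
            using der[OF that x] by (rule has_field_derivative_at_within)
          show "norm (f' z x) \<le> w x" if "z \<in> {a<..<b}" for z
            using bd[OF that x] by simp
        qed (use X t0 in auto)
        moreover have "X i - t0 \<noteq> 0" using X by auto
        ultimately show "norm (?s i x) \<le> w x"
          by (simp add: divide_le_eq)
      qed
    qed
    moreover have eq: "(LINT x|M. ?s i x) = ((LINT x|M. f (X i) x) - (LINT x|M. f t0 x)) / (X i - t0)" for i
      unfolding integral_divide_zero using int[of "X i"] int[OF t0] X(1)
      by (subst Bochner_Integration.integral_diff) auto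
    ultimately show "((\<lambda>y. ((LINT x|M. f y x) - (LINT x|M. f t0 x)) / (y - t0)) \<circ> X) \<longlonglongrightarrow> (LINT x|M. f' t0 x)"
      by (simp only: comp_def eq)
  qed
  then show ?thesis using t0 at_within_open[of t0 "{a<..<b}"] by simp
qed

lemma (in pair_sigma_finite) integrable_product:
  fixes f g :: "_ \<Rightarrow> real"
  assumes f: "integrable M1 f" and g: "integrable M2 g"
  shows "integrable (M1 \<Otimes>\<^sub>M M2) (\<lambda>(x, y). f x * g y)"
proof (rule Fubini_integrable)
  have [measurable]: "f \<in> borel_measurable M1" "g \<in> borel_measurable M2" using f g by auto
  show "(\<lambda>(x, y). f x * g y) \<in> borel_measurable (M1 \<Otimes>\<^sub>M M2)" by measurable
  show "integrable M1 (\<lambda>x. \<integral>y. norm (case (x, y) of (x, y) \<Rightarrow> f x * g y) \<partial>M2)"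
    using f by (simp add: abs_mult)
qed (use g in auto)

section \<open>Integrability, continuity and growth of Levy exponents\<close>

definition levy_kernel :: "'a::euclidean_space \<Rightarrow> 'a \<Rightarrow> complex" where
  "levy_kernel \<xi> u = iexp (\<xi> \<bullet> u) - 1 - \<i> * complex_of_real (\<xi> \<bullet> u) * indicator {u. norm u \<le> 1} u"

lemma levy_kernel_measurable[measurable]:
  "(\<lambda>(\<xi>, u). levy_kernel \<xi> u) \<in> borel_measurable (borel \<Otimes>\<^sub>M borel :: ('a::euclidean_space \<times> 'a) measure)"
  unfolding levy_kernel_def by measurable

text \<open>Taylor's formula of second order gives at most
  \<open>(norm \<xi>)\<^sup>2 * (norm u)\<^sup>2 / 2\<close> for small jumps, and the triangle
  inequality gives \<open>2\<close> for large ones. The constant is chosen to cover both cases at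
  once and shows the quadratic growth in \<open>\<xi>\<close>.\<close>

lemma norm_levy_kernel_le: "cmod (levy_kernel \<xi> u) \<le> 2 * (1 + (norm \<xi>)\<^sup>2) * min 1 ((norm u)\<^sup>2)"
proof (cases "norm u \<le> 1")
  case True
  have "cmod (levy_kernel \<xi> u) \<le> (\<xi> \<bullet> u)\<^sup>2 / 2"
    using iexp_approx1[of "\<xi> \<bullet> u" 1] True
    by (simp add: levy_kernel_def numeral_2_eq_2 algebra_simps)
  also have "\<dots> \<le> (norm \<xi> * norm u)\<^sup>2 / 2"
    using Cauchy_Schwarz_ineq2[of \<xi> u] by (intro divide_right_mono abs_le_square_iff[THEN iffD1]) auto
  also have "\<dots> \<le> 2 * (1 + (norm \<xi>)\<^sup>2) * (norm u)\<^sup>2"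
    by (simp add: power_mult_distrib algebra_simps)
  also have "(norm u)\<^sup>2 = min 1 ((norm u)\<^sup>2)"
    using True by (simp add: min_absorb2 power_le_one)
  finally show ?thesis .
next
  case False
  have "cmod (levy_kernel \<xi> u) \<le> cmod (iexp (\<xi> \<bullet> u)) + cmod 1"
    using False norm_triangle_ineq4[of "iexp (\<xi> \<bullet> u)" 1] by (simp add: levy_kernel_def)
  also have "\<dots> \<le> 2 * (1 + (norm \<xi>)\<^sup>2)" by simp
  also have "\<dots> = 2 * (1 + (norm \<xi>)\<^sup>2) * min 1 ((norm u)\<^sup>2)"
    using False one_le_power[of "norm u" 2] by (simp add: min_absorb1)
  finally show ?thesis .
qed

text \<open>The gradient is a separate argument \<open>g\<close>, so that mixtures and smoothed
  functions can be inserted together with the vector field obtained by differentiating under the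
  integral.\<close>

definition jump_remainder :: "('a::euclidean_space \<Rightarrow> real) \<Rightarrow> ('a \<Rightarrow> 'a) \<Rightarrow> 'a \<Rightarrow> 'a \<Rightarrow> real" where
  "jump_remainder f g y u = f (y + u) - f y - (g y \<bullet> u) * indicator {u. norm u \<le> 1} u"

locale levy_jumps =
  fixes \<nu> :: "'a::euclidean_space measure" and c :: 'a
  assumes sets_eq[measurable_cong]: "sets \<nu> = sets borel"
    and emeasure_0: "emeasure \<nu> {0} = 0"
    and finite_weight: "(\<integral>\<^sup>+u. ennreal (min 1 ((norm u)\<^sup>2)) \<partial>\<nu>) < \<infinity>"
begin

lemma integrable_weight: "integrable \<nu> (\<lambda>u. min 1 ((norm u)\<^sup>2))"
  using finite_weight by (intro integrableI_nonneg) auto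

text \<open>By Markov's inequality each set \<open>?A n\<close>, where the integrable weight is
  bounded below, has finite mass. These sets exhaust everything except the origin, which is a null
  set.\<close>

lemma sigma_finite: "sigma_finite_measure \<nu>"
proof
  let ?A = "\<lambda>n::nat. {u::'a. inverse (real (Suc n)) \<le> min 1 ((norm u)\<^sup>2)}"
  have fin: "emeasure \<nu> (?A n) \<noteq> \<infinity>" for n
  proof -
    have "emeasure \<nu> (?A n) \<le> ennreal (real (Suc n)) * (\<integral>\<^sup>+u. ennreal (min 1 ((norm u)\<^sup>2)) * indicator (space \<nu>) u \<partial>\<nu>)"
    proof -
      have "?A n = {u \<in> space \<nu>. 1 \<le> ennreal (real (Suc n)) * ennreal (min 1 ((norm u)\<^sup>2))}"
      proof -
        have "1 \<le> ennreal (real (Suc n)) * ennreal r \<longleftrightarrow> inverse (real (Suc n)) \<le> r" if "0 \<le> r" for r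
        proof -
          have "1 \<le> ennreal (real (Suc n)) * ennreal r \<longleftrightarrow> ennreal 1 \<le> ennreal (real (Suc n) * r)"
            by (simp add: ennreal_mult')
          also have "\<dots> \<longleftrightarrow> 1 \<le> real (Suc n) * r"
            using that by (intro ennreal_le_iff) simp
          also have "\<dots> \<longleftrightarrow> inverse (real (Suc n)) \<le> r"
            by (simp add: field_simps del: of_nat_Suc)
          finally show ?thesis .
        qed
        from this[of "min 1 ((norm (_::'a))\<^sup>2)"] show ?thesis
          using sets_eq_imp_space_eq[OF sets_eq] by auto
      qed
      then show ?thesis using nn_integral_Markov_inequality[of "\<lambda>u. ennreal (min 1 ((norm u)\<^sup>2))" "space \<nu>" \<nu> "ennreal (real (Suc n))"]
        by auto
    qed
    also have "\<dots> = ennreal (real (Suc n)) * (\<integral>\<^sup>+u. ennreal (min 1 ((norm u)\<^sup>2)) \<partial>\<nu>)"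
      by (intro arg_cong2[where f="(*)"] nn_integral_cong) auto
    also have "\<dots> < \<infinity>" using finite_weight by (simp add: ennreal_mult_less_top)
    finally show ?thesis by simp
  qed
  have un: "u \<in> (\<Union>n. ?A n) \<union> {0}" for u
  proof (cases "u = 0")
    case False
    then have "0 < min 1 ((norm u)\<^sup>2)" by simp
    from reals_Archimedean[OF this] show ?thesis by (auto intro: less_imp_le)
  qed simp
  show "\<exists>A. countable A \<and> A \<subseteq> sets \<nu> \<and> \<Union> A = space \<nu> \<and> (\<forall>a\<in>A. emeasure \<nu> a \<noteq> \<infinity>)"
  proof (intro exI[of _ "insert {0} (range ?A)"] conjI)
    show "\<Union> (insert {0} (range ?A)) = space \<nu>"
      using un sets_eq_imp_space_eq[OF sets_eq] by auto
    show "insert {0} (range ?A) \<subseteq> sets \<nu>" by (auto simp: sets_eq)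
    show "\<forall>a\<in>insert {0} (range ?A). emeasure \<nu> a \<noteq> \<infinity>" using fin emeasure_0 by auto
  qed auto
qed

sublocale sigma_finite_measure \<nu> by (rule sigma_finite)

lemma integrable_levy_kernel: "integrable \<nu> (levy_kernel \<xi>)"
proof (rule Bochner_Integration.integrable_bound)
  show "integrable \<nu> (\<lambda>u. 2 * (1 + (norm \<xi>)\<^sup>2) * min 1 ((norm u)\<^sup>2))"
    using integrable_weight by simp
  show "AE u in \<nu>. norm (levy_kernel \<xi> u) \<le> norm (2 * (1 + (norm \<xi>)\<^sup>2) * min 1 ((norm u)\<^sup>2))"
    using norm_levy_kernel_le[of \<xi>] by (intro AE_I2) (simp add: abs_mult)
qed simp

definition exponent :: "'a \<Rightarrow> complex" where
  "exponent \<xi> = \<i> * complex_of_real (c \<bullet> \<xi>) + (CLINT u|\<nu>. levy_kernel \<xi> u)"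

lemma levy_kernel_continuous: "(\<lambda>n. x n) \<longlonglongrightarrow> x0 \<Longrightarrow> (\<lambda>n. levy_kernel (x n) u) \<longlonglongrightarrow> levy_kernel x0 u"
  unfolding levy_kernel_def by (intro tendsto_intros) auto

lemma exponent_continuous: "continuous_on UNIV exponent"
  unfolding continuous_on_sequentially
proof (intro allI ballI impI, elim conjE)
  fix x :: "nat \<Rightarrow> 'a" and x0 assume x: "x \<longlonglongrightarrow> x0"
  from convergent_imp_bounded[OF x] obtain K where K: "\<And>n. norm (x n) \<le> K"
    by (auto simp: bounded_iff)
  have "(\<lambda>n. CLINT u|\<nu>. levy_kernel (x n) u) \<longlonglongrightarrow> (CLINT u|\<nu>. levy_kernel x0 u)"
  proof (rule integral_dominated_convergence[where w="\<lambda>u. 2 * (1 + K\<^sup>2) * min 1 ((norm u)\<^sup>2)"])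
    show "integrable \<nu> (\<lambda>u. 2 * (1 + K\<^sup>2) * min 1 ((norm u)\<^sup>2))" using integrable_weight by simp
    show "AE u in \<nu>. norm (levy_kernel (x n) u) \<le> 2 * (1 + K\<^sup>2) * min 1 ((norm u)\<^sup>2)" for n
      by (intro AE_I2 order_trans[OF norm_levy_kernel_le] mult_right_mono mult_left_mono add_left_mono power_mono K) auto
    show "AE u in \<nu>. (\<lambda>n. levy_kernel (x n) u) \<longlonglongrightarrow> levy_kernel x0 u"
      by (intro AE_I2 levy_kernel_continuous x)
  qed simp_all
  then show "(exponent \<circ> x) \<longlonglongrightarrow> exponent x0"
    unfolding exponent_def comp_def by (intro tendsto_intros x)
qed

lemma exponent_measurable[measurable]: "exponent \<in> borel_measurable borel"
  by (rule borel_measurable_continuous_onI[OF exponent_continuous])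

definition exponent_bound :: real where
  "exponent_bound = norm c + 2 * (LINT u|\<nu>. min 1 ((norm u)\<^sup>2))"

lemma norm_exponent_le: "cmod (exponent \<xi>) \<le> exponent_bound * (1 + (norm \<xi>)\<^sup>2)"
proof -
  have "cmod (CLINT u|\<nu>. levy_kernel \<xi> u) \<le> (LINT u|\<nu>. 2 * (1 + (norm \<xi>)\<^sup>2) * min 1 ((norm u)\<^sup>2))"
    using integrable_weight by (intro Bochner_Integration.integral_norm_bound_integral integrable_levy_kernel norm_levy_kernel_le) auto
  moreover have "\<bar>c \<bullet> \<xi>\<bar> \<le> norm c * (1 + (norm \<xi>)\<^sup>2)"
  proof -
    have "norm \<xi> \<le> 1 + (norm \<xi>)\<^sup>2"
      using zero_le_power2[of "norm \<xi> - 1"] by (simp add: power2_diff) (smt (verit) zero_le_power2)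
    then show ?thesis
      by (intro order_trans[OF Cauchy_Schwarz_ineq2] mult_left_mono) auto
  qed
  ultimately have "cmod (\<i> * complex_of_real (c \<bullet> \<xi>)) + cmod (CLINT u|\<nu>. levy_kernel \<xi> u) \<le> exponent_bound * (1 + (norm \<xi>)\<^sup>2)"
    by (simp add: exponent_bound_def norm_mult) (simp add: algebra_simps)
  then show ?thesis unfolding exponent_def by (rule norm_triangle_le)
qed

lemma exponent_bound_nonneg: "0 \<le> exponent_bound"
  by (auto simp: exponent_bound_def intro!: add_nonneg_nonneg integral_nonneg_AE)

text \<open>The integrand on the right-hand side of the Stein identity at the point
  \<open>y\<close>; the drift \<open>c\<close> will be instantiated by \<open>b - mean\<close>,
  which merges the first two terms.\<close>

definition stein :: "('a \<Rightarrow> real) \<Rightarrow> ('a \<Rightarrow> 'a) \<Rightarrow> 'a \<Rightarrow> real" where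
  "stein f g y = c \<bullet> g y + (LINT u|\<nu>. jump_remainder f g y u)"

end

section \<open>Mixtures of exponentials and the Stein functional\<close>

locale exponential_mixture =
  fixes N :: "'z measure" and F :: "'z \<Rightarrow> complex" and l :: "'z \<Rightarrow> 'a::euclidean_space"
  assumes sigma_finite_N: "sigma_finite_measure N"
    and F_measurable[measurable]: "F \<in> borel_measurable N"
    and l_measurable[measurable]: "l \<in> borel_measurable N"
    and integrable_moment: "integrable N (\<lambda>z. cmod (F z) * (1 + (norm (l z))\<^sup>2))"
begin

definition mix :: "'a \<Rightarrow> real" where
  "mix y = (LINT z|N. Re (F z * iexp (l z \<bullet> y)))"

definition mix_grad :: "'a \<Rightarrow> 'a" where
  "mix_grad y = (LINT z|N. Re (F z * \<i> * iexp (l z \<bullet> y)) *\<^sub>R l z)"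

lemma le_moment: "norm (l z) \<le> 1 + (norm (l z))\<^sup>2"
  using zero_le_power2[of "norm (l z) - 1"] by (simp add: power2_diff) (smt (verit) zero_le_power2)

text \<open>One dominating function serves all integrands: values need no moment of the frequency
  \<open>l\<close>, gradients need one, and the Levy exponent, growing quadratically, needs
  two.\<close>

lemma integrable_dominated:
  fixes h :: "'z \<Rightarrow> 'b::{banach, second_countable_topology}"
  assumes "h \<in> borel_measurable N" "\<And>z. norm (h z) \<le> K * (cmod (F z) * (1 + (norm (l z))\<^sup>2))"
  shows "integrable N h"
proof (rule Bochner_Integration.integrable_bound)
  show "integrable N (\<lambda>z. K * (cmod (F z) * (1 + (norm (l z))\<^sup>2)))" using integrable_moment by simp
  show "AE z in N. norm (h z) \<le> norm (K * (cmod (F z) * (1 + (norm (l z))\<^sup>2)))"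
    using assms(2) by (auto intro: order_trans[OF _ abs_ge_self])
qed fact

lemma integrable_mix: "integrable N (\<lambda>z. Re (F z * iexp (l z \<bullet> y)))"
  by (rule integrable_dominated[where K=1])
    (auto intro!: order_trans[OF abs_Re_le_cmod] simp: norm_mult mult_le_cancel_left1 simp del: times_complex.sel)

lemma integrable_mix_grad: "integrable N (\<lambda>z. Re (F z * \<i> * iexp (l z \<bullet> y)) *\<^sub>R l z)"
proof (rule integrable_dominated[where K=1])
  fix z
  have "\<bar>Re (F z * \<i> * iexp (l z \<bullet> y))\<bar> * norm (l z) \<le> cmod (F z) * (1 + (norm (l z))\<^sup>2)"
    by (intro mult_mono le_moment order_trans[OF abs_Re_le_cmod]) (auto simp: norm_mult)
  then show "norm (Re (F z * \<i> * iexp (l z \<bullet> y)) *\<^sub>R l z) \<le> 1 * (cmod (F z) * (1 + (norm (l z))\<^sup>2))"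
    by simp
qed simp

lemma inner_mix_grad: "v \<bullet> mix_grad y = (LINT z|N. Re (F z * \<i> * iexp (l z \<bullet> y)) * (v \<bullet> l z))"
  unfolding mix_grad_def using integral_inner_right[OF integrable_mix_grad[of y], of v] by simp

text \<open>Derivatives along lines are enough: through all inner products they determine
  \<open>mix_grad\<close>, which is how it is later identified with explicitly known
  gradients.\<close>

lemma DERIV_mix: "((\<lambda>s. mix (y + s *\<^sub>R v)) has_real_derivative v \<bullet> mix_grad (y + s *\<^sub>R v)) (at s)"
  unfolding mix_def inner_mix_grad
proof (rule DERIV_integral[where a="s - 1" and b="s + 1" and w="\<lambda>z. norm v * (cmod (F z) * (1 + (norm (l z))\<^sup>2))"])
  fix t z
  show "((\<lambda>t. Re (F z * iexp (l z \<bullet> (y + t *\<^sub>R v)))) has_real_derivative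
      Re (F z * \<i> * iexp (l z \<bullet> (y + t *\<^sub>R v))) * (v \<bullet> l z)) (at t)"
    unfolding Re_exp Im_exp times_complex.sel
    by (auto intro!: derivative_eq_intros simp: cis_conv_exp[symmetric] inner_commute algebra_simps)
  have "\<bar>Re (F z * \<i> * iexp (l z \<bullet> (y + t *\<^sub>R v)))\<bar> * \<bar>v \<bullet> l z\<bar> \<le> cmod (F z) * (norm v * (1 + (norm (l z))\<^sup>2))"
    by (intro mult_mono order_trans[OF abs_Re_le_cmod] order_trans[OF Cauchy_Schwarz_ineq2] mult_left_mono le_moment)
      (auto simp: norm_mult)
  then show "\<bar>Re (F z * \<i> * iexp (l z \<bullet> (y + t *\<^sub>R v))) * (v \<bullet> l z)\<bar> \<le> norm v * (cmod (F z) * (1 + (norm (l z))\<^sup>2))"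
    by (simp add: abs_mult mult_ac)
qed (use integrable_mix integrable_moment in auto)

text \<open>For the single exponential with frequency \<open>l\<close> the remainder is
  \<open>iexp (l \<bullet> y)\<close> times \<open>levy_kernel l u\<close>; the general case follows
  by linearity.\<close>

lemma jump_remainder_mix:
  "jump_remainder mix mix_grad y u = (LINT z|N. Re (F z * iexp (l z \<bullet> y) * levy_kernel (l z) u))"
proof -
  have i3: "integrable N (\<lambda>z. Re (F z * \<i> * iexp (l z \<bullet> y)) * (u \<bullet> l z))"
    using integrable_inner_right[OF integrable_mix_grad[of y], of u] by simp
  have "jump_remainder mix mix_grad y u = (LINT z|N. Re (F z * iexp (l z \<bullet> (y + u))) - Re (F z * iexp (l z \<bullet> y))
     - Re (F z * \<i> * iexp (l z \<bullet> y)) * (u \<bullet> l z) * indicator {u. norm u \<le> 1} u)"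
    unfolding jump_remainder_def inner_commute[of "mix_grad y"] inner_mix_grad
    using i3 integrable_mix by (simp add: mix_def)
  also have "\<dots> = (LINT z|N. Re (F z * iexp (l z \<bullet> y) * levy_kernel (l z) u))"
    by (intro Bochner_Integration.integral_cong refl)
      (auto simp: levy_kernel_def inner_add_right exp_add algebra_simps inner_commute split: split_indicator)
  finally show ?thesis .
qed

end

locale levy_mixture = levy_jumps \<nu> c + exponential_mixture N F l
  for \<nu> and c :: "'a::euclidean_space" and N :: "'z measure" and F and l :: "'z \<Rightarrow> 'a"
begin

sublocale pair: pair_sigma_finite N \<nu>
  using sigma_finite_N sigma_finite by (simp add: pair_sigma_finite_def)

text \<open>Fubini's theorem applies because \<open>norm_levy_kernel_le\<close> splits the bound
  into a factor in \<open>z\<close>, integrable by \<open>integrable_moment\<close>, and the weight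
  in \<open>u\<close>, integrable for \<open>\<nu>\<close>. The drift contributes the linear part of
  the exponent.\<close>

lemma stein_mix: "stein mix mix_grad y = (LINT z|N. Re (F z * iexp (l z \<bullet> y) * exponent (l z)))"
proof -
  let ?h = "\<lambda>z u. Re (F z * iexp (l z \<bullet> y) * levy_kernel (l z) u)"
  have int: "integrable (N \<Otimes>\<^sub>M \<nu>) (\<lambda>(z, u). ?h z u)"
  proof (rule Bochner_Integration.integrable_bound)
    have "integrable (N \<Otimes>\<^sub>M \<nu>) (\<lambda>(z, u). cmod (F z) * (1 + (norm (l z))\<^sup>2) * min 1 ((norm u)\<^sup>2))"
      using integrable_moment integrable_weight by (rule pair.integrable_product)
    then show "integrable (N \<Otimes>\<^sub>M \<nu>) (\<lambda>(z, u). 2 * (cmod (F z) * (1 + (norm (l z))\<^sup>2) * min 1 ((norm u)\<^sup>2)))"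
      by (simp add: split_beta')
    show "AE w in N \<Otimes>\<^sub>M \<nu>. norm (case w of (z, u) \<Rightarrow> ?h z u) \<le> norm (case w of (z, u) \<Rightarrow> 2 * (cmod (F z) * (1 + (norm (l z))\<^sup>2) * min 1 ((norm u)\<^sup>2)))"
    proof (rule AE_I2, clarify)
      fix z u
      have "\<bar>?h z u\<bar> \<le> cmod (F z) * (2 * (1 + (norm (l z))\<^sup>2) * min 1 ((norm u)\<^sup>2))"
        by (rule order_trans[OF abs_Re_le_cmod])
          (use norm_levy_kernel_le[of "l z" u] in \<open>auto simp: norm_mult simp del: times_complex.sel intro!: mult_left_mono\<close>)
      then show "norm (?h z u) \<le> norm (2 * (cmod (F z) * (1 + (norm (l z))\<^sup>2) * min 1 ((norm u)\<^sup>2)))"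
        by (simp add: mult_ac del: distrib_left_numeral times_complex.sel)
    qed
  qed measurable
  have i3: "integrable N (\<lambda>z. Re (F z * \<i> * iexp (l z \<bullet> y)) * (c \<bullet> l z))"
    using integrable_inner_right[OF integrable_mix_grad[of y], of c] by simp
  have "(LINT u|\<nu>. jump_remainder mix mix_grad y u) = (LINT z|N. LINT u|\<nu>. ?h z u)"
    unfolding jump_remainder_mix by (rule pair.Fubini_integral[OF int])
  also have "\<dots> = (LINT z|N. Re (F z * iexp (l z \<bullet> y) * (CLINT u|\<nu>. levy_kernel (l z) u)))"
    using integrable_levy_kernel by (intro Bochner_Integration.integral_cong refl) (subst integral_Re, auto)
  finally have j: "(LINT u|\<nu>. jump_remainder mix mix_grad y u) = \<dots>" .
  have "integrable N (\<lambda>z. LINT u|\<nu>. ?h z u)"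
    using pair.integrable_fst'[OF int] by (simp only: prod.case)
  also have "(\<lambda>z. LINT u|\<nu>. ?h z u) = (\<lambda>z. Re (F z * iexp (l z \<bullet> y) * (CLINT u|\<nu>. levy_kernel (l z) u)))"
    using integrable_levy_kernel by (intro ext) (subst integral_Re, auto)
  finally have i4: "integrable N (\<lambda>z. Re (F z * iexp (l z \<bullet> y) * (CLINT u|\<nu>. levy_kernel (l z) u)))" .
  have "stein mix mix_grad y = (LINT z|N. Re (F z * \<i> * iexp (l z \<bullet> y)) * (c \<bullet> l z) + Re (F z * iexp (l z \<bullet> y) * (CLINT u|\<nu>. levy_kernel (l z) u)))"
    unfolding stein_def j inner_mix_grad by (rule Bochner_Integration.integral_add[OF i3 i4, symmetric])
  also have "\<dots> = (LINT z|N. Re (F z * iexp (l z \<bullet> y) * exponent (l z)))"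
    by (intro Bochner_Integration.integral_cong refl) (simp add: exponent_def algebra_simps)
  finally show ?thesis .
qed

text \<open>For fixed \<open>z\<close> the integrand is bounded in \<open>y\<close>, so the exchange
  of integrals asks for no moment of \<open>\<mu>\<close>; the inner integral is then its
  characteristic function at \<open>l z\<close>.\<close>

lemma integral_stein_mix:
  assumes \<mu>: "finite_measure \<mu>" and [measurable_cong]: "sets \<mu> = sets borel"
  shows "(LINT y|\<mu>. stein mix mix_grad y) =
    (LINT z|N. Re (F z * exponent (l z) * (CLINT y|\<mu>. iexp (l z \<bullet> y))))"
proof -
  interpret \<mu>: finite_measure \<mu> by fact
  interpret N: sigma_finite_measure N by (rule sigma_finite_N)
  interpret pm: pair_sigma_finite N \<mu> ..
  let ?h = "\<lambda>z y. Re (F z * iexp (l z \<bullet> y) * exponent (l z))"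
  have int: "integrable (N \<Otimes>\<^sub>M \<mu>) (\<lambda>(z, y). ?h z y)"
  proof (rule Bochner_Integration.integrable_bound)
    have "integrable (N \<Otimes>\<^sub>M \<mu>) (\<lambda>(z, y). cmod (F z) * (1 + (norm (l z))\<^sup>2) * exponent_bound)"
      using integrable_moment by (intro pm.integrable_product) simp_all
    then show "integrable (N \<Otimes>\<^sub>M \<mu>) (\<lambda>(z, y). cmod (F z) * (1 + (norm (l z))\<^sup>2) * exponent_bound)" .
    show "AE w in N \<Otimes>\<^sub>M \<mu>. norm (case w of (z, y) \<Rightarrow> ?h z y) \<le> norm (case w of (z, u) \<Rightarrow> cmod (F z) * (1 + (norm (l z))\<^sup>2) * exponent_bound)"
    proof (rule AE_I2, clarify)
      fix z y
      have "\<bar>?h z y\<bar> \<le> cmod (F z) * (exponent_bound * (1 + (norm (l z))\<^sup>2))"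
        by (rule order_trans[OF abs_Re_le_cmod]) (auto simp: norm_mult intro!: mult_left_mono norm_exponent_le)
      then show "norm (?h z y) \<le> norm (cmod (F z) * (1 + (norm (l z))\<^sup>2) * exponent_bound)"
        using exponent_bound_nonneg by (simp add: mult_ac)
    qed
  qed measurable
  have "(LINT y|\<mu>. stein mix mix_grad y) = (LINT z|N. LINT y|\<mu>. ?h z y)"
    unfolding stein_mix by (rule pm.Fubini_integral[OF int])
  also have "\<dots> = (LINT z|N. Re (F z * exponent (l z) * (CLINT y|\<mu>. iexp (l z \<bullet> y))))"
  proof (intro Bochner_Integration.integral_cong refl)
    fix z
    have e: "integrable \<mu> (\<lambda>y. iexp (l z \<bullet> y))"
      by (rule \<mu>.integrable_const_bound[where B=1]) auto
    have "(LINT y|\<mu>. ?h z y) = (LINT y|\<mu>. Re (F z * exponent (l z) * iexp (l z \<bullet> y)))"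
      by (simp add: mult_ac)
    also have "\<dots> = Re (F z * exponent (l z) * (CLINT y|\<mu>. iexp (l z \<bullet> y)))"
      using e by (subst integral_Re) auto
    finally show "(LINT y|\<mu>. ?h z y) = Re (F z * exponent (l z) * (CLINT y|\<mu>. iexp (l z \<bullet> y)))" .
  qed
  finally show ?thesis .
qed

end

section \<open>Levy exponents under dilation\<close>

lemma AE_dilation_measure: "AE t in dilation_measure. t \<in> {0<..<1}"
  unfolding dilation_measure_def by (subst AE_density) (auto split: split_indicator_asm)

lemma dilation_measure_lborel:
  fixes h :: "real \<Rightarrow> 'b::{banach, second_countable_topology}"
  assumes [measurable]: "h \<in> borel_measurable borel"
  shows "integrable dilation_measure h \<longleftrightarrow> integrable lborel (\<lambda>t. (indicator {0<..<1} t / t) *\<^sub>R h t)"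
    and "integral\<^sup>L dilation_measure h = (LBINT t. (indicator {0<..<1} t / t) *\<^sub>R h t)"
  unfolding dilation_measure_def
  by (subst integrable_density integral_density; auto split: split_indicator)+

text \<open>The density \<open>1/t\<close> cancels \<open>t\<close> and leaves the length of an
  interval. With \<open>r = 1\<close> this gives the weight of the drift, with
  \<open>r = 1 / norm u\<close> the truncation correction.\<close>

lemma dilation_measure_id:
  assumes r: "0 < r" "r \<le> 1"
  shows "integrable dilation_measure (\<lambda>t. t * indicator {..r} t)"
    and "(LINT t|dilation_measure. t * indicator {..r} t) = r"
proof -
  have eq: "(indicator {0<..<1} t / t) *\<^sub>R (t * indicator {..r} t) = indicator ({0<..<1} \<inter> {..r}) t" for t :: real
    by (auto split: split_indicator)
  have "emeasure lborel ({0<..<1} \<inter> {..r}) = ennreal r"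
  proof (cases "r = 1")
    case True
    then have "{0<..<1} \<inter> {..r} = {0<..<1}" by auto
    then show ?thesis using True by simp
  next
    case False
    then have "{0<..<1} \<inter> {..r} = {0<..r}" using r by auto
    then show ?thesis using r by simp
  qed
  then show "integrable dilation_measure (\<lambda>t. t * indicator {..r} t)"
    "(LINT t|dilation_measure. t * indicator {..r} t) = r"
    using r by (simp_all add: dilation_measure_lborel eq measure_def del: indicator_inter_arith real_scaleR_def)
qed

lemma integrable_lborel_scaled:
  fixes f :: "real \<Rightarrow> 'b::{banach, second_countable_topology}"
  assumes s: "0 < s" and f: "integrable lborel (\<lambda>t. s *\<^sub>R f (0 + s * t))"
  shows "integrable lborel f"
proof -
  have "integrable lborel (\<lambda>t. (1 / s) *\<^sub>R (s *\<^sub>R f (0 + s * t)))"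
    by (rule integrable_scaleR_right[OF f])
  then show ?thesis using s lborel_integrable_real_affine_iff[of s f 0] by simp
qed

context levy_jumps
begin

lemma integrable_direction: "integrable \<nu> (\<lambda>u. (indicator {u. 1 < norm u} u / norm u) *\<^sub>R u)"
proof (rule Bochner_Integration.integrable_bound[OF integrable_weight])
  show "AE u in \<nu>. norm ((indicator {u. 1 < norm u} u / norm u) *\<^sub>R u) \<le> norm (min 1 ((norm u)\<^sup>2))"
  proof (rule AE_I2)
    fix u :: 'a
    show "norm ((indicator {u. 1 < norm u} u / norm u) *\<^sub>R u) \<le> norm (min 1 ((norm u)\<^sup>2))"
      using one_le_power[of "norm u" 2] by (cases "1 < norm u") auto
  qed
qed simp

definition "mean_direction = (LINT u|\<nu>. (indicator {u. 1 < norm u} u / norm u) *\<^sub>R u)"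

text \<open>\<open>C\<close> is the compensator present after truncating \<open>t u\<close> but
  absent when \<open>u\<close> itself is truncated: it lives on \<open>norm u > 1\<close> and
  \<open>t \<le> 1 / norm u\<close>. Its integral over \<open>t\<close> is
  \<open>\<xi> \<bullet> u\<close> divided by \<open>norm u\<close>.\<close>

lemma integral_truncation_change:
  fixes \<xi> :: 'a
  defines "C \<equiv> \<lambda>(u, t). ((\<xi> \<bullet> u) * indicator {u. 1 < norm u} u) * (t * indicator {..1 / norm u} t)"
  shows "integrable (\<nu> \<Otimes>\<^sub>M dilation_measure) C" "integral\<^sup>L (\<nu> \<Otimes>\<^sub>M dilation_measure) C = \<xi> \<bullet> mean_direction"
proof -
  interpret D: sigma_finite_measure dilation_measure by (rule sigma_finite_dilation_measure)
  interpret P: pair_sigma_finite \<nu> dilation_measure ..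
  have [measurable]: "C \<in> borel_measurable (\<nu> \<Otimes>\<^sub>M dilation_measure)"
    unfolding C_def indicator_def atMost_iff by measurable
  have i1: "integrable \<nu> (\<lambda>u. \<xi> \<bullet> ((indicator {u. 1 < norm u} u / norm u) *\<^sub>R u))"
    by (rule integrable_inner_right[OF integrable_direction])
  have inv: "1 < norm u \<Longrightarrow> 0 < 1 / norm u \<and> 1 / norm u \<le> 1" for u :: 'a
    by (auto intro!: divide_pos_pos simp: divide_le_eq)
  have a: "integrable dilation_measure (\<lambda>t. C (u, t))" for u
    unfolding C_def using dilation_measure_id[of "1 / norm u"] inv[of u] by (cases "1 < norm u") auto
  have b: "(LINT t|dilation_measure. C (u, t)) = \<xi> \<bullet> ((indicator {u. 1 < norm u} u / norm u) *\<^sub>R u)" for u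
    unfolding C_def using dilation_measure_id[of "1 / norm u"] inv[of u] by (cases "1 < norm u") auto
  have b': "(LINT t|dilation_measure. norm (C (u, t))) = \<bar>\<xi> \<bullet> ((indicator {u. 1 < norm u} u / norm u) *\<^sub>R u)\<bar>" for u
  proof -
    have "(LINT t|dilation_measure. norm (C (u, t))) = (LINT t|dilation_measure. (\<bar>\<xi> \<bullet> u\<bar> * indicator {u. 1 < norm u} u) * (t * indicator {..1 / norm u} t))"
    \<comment> \<open>Only almost everywhere: for \<open>t < 0\<close> the factor \<open>t\<close>
      has the wrong sign, but the dilation measure lives on \<open>(0, 1)\<close>.\<close>
    proof (rule integral_cong_AE)
      show "AE t in dilation_measure. norm (C (u, t)) = (\<bar>\<xi> \<bullet> u\<bar> * indicator {u. 1 < norm u} u) * (t * indicator {..1 / norm u} t)"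
        using AE_dilation_measure by eventually_elim (auto simp: C_def abs_mult split: split_indicator)
    qed (use a in auto)
    also have "\<dots> = \<bar>\<xi> \<bullet> ((indicator {u. 1 < norm u} u / norm u) *\<^sub>R u)\<bar>"
      using dilation_measure_id[of "1 / norm u"] inv[of u] by (cases "1 < norm u") (auto simp: abs_mult)
    finally show ?thesis .
  qed
  show int: "integrable (\<nu> \<Otimes>\<^sub>M dilation_measure) C"
  proof (rule P.Fubini_integrable)
    show "integrable \<nu> (\<lambda>u. LINT t|dilation_measure. norm (C (u, t)))"
      unfolding b' using i1 by (rule integrable_abs)
  qed (use a in auto)
  have "integral\<^sup>L (\<nu> \<Otimes>\<^sub>M dilation_measure) C = (LINT u|\<nu>. LINT t|dilation_measure. C (u, t))"
    by (rule P.integral_fst'[OF int, symmetric])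
  also have "\<dots> = \<xi> \<bullet> mean_direction"
    unfolding b mean_direction_def by (rule integral_inner_right[OF integrable_direction])
  finally show "integral\<^sup>L (\<nu> \<Otimes>\<^sub>M dilation_measure) C = \<xi> \<bullet> mean_direction" .
qed

end

text \<open>Unqualified names refer to drift \<open>b - mean\<close> and jumps
  \<open>\<nu>'\<close>, names with the prefix \<open>image\<close> to drift \<open>b\<close> and
  jumps \<open>\<nu>\<close>. Thus \<open>exponent\<close> is the multiplier of the Stein functional
  and \<open>image.exponent\<close> the logarithm of the expected characteristic function.\<close>

locale levy_dilation = levy_jumps \<nu>' "b - mean" + image: levy_jumps \<nu> b
  for \<nu>' \<nu> :: "'a::euclidean_space measure" and b mean :: 'a +
  assumes image: "\<nu> = distr (\<nu>' \<Otimes>\<^sub>M dilation_measure) borel (\<lambda>(u, t). t *\<^sub>R u)"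
    and mean: "mean = (LINT u|\<nu>'. (indicator {u. 1 < norm u} u / norm u) *\<^sub>R u)"
begin

text \<open>The kernels \<open>levy_kernel (t *\<^sub>R \<xi>) u\<close> and
  \<open>levy_kernel \<xi> (t *\<^sub>R u)\<close> differ only by the truncation term
  \<open>C\<close>, whose integral is \<open>\<xi> \<bullet> mean\<close>. Since \<open>t\<close>
  has integral \<open>1\<close> against \<open>dt/t\<close> on \<open>(0, 1)\<close>, the drift
  \<open>b - mean\<close> passes through unchanged and the two occurrences of \<open>mean\<close>
  cancel.\<close>

lemma exponent_image:
  "image.exponent \<xi> = (CLINT t|dilation_measure. exponent (t *\<^sub>R \<xi>))" (is ?eq)
  "integrable dilation_measure (\<lambda>t. exponent (t *\<^sub>R \<xi>))" (is ?int)
proof -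
  interpret D: sigma_finite_measure dilation_measure by (rule sigma_finite_dilation_measure)
  interpret P: pair_sigma_finite \<nu>' dilation_measure ..
  let ?P = "\<nu>' \<Otimes>\<^sub>M dilation_measure"
  define G where "G w = levy_kernel \<xi> (case w of (u, t) \<Rightarrow> t *\<^sub>R u)" for w :: "'a \<times> real"
  define C where "C w = (case w of (u, t) \<Rightarrow> ((\<xi> \<bullet> u) * indicator {u. 1 < norm u} u) * (t * indicator {..1 / norm u} t))" for w :: "'a \<times> real"
  define K where "K w = (case w of (u, t) \<Rightarrow> levy_kernel (t *\<^sub>R \<xi>) u)" for w :: "'a \<times> real"
  have sc: "(\<lambda>(u, t). t *\<^sub>R u) \<in> borel_measurable ?P" by measurable
  have C: "integrable ?P C" "integral\<^sup>L ?P C = \<xi> \<bullet> mean"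
    using integral_truncation_change[of \<xi>] mean mean_direction_def by (simp_all add: C_def[abs_def])
  have G: "integrable ?P G" "(CLINT u|\<nu>. levy_kernel \<xi> u) = (CLINT w|?P. G w)"
    using image.integrable_levy_kernel[of \<xi>] integrable_distr_eq[OF sc, of "levy_kernel \<xi>"] integral_distr[OF sc, of "levy_kernel \<xi>"]
    unfolding image[symmetric] G_def[abs_def] by auto
  have [measurable]: "K \<in> borel_measurable ?P" unfolding K_def by measurable
  have AE: "AE w in ?P. snd w \<in> {0<..<1}"
  proof -
    have "AE u in \<nu>'. AE t in dilation_measure. snd (u, t) \<in> {0<..<1::real}"
      using AE_dilation_measure by simp
    moreover have "{w \<in> space ?P. snd w \<in> {0<..<1}} \<in> sets ?P" by measurable
    ultimately show ?thesis by (intro P.AE_pair_measure)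
  qed
  have K: "AE w in ?P. K w = G w + \<i> * complex_of_real (C w)"
    using AE
  proof eventually_elim
    case (elim w)
    obtain u t where w: "w = (u, t)" by (cases w)
    with elim have t: "0 < t" "t < 1" by auto
    have 1: "norm u \<le> 1 \<Longrightarrow> t * norm u \<le> 1"
      using t mult_mono[of t 1 "norm u" 1] by auto
    have 2: "1 < norm u \<Longrightarrow> t * norm u \<le> 1 \<longleftrightarrow> t \<le> 1 / norm u"
      by (subst pos_le_divide_eq) auto
    show ?case unfolding w K_def G_def C_def levy_kernel_def
      using 1 2 t by (cases "norm u \<le> 1") (auto simp: algebra_simps split: split_indicator)
  qed
  have "integrable ?P K \<longleftrightarrow> integrable ?P (\<lambda>w. G w + \<i> * complex_of_real (C w))"
    by (rule integrable_cong_AE) (use K G C in auto)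
  then have Kint: "integrable ?P K" using G C by simp
  have "integral\<^sup>L ?P K = (CLINT w|?P. G w + \<i> * complex_of_real (C w))"
    by (rule integral_cong_AE) (use K G C in auto)
  also have "\<dots> = (CLINT u|\<nu>. levy_kernel \<xi> u) + \<i> * complex_of_real (\<xi> \<bullet> mean)"
    using G C by simp
  finally have eq1: "integral\<^sup>L ?P K = (CLINT u|\<nu>. levy_kernel \<xi> u) + \<i> * complex_of_real (\<xi> \<bullet> mean)" .
  have K': "integrable ?P (case_prod (\<lambda>u t. levy_kernel (t *\<^sub>R \<xi>) u))"
    using Kint unfolding K_def[abs_def] by (simp add: split_beta')
  have J: "integrable dilation_measure (\<lambda>t. CLINT u|\<nu>'. levy_kernel (t *\<^sub>R \<xi>) u)"
    by (rule P.integrable_snd[OF K'])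
  have eq2: "integral\<^sup>L ?P K = (CLINT t|dilation_measure. CLINT u|\<nu>'. levy_kernel (t *\<^sub>R \<xi>) u)"
    using P.integral_snd[OF K'] unfolding K_def[abs_def] by (simp add: split_beta')
  have id: "integrable dilation_measure (\<lambda>t. t)" "(LINT t|dilation_measure. t) = 1"
  proof -
    have AE1: "AE t in dilation_measure. t = t * indicator {..1} t"
      using AE_dilation_measure by eventually_elim auto
    show "integrable dilation_measure (\<lambda>t. t)"
      by (subst integrable_cong_AE[OF _ _ AE1]) (use dilation_measure_id[of 1] in auto)
    show "(LINT t|dilation_measure. t) = 1"
      by (subst integral_cong_AE[OF _ _ AE1]) (use dilation_measure_id[of 1] in auto)
  qed
  have e: "exponent (t *\<^sub>R \<xi>) = \<i> * complex_of_real ((b - mean) \<bullet> \<xi>) * complex_of_real t + (CLINT u|\<nu>'. levy_kernel (t *\<^sub>R \<xi>) u)" for t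
    by (simp add: exponent_def)
  show ?int unfolding e using id J by (intro Bochner_Integration.integrable_add integrable_mult_right) auto
  have "(CLINT t|dilation_measure. exponent (t *\<^sub>R \<xi>)) =
      \<i> * complex_of_real ((b - mean) \<bullet> \<xi>) * complex_of_real (LINT t|dilation_measure. t) + (CLINT t|dilation_measure. CLINT u|\<nu>'. levy_kernel (t *\<^sub>R \<xi>) u)"
    unfolding e using id(1) J by (subst Bochner_Integration.integral_add) auto
  then show ?eq
    using eq1 eq2 by (simp add: id image.exponent_def algebra_simps inner_commute)
qed

text \<open>The substitution \<open>r = s t\<close> moves the scale \<open>s\<close> out of the
  integrand and into the upper limit, where the fundamental theorem of calculus can reach
  it.\<close>

lemma exponent_image_scaled:
  assumes s: "0 < s"
  shows "image.exponent (s *\<^sub>R \<xi>) = (LBINT r. (indicator {0<..<s} r / r) *\<^sub>R exponent (r *\<^sub>R \<xi>))"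
    and "integrable lborel (\<lambda>r. (indicator {0<..<s} r / r) *\<^sub>R exponent (r *\<^sub>R \<xi>))"
proof -
  let ?h = "\<lambda>s r. (indicator {0<..<s} r / r) *\<^sub>R exponent (r *\<^sub>R \<xi>)"
  have "(\<lambda>t. (indicator {0<..<1} t / t) *\<^sub>R exponent (t *\<^sub>R s *\<^sub>R \<xi>)) = (\<lambda>t. s *\<^sub>R ?h s (0 + s * t))"
    using s by (auto split: split_indicator simp: fun_eq_iff mult.commute zero_less_mult_iff)
  then have 1: "image.exponent (s *\<^sub>R \<xi>) = (LBINT t. s *\<^sub>R ?h s (0 + s * t))"
    and 2: "integrable lborel (\<lambda>t. s *\<^sub>R ?h s (0 + s * t))"
    using exponent_image[of "s *\<^sub>R \<xi>"]
    by (simp_all add: dilation_measure_lborel)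
  show "image.exponent (s *\<^sub>R \<xi>) = (LBINT r. ?h s r)"
  proof -
    have "(LBINT r. ?h s r) = s *\<^sub>R (LBINT t. ?h s (0 + s * t))"
      using s lborel_integral_real_affine[of s "?h s" 0] by (simp only: abs_of_pos)
    also have "\<dots> = (LBINT t. s *\<^sub>R ?h s (0 + s * t))"
      by (rule integral_scaleR_right[symmetric])
    finally show ?thesis using 1 by (simp only:)
  qed
  show "integrable lborel (?h s)"
    by (rule integrable_lborel_scaled[OF s 2])
qed

text \<open>The factor \<open>1/r\<close> is singular at \<open>0\<close>, so the integral is split
  at \<open>s/2\<close>: the part below is a constant, and the fundamental theorem of calculus is
  applied on \<open>[s/2, s + 1]\<close>, where the integrand is continuous.\<close>

lemma has_vector_derivative_exponent_image:
  assumes s: "0 < s"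
  shows "((\<lambda>s. image.exponent (s *\<^sub>R \<xi>)) has_vector_derivative (1 / s) *\<^sub>R exponent (s *\<^sub>R \<xi>)) (at s)"
proof -
  let ?f = "\<lambda>r. (1 / r) *\<^sub>R exponent (r *\<^sub>R \<xi>)"
  let ?h = "\<lambda>s r. (indicator {0<..<s} r / r) *\<^sub>R exponent (r *\<^sub>R \<xi>)"
  have cont: "continuous_on {s/2..s+1} ?f"
    using s by (intro continuous_intros continuous_on_compose2[OF exponent_continuous]) auto
  have eq: "image.exponent (t *\<^sub>R \<xi>) = image.exponent ((s/2) *\<^sub>R \<xi>) + (LBINT r=s/2..t. ?f r)" if "t \<in> {s/2<..<s+1}" for t
  proof -
    have "image.exponent (t *\<^sub>R \<xi>) - image.exponent ((s/2) *\<^sub>R \<xi>) = (LBINT r. ?h t r - ?h (s/2) r)"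
      using exponent_image_scaled[of t \<xi>] exponent_image_scaled[of "s/2" \<xi>] s that
      by (subst Bochner_Integration.integral_diff) auto
    also have "\<dots> = (LBINT r=s/2..t. ?f r)"
      using s that by (subst interval_integral_Ico) (auto intro!: Bochner_Integration.integral_cong simp: set_lebesgue_integral_def split: split_indicator)
    finally show ?thesis by (simp add: algebra_simps)
  qed
  have "((\<lambda>t. LBINT r=s/2..t. ?f r) has_vector_derivative ?f s) (at s within {s/2..s+1})"
    using s by (intro interval_integral_FTC2 cont) auto
  moreover have "at s within {s/2..s+1} = at s"
    using s by (intro at_within_interior) auto
  ultimately have "((\<lambda>t. image.exponent ((s/2) *\<^sub>R \<xi>) + (LBINT r=s/2..t. ?f r)) has_vector_derivative ?f s) (at s)"
    by (auto intro!: derivative_eq_intros)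
  then show ?thesis
    by (rule has_vector_derivative_transform_within_open[where S="{s/2<..<s+1}"]) (use s eq in auto)
qed

end

section \<open>Gaussian measure and Schwartz functions\<close>

text \<open>Built from independent standard normal coordinates, so that the characteristic function
  factorizes and the second moment is a sum of one-dimensional ones. This is the measure on
  frequencies; the smoothing kernel on space is \<open>gauss_kernel\<close>.\<close>

definition gaussian :: "'a::euclidean_space measure" where
  "gaussian = distr (\<Pi>\<^sub>M b\<in>Basis. std_normal_distribution) borel (\<lambda>f. \<Sum>b\<in>Basis. f b *\<^sub>R b)"

lemma sets_gaussian[measurable_cong, simp]: "sets gaussian = sets borel"
  by (simp add: gaussian_def)

lemma space_gaussian[simp]: "space gaussian = UNIV"
  by (simp add: gaussian_def)

lemma gaussian_map_measurable:
  "(\<lambda>f. \<Sum>b\<in>Basis. f b *\<^sub>R b :: 'a) \<in> borel_measurable (\<Pi>\<^sub>M b\<in>(Basis :: 'a::euclidean_space set). std_normal_distribution)"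
proof -
  have "(\<lambda>f. f b) \<in> borel_measurable (\<Pi>\<^sub>M b\<in>(Basis :: 'a set). std_normal_distribution)" if "b \<in> Basis" for b
    using measurable_component_singleton[OF that, of "\<lambda>_. std_normal_distribution"]
    by (simp cong: measurable_cong_sets)
  then show ?thesis
    by (intro borel_measurable_sum borel_measurable_scaleR) auto
qed

lemma prob_space_gaussian: "prob_space (gaussian :: 'a::euclidean_space measure)"
proof -
  interpret N: prob_space std_normal_distribution by (rule prob_space_normal_density) simp
  show ?thesis unfolding gaussian_def
    by (intro prob_space.prob_space_distr prob_space_PiM gaussian_map_measurable N.prob_space_axioms)
qed

lemma inner_Basis_sum: "b \<in> Basis \<Longrightarrow> (\<Sum>i\<in>Basis. f i *\<^sub>R i) \<bullet> b = f b" for f :: "'a::euclidean_space \<Rightarrow> real"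
  by (simp add: inner_sum_left inner_Basis if_distrib cong: if_cong)

lemma norm_power2_Basis: "(norm x)\<^sup>2 = (\<Sum>b\<in>Basis. (x \<bullet> b)\<^sup>2)" for x :: "'a::euclidean_space"
  unfolding power2_norm_eq_inner by (subst euclidean_inner) (simp add: power2_eq_square)

lemma cf_gaussian:
  fixes \<xi> :: "'a::euclidean_space"
  shows "(CLINT z|gaussian. iexp (\<xi> \<bullet> z)) = complex_of_real (exp (- (norm \<xi>)\<^sup>2 / 2))"
proof -
  interpret N: prob_space std_normal_distribution by (rule prob_space_normal_density) simp
  interpret product_prob_space "\<lambda>_::'a. std_normal_distribution" ..
  have "(CLINT z|gaussian. iexp (\<xi> \<bullet> z)) = (CLINT f|(\<Pi>\<^sub>M b\<in>(Basis :: 'a set). std_normal_distribution). iexp (\<xi> \<bullet> (\<Sum>b\<in>Basis. f b *\<^sub>R b)))"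
    unfolding gaussian_def by (rule integral_distr[OF gaussian_map_measurable]) simp
  also have "\<dots> = (CLINT f|(\<Pi>\<^sub>M b\<in>(Basis :: 'a set). std_normal_distribution). (\<Prod>b\<in>Basis. iexp ((\<xi> \<bullet> b) * f b)))"
    by (simp add: inner_sum_right exp_sum sum_distrib_left mult.commute)
  also have "\<dots> = (\<Prod>b\<in>(Basis :: 'a set). CLINT x|std_normal_distribution. iexp ((\<xi> \<bullet> b) * x))"
    by (rule product_integral_prod) (auto intro!: N.integrable_const_bound[where B=1] simp: cong: measurable_cong_sets)
  also have "\<dots> = (\<Prod>b\<in>(Basis :: 'a set). complex_of_real (exp (- (\<xi> \<bullet> b)\<^sup>2 / 2)))"
    using char_std_normal_distribution[unfolded char_def fun_eq_iff] by simp
  also have "\<dots> = complex_of_real (exp (- (norm \<xi>)\<^sup>2 / 2))"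
    by (simp add: of_real_prod[symmetric] exp_sum[symmetric] norm_power2_Basis sum_negf sum_divide_distrib del: of_real_prod)
  finally show ?thesis .
qed

lemma integrable_gaussian_norm_power2: "integrable gaussian (\<lambda>z::'a::euclidean_space. (norm z)\<^sup>2)"
proof -
  interpret N: prob_space std_normal_distribution by (rule prob_space_normal_density) simp
  interpret product_prob_space "\<lambda>_::'a. std_normal_distribution" ..
  let ?P = "\<Pi>\<^sub>M b\<in>(Basis :: 'a set). std_normal_distribution"
  have "integrable ?P (\<lambda>f. (f b)\<^sup>2)" if b: "b \<in> Basis" for b
  proof -
    have "integrable (distr ?P std_normal_distribution (\<lambda>f. f b)) (\<lambda>x. x\<^sup>2)"
      using distr_PiM_component[of Basis "\<lambda>_. std_normal_distribution" b] N.prob_space_axioms b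
        integrable_std_normal_distribution_moment[of 2] by simp
    then show ?thesis
      by (subst (asm) integrable_distr_eq) (use b in simp_all)
  qed
  then have "integrable ?P (\<lambda>f. \<Sum>b\<in>Basis. (f b)\<^sup>2)" by simp
  also have "(\<lambda>f. \<Sum>b\<in>Basis. (f b)\<^sup>2) = (\<lambda>f. (norm (\<Sum>b\<in>Basis. f b *\<^sub>R b :: 'a))\<^sup>2)"
    by (rule ext) (simp add: norm_power2_Basis inner_Basis_sum)
  finally show ?thesis
    unfolding gaussian_def by (subst integrable_distr_eq[OF gaussian_map_measurable]) simp_all
qed

section \<open>Integrability over Euclidean space from one dimension\<close>

lemma integrable_lborel_prod_bounded:
  fixes f :: "'a::euclidean_space \<Rightarrow> real" and h :: "real \<Rightarrow> real"
  assumes h: "integrable lborel h" "\<And>x. 0 \<le> h x"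
    and f: "f \<in> borel_measurable borel" "\<And>x. \<bar>f x\<bar> \<le> C * (\<Prod>b\<in>Basis. h (x \<bullet> b))"
  shows "integrable lborel f"
proof (rule Bochner_Integration.integrable_bound)
  have [measurable]: "h \<in> borel_measurable borel" using borel_measurable_integrable[OF h(1)] by simp
  have nn: "0 \<le> (\<Prod>b\<in>Basis. h (x \<bullet> b))" for x :: 'a by (intro prod_nonneg) (simp add: h)
  have "integrable lborel (\<lambda>x::'a. \<Prod>b\<in>Basis. h (x \<bullet> b))"
  proof (rule integrableI_nonneg)
    have "(\<integral>\<^sup>+x. ennreal (\<Prod>b\<in>Basis. h (x \<bullet> b)) \<partial>(lborel :: 'a measure)) = (\<integral>\<^sup>+x. (\<Prod>b\<in>Basis. ennreal (h (x \<bullet> b))) \<partial>(lborel :: 'a measure))"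
      by (simp add: prod_ennreal h)
    also have "\<dots> = (\<Prod>b\<in>(Basis :: 'a set). (\<integral>\<^sup>+x. ennreal (h x) \<partial>lborel))"
      by (rule nn_integral_lborel_prod) auto
    also have "\<dots> < \<infinity>"
      using h by (simp add: nn_integral_eq_integral ennreal_power less_top[symmetric] power_less_top_ennreal)
    finally show "(\<integral>\<^sup>+x. ennreal (\<Prod>b\<in>Basis. h (x \<bullet> b)) \<partial>(lborel :: 'a measure)) < \<infinity>" .
  qed (use nn in auto)
  then show "integrable lborel (\<lambda>x::'a. C * (\<Prod>b\<in>Basis. h (x \<bullet> b)))" by simp
  show "AE x in lborel. norm (f x) \<le> norm (C * (\<Prod>b\<in>Basis. h (x \<bullet> b)))"
    using f(2) by (auto intro: order_trans[OF _ abs_ge_self])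
qed (use f in simp)

lemma integrable_gauss_kernel:
  fixes \<delta> :: real assumes "0 < \<delta>"
  shows "integrable lborel (\<lambda>y::'a::euclidean_space. exp (- \<delta> * (norm y)\<^sup>2))"
proof (rule integrable_lborel_prod_bounded[where h="\<lambda>x. exp (- \<delta> * x\<^sup>2)" and C=1])
  \<comment> \<open>The standard deviation for which the normal density is proportional to
    \<open>exp (- \<delta> * x\<^sup>2)\<close>.\<close>
  define s where "s = sqrt (1 / (2 * \<delta>))"
  have s: "0 < s" "s\<^sup>2 = 1 / (2 * \<delta>)" using assms by (auto simp: s_def)
  have "integrable lborel (\<lambda>x. sqrt (2 * pi * s\<^sup>2) * normal_density 0 s x)"
    using s by simp
  also have "(\<lambda>x. sqrt (2 * pi * s\<^sup>2) * normal_density 0 s x) = (\<lambda>x. exp (- \<delta> * x\<^sup>2))"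
    using s assms by (auto simp: normal_density_def fun_eq_iff)
  finally show "integrable lborel (\<lambda>x. exp (- \<delta> * x\<^sup>2))" .
  fix x :: 'a
  show "\<bar>exp (- \<delta> * (norm x)\<^sup>2)\<bar> \<le> 1 * (\<Prod>b\<in>Basis. exp (- \<delta> * (x \<bullet> b)\<^sup>2))"
    by (simp add: exp_sum[symmetric] norm_power2_Basis sum_negf sum_distrib_left)
qed auto

text \<open>Each of the \<open>DIM('a)\<close> factors \<open>1 + (x \<bullet> b)\<^sup>2\<close> is
  at most \<open>(1 + norm x)\<^sup>2\<close>, which explains the power \<open>2 * DIM('a)\<close>;
  the product of the reciprocals is integrable coordinate by coordinate.\<close>

lemma integrable_lborel_decay:
  fixes f :: "'a::euclidean_space \<Rightarrow> real"
  assumes f: "f \<in> borel_measurable borel" "\<And>x. (1 + norm x) ^ (2 * DIM('a)) * \<bar>f x\<bar> \<le> C"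
  shows "integrable lborel f"
proof (rule integrable_lborel_prod_bounded[where h="\<lambda>x. inverse (1 + x\<^sup>2)" and C=C])
  show "integrable lborel (\<lambda>x::real. inverse (1 + x\<^sup>2))"
    using integrable_inverse_1_plus_square by (simp add: set_integrable_def)
  fix x :: 'a
  have "(\<Prod>b\<in>Basis. 1 + (x \<bullet> b)\<^sup>2) \<le> (\<Prod>b\<in>(Basis::'a set). (1 + norm x)\<^sup>2)"
  proof (rule prod_mono)
    fix b :: 'a assume b: "b \<in> Basis"
    have "(x \<bullet> b)\<^sup>2 \<le> (norm x)\<^sup>2"
      using Basis_le_norm[OF b, of x] by (intro abs_le_square_iff[THEN iffD1]) auto
    then show "0 \<le> 1 + (x \<bullet> b)\<^sup>2 \<and> 1 + (x \<bullet> b)\<^sup>2 \<le> (1 + norm x)\<^sup>2"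
      using norm_ge_zero[of x] power2_sum[of 1 "norm x"] zero_le_power2[of "x \<bullet> b"]
      by (simp only: power_one mult_1_right) linarith
  qed
  also have "\<dots> = (1 + norm x) ^ (2 * DIM('a))" by (simp add: power_mult)
  finally have "(\<Prod>b\<in>Basis. 1 + (x \<bullet> b)\<^sup>2) * \<bar>f x\<bar> \<le> C"
    by (rule order_trans[OF mult_right_mono f(2)]) simp
  moreover have "0 < (\<Prod>b\<in>Basis. 1 + (x \<bullet> b)\<^sup>2)" by (intro prod_pos) (simp add: add_pos_nonneg)
  ultimately show "\<bar>f x\<bar> \<le> C * (\<Prod>b\<in>Basis. inverse (1 + (x \<bullet> b)\<^sup>2))"
    by (simp add: prod_inversef[symmetric] prod_dividef field_simps)
qed (use f in auto)

section \<open>Damped trigonometric test functions and Schwartz bounds\<close>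

lemma real_polynomial_function_has_derivative:
  fixes p :: "'a::real_normed_vector \<Rightarrow> real"
  assumes "real_polynomial_function p"
  shows "\<exists>D. (\<forall>x. (p has_derivative D x) (at x)) \<and> (\<forall>v. real_polynomial_function (\<lambda>x. D x v))"
  using assms
proof induction
  case (linear f)
  then show ?case
    by (intro exI[of _ "\<lambda>x. f"]) (auto simp: bounded_linear_imp_has_derivative)
next
  case (const c)
  then show ?case by (intro exI[of _ "\<lambda>x v. 0"]) auto
next
  case (add f g)
  then obtain D E where "\<forall>x. (f has_derivative D x) (at x)" "\<forall>v. real_polynomial_function (\<lambda>x. D x v)"
    "\<forall>x. (g has_derivative E x) (at x)" "\<forall>v. real_polynomial_function (\<lambda>x. E x v)" by blast
  then show ?case by (intro exI[of _ "\<lambda>x v. D x v + E x v"]) (auto intro: has_derivative_add)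
next
  case (mult f g)
  then obtain D E where "\<forall>x. (f has_derivative D x) (at x)" "\<forall>v. real_polynomial_function (\<lambda>x. D x v)"
    "\<forall>x. (g has_derivative E x) (at x)" "\<forall>v. real_polynomial_function (\<lambda>x. E x v)" by blast
  with mult.hyps show ?case
    by (intro exI[of _ "\<lambda>x v. f x * E x v + D x v * g x"] conjI allI has_derivative_mult real_polynomial_function.intros(3,4)) auto
qed

lemma real_polynomial_function_growth:
  fixes p :: "'a::real_normed_vector \<Rightarrow> real"
  assumes "real_polynomial_function p"
  shows "\<exists>C n. \<forall>x. \<bar>p x\<bar> \<le> C * (1 + norm x) ^ n"
  using assms
proof induction
  case (linear f)
  then obtain K where K: "K > 0" "\<And>x. norm (f x) \<le> norm x * K" using bounded_linear.pos_bounded by metis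
  show ?case
    using K by (intro exI[of _ K] exI[of _ 1]) (auto intro!: order_trans[OF K(2)[unfolded real_norm_def]] simp: algebra_simps)
next
  case (const c)
  then show ?case by (intro exI[of _ "\<bar>c\<bar>"] exI[of _ 0]) auto
next
  case (add f g)
  then obtain C n D m where f: "\<And>x. \<bar>f x\<bar> \<le> C * (1 + norm x) ^ n" and g: "\<And>x. \<bar>g x\<bar> \<le> D * (1 + norm x) ^ m" by blast
  show ?case
  proof (intro exI allI)
    fix x
    have "\<bar>f x\<bar> \<le> \<bar>C\<bar> * (1 + norm x) ^ (n + m)"
      by (rule order_trans[OF f mult_mono]) (auto intro!: power_increasing)
    moreover have "\<bar>g x\<bar> \<le> \<bar>D\<bar> * (1 + norm x) ^ (n + m)"
      by (rule order_trans[OF g mult_mono]) (auto intro!: power_increasing)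
    ultimately show "\<bar>f x + g x\<bar> \<le> (\<bar>C\<bar> + \<bar>D\<bar>) * (1 + norm x) ^ (n + m)"
      by (simp add: distrib_right)
  qed
next
  case (mult f g)
  then obtain C n D m where f: "\<And>x. \<bar>f x\<bar> \<le> C * (1 + norm x) ^ n" and g: "\<And>x. \<bar>g x\<bar> \<le> D * (1 + norm x) ^ m" by blast
  show ?case
  proof (intro exI allI)
    fix x
    have "\<bar>f x\<bar> * \<bar>g x\<bar> \<le> (C * (1 + norm x) ^ n) * (D * (1 + norm x) ^ m)"
      by (rule mult_mono[OF f g]) (auto intro: order_trans[OF _ f])
    then show "\<bar>f x * g x\<bar> \<le> (C * D) * (1 + norm x) ^ (n + m)"
      by (simp add: abs_mult power_add mult_ac)
  qed
qed

inductive_set damped_trig :: "'a::euclidean_space \<Rightarrow> real \<Rightarrow> real \<Rightarrow> ('a \<Rightarrow> real) set"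
  for \<xi> :: 'a and \<theta> \<delta> :: real where
  "real_polynomial_function p \<Longrightarrow> real_polynomial_function r \<Longrightarrow>
    (\<lambda>x. (p x * cos (\<xi> \<bullet> x + \<theta>) + r x * sin (\<xi> \<bullet> x + \<theta>)) * exp (- \<delta> * (x \<bullet> x))) \<in> damped_trig \<xi> \<theta> \<delta>"

lemma damped_trig_has_derivative:
  assumes "h \<in> damped_trig \<xi> \<theta> \<delta>"
  shows "\<exists>D. (\<forall>x. (h has_derivative D x) (at x)) \<and> (\<forall>v. (\<lambda>x. D x v) \<in> damped_trig \<xi> \<theta> \<delta>)"
  using assms
proof cases
  case (1 p r)
  obtain D E where D: "\<And>x. (p has_derivative D x) (at x)" "\<And>v. real_polynomial_function (\<lambda>x. D x v)"
    and E: "\<And>x. (r has_derivative E x) (at x)" "\<And>v. real_polynomial_function (\<lambda>x. E x v)"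
    using real_polynomial_function_has_derivative[OF 1(2)] real_polynomial_function_has_derivative[OF 1(3)] by blast
  let ?D = "\<lambda>x v. ((D x v + r x * (\<xi> \<bullet> v) + - 2 * \<delta> * (x \<bullet> v) * p x) * cos (\<xi> \<bullet> x + \<theta>) +
      (E x v + - (\<xi> \<bullet> v) * p x + - 2 * \<delta> * (x \<bullet> v) * r x) * sin (\<xi> \<bullet> x + \<theta>)) * exp (- \<delta> * (x \<bullet> x))"
  show ?thesis
  proof (intro exI[of _ ?D] conjI allI)
    fix x :: 'a
    show "(h has_derivative ?D x) (at x)" unfolding 1(1)
      by (rule derivative_eq_intros D E refl)+ (auto simp: fun_eq_iff inner_commute algebra_simps)
  next
    fix v :: 'a
    have "bounded_linear (\<lambda>x. x \<bullet> v)" by (rule bounded_linear_inner_left)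
    then show "(\<lambda>x. ?D x v) \<in> damped_trig \<xi> \<theta> \<delta>"
      by (intro damped_trig.intros D E 1 real_polynomial_function.intros)
  qed
qed

lemma damped_trig_bounded:
  assumes h: "h \<in> damped_trig \<xi> \<theta> \<delta>" and \<delta>: "0 < \<delta>"
  shows "bounded (range (\<lambda>x. (1 + norm x) ^ m * h x))"
  using h
proof cases
  case (1 p r)
  obtain C n D k where f: "\<And>x. \<bar>p x\<bar> \<le> C * (1 + norm x) ^ n" and g: "\<And>x. \<bar>r x\<bar> \<le> D * (1 + norm x) ^ k"
    using real_polynomial_function_growth[OF 1(2)] real_polynomial_function_growth[OF 1(3)] by blast
  \<comment> \<open>After \<open>1 + norm x \<le> exp (norm x)\<close> the exponent is a quadratic
    polynomial in \<open>norm x\<close>; completing the square shows that its maximum is the stated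
    one.\<close>
  have G: "(1 + norm x) ^ j * exp (- \<delta> * (x \<bullet> x)) \<le> exp ((real j)\<^sup>2 / (4 * \<delta>))" for j and x :: 'a
  proof -
    have "(1 + norm x) ^ j \<le> exp (norm x) ^ j" by (intro power_mono) auto
    then have "(1 + norm x) ^ j * exp (- \<delta> * (x \<bullet> x)) \<le> exp (real j * norm x) * exp (- \<delta> * (x \<bullet> x))"
      by (intro mult_right_mono) (auto simp: exp_of_nat_mult)
    also have "\<dots> = exp (real j * norm x - \<delta> * (norm x)\<^sup>2)"
      by (simp add: exp_add[symmetric] power2_norm_eq_inner)
    also have "real j * norm x - \<delta> * (norm x)\<^sup>2 = (real j)\<^sup>2 / (4 * \<delta>) - (2 * \<delta> * norm x - real j)\<^sup>2 / (4 * \<delta>)"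
      using \<delta> by (simp add: field_simps power2_eq_square)
    also have "exp \<dots> \<le> exp ((real j)\<^sup>2 / (4 * \<delta>))" using \<delta> by simp
    finally show ?thesis .
  qed
  show ?thesis unfolding bounded_iff
  proof (intro exI ballI)
    fix y assume "y \<in> range (\<lambda>x. (1 + norm x) ^ m * h x)"
    then obtain x where y: "y = (1 + norm x) ^ m * h x" by blast
    have "\<bar>p x * cos (\<xi> \<bullet> x + \<theta>)\<bar> \<le> (C * (1 + norm x) ^ n) * 1"
      unfolding abs_mult by (intro mult_mono f) (auto intro: order_trans[OF _ f])
    moreover have "\<bar>r x * sin (\<xi> \<bullet> x + \<theta>)\<bar> \<le> (D * (1 + norm x) ^ k) * 1"
      unfolding abs_mult by (intro mult_mono g) (auto intro: order_trans[OF _ g])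
    ultimately have "\<bar>p x * cos (\<xi> \<bullet> x + \<theta>) + r x * sin (\<xi> \<bullet> x + \<theta>)\<bar> \<le> C * (1 + norm x) ^ n + D * (1 + norm x) ^ k"
      by linarith
    then have "norm y \<le> (1 + norm x) ^ m * ((C * (1 + norm x) ^ n + D * (1 + norm x) ^ k) * exp (- \<delta> * (x \<bullet> x)))"
      unfolding y 1(1) by (auto simp: abs_mult intro!: mult_left_mono mult_right_mono)
    also have "\<dots> = C * ((1 + norm x) ^ (m + n) * exp (- \<delta> * (x \<bullet> x))) + D * ((1 + norm x) ^ (m + k) * exp (- \<delta> * (x \<bullet> x)))"
      by (simp add: power_add algebra_simps)
    also have "\<dots> \<le> \<bar>C\<bar> * exp ((real (m + n))\<^sup>2 / (4 * \<delta>)) + \<bar>D\<bar> * exp ((real (m + k))\<^sup>2 / (4 * \<delta>))"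
      by (intro add_mono mult_mono G) auto
    finally show "norm y \<le> \<bar>C\<bar> * exp ((real (m + n))\<^sup>2 / (4 * \<delta>)) + \<bar>D\<bar> * exp ((real (m + k))\<^sup>2 / (4 * \<delta>))" .
  qed
qed

lemma partial_derivs_damped_trig:
  assumes "h \<in> damped_trig \<xi> \<theta> \<delta>"
  shows "partial_derivs bs h \<in> damped_trig \<xi> \<theta> \<delta>"
proof (induction bs)
  case (Cons b bs)
  obtain D where D: "\<And>x. (partial_derivs bs h has_derivative D x) (at x)" "\<And>v. (\<lambda>x. D x v) \<in> damped_trig \<xi> \<theta> \<delta>"
    using damped_trig_has_derivative[OF Cons] by blast
  have "partial_derivs (b # bs) h = (\<lambda>x. D x b)"
    using frechet_derivative_at[OF D(1)] by (simp add: fun_eq_iff)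
  then show ?case using D by simp
qed (simp add: assms)

lemma damped_trig_schwartz:
  assumes "h \<in> damped_trig \<xi> \<theta> \<delta>" and "0 < \<delta>"
  shows "h \<in> schwartz_space"
  using damped_trig_bounded[OF partial_derivs_damped_trig[OF assms(1)] assms(2)]
    damped_trig_has_derivative[OF partial_derivs_damped_trig[OF assms(1)]]
  unfolding schwartz_space_def differentiable_def by blast

text \<open>The phase \<open>\<theta>\<close> lets real test functions reach both the real and the
  imaginary part of a characteristic function.\<close>

definition test_cos :: "'a::euclidean_space \<Rightarrow> real \<Rightarrow> real \<Rightarrow> 'a \<Rightarrow> real" where
  "test_cos \<xi> \<theta> \<delta> x = cos (\<xi> \<bullet> x + \<theta>) * exp (- \<delta> * (x \<bullet> x))"

definition test_cos_grad :: "'a::euclidean_space \<Rightarrow> real \<Rightarrow> real \<Rightarrow> 'a \<Rightarrow> 'a" where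
  "test_cos_grad \<xi> \<theta> \<delta> x = - (sin (\<xi> \<bullet> x + \<theta>) * exp (- \<delta> * (x \<bullet> x))) *\<^sub>R \<xi>
     - (2 * \<delta> * cos (\<xi> \<bullet> x + \<theta>) * exp (- \<delta> * (x \<bullet> x))) *\<^sub>R x"

lemma GDERIV_test_cos: "GDERIV (test_cos \<xi> \<theta> \<delta>) x :> test_cos_grad \<xi> \<theta> \<delta> x"
  unfolding gderiv_def test_cos_def[abs_def] test_cos_grad_def
  by (rule derivative_eq_intros refl)+ (auto simp: fun_eq_iff inner_commute inner_diff_right algebra_simps)

lemma gradient_test_cos: "gradient (test_cos \<xi> \<theta> \<delta>) = test_cos_grad \<xi> \<theta> \<delta>"
  using gradient_eqI[OF GDERIV_test_cos] by (rule ext)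

lemma test_cos_schwartz: "0 < \<delta> \<Longrightarrow> test_cos \<xi> \<theta> \<delta> \<in> schwartz_space"
  unfolding test_cos_def[abs_def]
  using damped_trig_schwartz[OF damped_trig.intros[of "\<lambda>_. 1" "\<lambda>_. 0" \<xi> \<theta> \<delta>]] by auto

text \<open>Dilating a damped cosine gives a damped cosine with frequency
  \<open>t *\<^sub>R \<xi>\<close> and width parameter \<open>t * s\<close>. Hence the Stein
  identity for this family is available along the whole ray, not only at
  \<open>t = 1\<close>.\<close>

lemma test_cos_grad_scale: "test_cos_grad (t *\<^sub>R \<xi>) \<theta> ((t * s)\<^sup>2 / 2) y = t *\<^sub>R test_cos_grad \<xi> \<theta> (s\<^sup>2 / 2) (t *\<^sub>R y)"
  by (simp add: test_cos_grad_def algebra_simps power2_eq_square)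

text \<open>What the argument takes from Schwartz functions: boundedness of \<open>f\<close> and the
  Lipschitz gradient control the jump remainder, the bound on \<open>x \<bullet> g x\<close> permits
  differentiation of \<open>E f(t X)\<close> without moments, and integrability provides a bounded
  Fourier transform.\<close>

locale test_function =
  fixes f :: "'a::euclidean_space \<Rightarrow> real" and g :: "'a \<Rightarrow> 'a" and B :: real
  assumes GDERIV: "GDERIV f x :> g x"
    and f_bound: "\<bar>f x\<bar> \<le> B" and g_bound: "norm (g x) \<le> B" and xg_bound: "\<bar>x \<bullet> g x\<bar> \<le> B"
    and g_lipschitz: "norm (g x - g y) \<le> B * norm (x - y)"
    and f_integrable: "integrable lborel f"

text \<open>Finitely many seminorms suffice: first derivatives for the gradient, with weight one for
  \<open>x \<bullet> g x\<close>, second derivatives for the Lipschitz constant, and weight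
  \<open>2 * DIM('a)\<close> on \<open>f\<close> itself for integrability.\<close>

lemma schwartz_test_function:
  fixes f :: "'a::euclidean_space \<Rightarrow> real"
  assumes f: "f \<in> schwartz_space"
  obtains B where "test_function f (gradient f) B"
proof -
  let ?d = "\<lambda>bs. partial_derivs bs f"
  have diff: "?d bs differentiable (at x)" if "set bs \<subseteq> Basis" for bs x
    using f that by (auto simp: schwartz_space_def lists_eq_set)
  have "\<exists>C. \<forall>x. (1 + norm x) ^ m * \<bar>?d bs x\<bar> \<le> C" if "set bs \<subseteq> Basis" for bs m
  proof -
    have "bounded (range (\<lambda>x. (1 + norm x) ^ m * ?d bs x))"
      using f that by (auto simp: schwartz_space_def lists_eq_set)
    then show ?thesis by (auto simp: bounded_iff abs_mult)
  qed
  then obtain K where K: "\<And>bs m x. set bs \<subseteq> Basis \<Longrightarrow> (1 + norm x) ^ m * \<bar>?d bs x\<bar> \<le> K bs m"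
    by metis
  have K0: "\<bar>?d bs x\<bar> \<le> K bs 0" if "set bs \<subseteq> Basis" for bs x using K[OF that, of x 0] by simp
  have fr: "frechet_derivative (?d bs) (at x) v = (\<Sum>b\<in>Basis. (v \<bullet> b) * ?d (b # bs) x)" if "set bs \<subseteq> Basis" for bs x v
  proof -
    have lin: "linear (frechet_derivative (?d bs) (at x))"
      using diff[OF that] by (rule linear_frechet_derivative)
    have "frechet_derivative (?d bs) (at x) v = frechet_derivative (?d bs) (at x) (\<Sum>b\<in>Basis. (v \<bullet> b) *\<^sub>R b)"
      by (simp add: euclidean_representation)
    also have "\<dots> = (\<Sum>b\<in>Basis. (v \<bullet> b) * ?d (b # bs) x)"
      unfolding linear_sum[OF lin] linear_scale[OF lin] by simp
    finally show ?thesis .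
  qed
  have grad: "GDERIV f x :> (\<Sum>b\<in>Basis. ?d [b] x *\<^sub>R b)" for x
  proof -
    have "(f has_derivative frechet_derivative f (at x)) (at x)"
      using frechet_derivative_works[THEN iffD1, OF diff[of "[]" x]] by simp
    moreover have "frechet_derivative f (at x) = (\<lambda>v. v \<bullet> (\<Sum>b\<in>Basis. ?d [b] x *\<^sub>R b))"
    proof
      fix v
      show "frechet_derivative f (at x) v = v \<bullet> (\<Sum>b\<in>Basis. ?d [b] x *\<^sub>R b)"
        using fr[of "[]" x v] by (simp add: inner_sum_right mult.commute del: partial_derivs.simps(2)) 
    qed
    ultimately show ?thesis unfolding gderiv_def by (rule has_derivative_eq_rhs)
  qed
  have gr: "gradient f x = (\<Sum>b\<in>Basis. ?d [b] x *\<^sub>R b)" for x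
    by (rule gradient_eqI[OF grad])
  have gle: "norm (gradient f x) \<le> (\<Sum>b\<in>Basis. \<bar>?d [b] x\<bar>)" for x
    unfolding gr by (rule order_trans[OF norm_sum]) simp
  \<comment> \<open>Bounds the operator norm of the derivative of the partial derivative along
    \<open>b\<close> by second partial derivatives; the mean value inequality then makes it a
    Lipschitz constant.\<close>
  define L where "L b = (\<Sum>b'\<in>Basis. K [b', b] 0)" for b
  have lip: "\<bar>?d [b] x - ?d [b] y\<bar> \<le> L b * norm (x - y)" if b: "b \<in> Basis" for b x y
  proof -
    have "norm (?d [b] x - ?d [b] y) \<le> L b * norm (x - y)"
    proof (rule differentiable_bound[where S=UNIV])
      fix z
      show "(?d [b] has_derivative frechet_derivative (?d [b]) (at z)) (at z within UNIV)"
        using frechet_derivative_works[THEN iffD1, OF diff[of "[b]" z]] b by simp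
      show "onorm (frechet_derivative (?d [b]) (at z)) \<le> L b"
      proof (rule onorm_le)
        fix v
        have "norm (frechet_derivative (?d [b]) (at z) v) \<le> (\<Sum>b'\<in>Basis. \<bar>v \<bullet> b'\<bar> * \<bar>?d [b', b] z\<bar>)"
          using fr[of "[b]" z v] b by (auto simp: abs_mult[symmetric] intro!: sum_abs)
        also have "\<dots> \<le> (\<Sum>b'\<in>Basis. norm v * K [b', b] 0)"
          using b by (intro sum_mono mult_mono Basis_le_norm K0) auto
        finally show "norm (frechet_derivative (?d [b]) (at z) v) \<le> L b * norm v"
          by (simp add: L_def sum_distrib_left sum_distrib_right mult.commute)
      qed
    qed auto
    then show ?thesis by simp
  qed
  define B where "B = \<bar>K [] 0\<bar> + (\<Sum>b\<in>Basis. K [b] 0) + (\<Sum>b\<in>Basis. K [b] 1) + (\<Sum>b\<in>Basis. L b)"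
  have Knn: "0 \<le> K bs m" if "set bs \<subseteq> Basis" for bs m
    using K[OF that, of 0 m] by (auto intro: order_trans[rotated])
  have nn: "0 \<le> (\<Sum>b\<in>Basis. K [b] 0)" "0 \<le> (\<Sum>b\<in>Basis. K [b] 1)" "0 \<le> (\<Sum>b\<in>Basis. L b)"
    unfolding L_def by (intro sum_nonneg Knn; simp)+
  have "test_function f (gradient f) B"
  proof
    fix x y :: 'a
    show "GDERIV f x :> gradient f x" using grad gr by simp
    show "\<bar>f x\<bar> \<le> B" using K0[of "[]" x] nn by (simp add: B_def)
    have "norm (gradient f x) \<le> (\<Sum>b\<in>Basis. K [b] 0)"
      by (rule order_trans[OF gle sum_mono], rule K0) auto
    then show "norm (gradient f x) \<le> B" using nn by (simp add: B_def)
    have "\<bar>x \<bullet> gradient f x\<bar> \<le> norm x * norm (gradient f x)" by (rule Cauchy_Schwarz_ineq2)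
    also have "\<dots> \<le> (1 + norm x) * (\<Sum>b\<in>Basis. \<bar>?d [b] x\<bar>)"
      by (intro mult_mono gle) auto
    also have "\<dots> \<le> (\<Sum>b\<in>Basis. K [b] 1)"
      unfolding sum_distrib_left using K[of "[_]" x 1] by (intro sum_mono) simp
    finally show "\<bar>x \<bullet> gradient f x\<bar> \<le> B" using nn by (simp add: B_def)
    have "norm (gradient f x - gradient f y) \<le> (\<Sum>b\<in>Basis. \<bar>?d [b] x - ?d [b] y\<bar>)"
      unfolding gr sum_subtractf[symmetric] scaleR_diff_left[symmetric]
      by (rule order_trans[OF norm_sum]) simp
    also have "\<dots> \<le> (\<Sum>b\<in>Basis. L b) * norm (x - y)"
      unfolding sum_distrib_right by (intro sum_mono lip)
    also have "\<dots> \<le> B * norm (x - y)"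
      using nn by (intro mult_right_mono) (auto simp: B_def)
    finally show "norm (gradient f x - gradient f y) \<le> B * norm (x - y)" .
  next
    have "continuous_on UNIV f"
      using diff[of "[]"] by (auto intro!: continuous_at_imp_continuous_on differentiable_imp_continuous_within)
    then have "f \<in> borel_measurable borel" by (rule borel_measurable_continuous_onI)
    then show "integrable lborel f"
      using K[of "[]" _ "2 * DIM('a)"] by (intro integrable_lborel_decay) auto
  qed
  then show ?thesis by (rule that)
qed

section \<open>Gaussian smoothing\<close>

lemma GDERIV_imp_DERIV_line:
  assumes "GDERIV f (y + s *\<^sub>R v) :> D"
  shows "((\<lambda>s. f (y + s *\<^sub>R v)) has_real_derivative v \<bullet> D) (at s)"
proof -
  have "((\<lambda>s. y + s *\<^sub>R v) has_derivative (\<lambda>h. h *\<^sub>R v)) (at s)"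
    by (auto intro!: derivative_eq_intros)
  from has_derivative_compose[OF this assms[unfolded gderiv_def]]
  show ?thesis unfolding has_field_derivative_def
    by (rule has_derivative_eq_rhs) (simp add: fun_eq_iff mult.commute)
qed

context test_function
begin

lemma DERIV_line: "((\<lambda>s. f (y + s *\<^sub>R v)) has_real_derivative v \<bullet> g (y + s *\<^sub>R v)) (at s)"
  by (rule GDERIV_imp_DERIV_line[OF GDERIV])

lemma B_nonneg: "0 \<le> B"
  using f_bound[of 0] by linarith

lemma continuous_f: "continuous_on UNIV f"
  using GDERIV by (auto simp: gderiv_def intro!: has_derivative_continuous continuous_at_imp_continuous_on)

lemma continuous_g: "continuous_on UNIV g"
proof (rule lipschitz_on_continuous_on[where L=B])
  show "B-lipschitz_on UNIV g"
    using g_lipschitz B_nonneg by (auto intro!: lipschitz_onI simp: dist_norm)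
qed

lemma f_measurable[measurable]: "f \<in> borel_measurable borel"
  and g_measurable[measurable]: "g \<in> borel_measurable borel"
  by (auto intro!: borel_measurable_continuous_onI continuous_f continuous_g)

text \<open>For small jumps the mean value theorem on the segment from \<open>y\<close> to
  \<open>y + u\<close> turns the remainder into an increment of \<open>g\<close>, so the Lipschitz
  bound yields a second factor \<open>norm u\<close>. Large jumps use boundedness of
  \<open>f\<close> only. The estimate is uniform in \<open>y\<close>.\<close>

lemma jump_remainder_bound: "\<bar>jump_remainder f g y u\<bar> \<le> 2 * B * min 1 ((norm u)\<^sup>2)"
proof (cases "norm u \<le> 1")
  case True
  obtain s where s: "0 < s" "s < 1" "f (y + 1 *\<^sub>R u) - f (y + 0 *\<^sub>R u) = (1 - 0) * (u \<bullet> g (y + s *\<^sub>R u))"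
    using MVT2[of 0 1 "\<lambda>s. f (y + s *\<^sub>R u)" "\<lambda>s. u \<bullet> g (y + s *\<^sub>R u)"] DERIV_line by auto
  then have "jump_remainder f g y u = u \<bullet> (g (y + s *\<^sub>R u) - g y)"
    using True by (simp add: jump_remainder_def inner_commute inner_diff_right)
  also have "\<bar>\<dots>\<bar> \<le> norm u * norm (g (y + s *\<^sub>R u) - g y)" by (rule Cauchy_Schwarz_ineq2)
  also have "\<dots> \<le> norm u * (B * norm u)"
  proof (intro mult_left_mono)
    have "norm (g (y + s *\<^sub>R u) - g y) \<le> B * norm (y + s *\<^sub>R u - y)" by (rule g_lipschitz)
    also have "\<dots> \<le> B * norm u" using s B_nonneg by (intro mult_left_mono) (auto intro: mult_left_le_one_le)
    finally show "norm (g (y + s *\<^sub>R u) - g y) \<le> B * norm u" .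
  qed simp
  also have "\<dots> \<le> 2 * B * (norm u)\<^sup>2" using B_nonneg by (simp add: power2_eq_square)
  also have "(norm u)\<^sup>2 = min 1 ((norm u)\<^sup>2)" using True by (simp add: min_absorb2 power_le_one)
  finally show ?thesis .
next
  case False
  then have "\<bar>jump_remainder f g y u\<bar> \<le> 2 * B"
    using f_bound[of "y + u"] f_bound[of y] by (simp add: jump_remainder_def)
  also have "\<dots> = 2 * B * min 1 ((norm u)\<^sup>2)"
    using False one_le_power[of "norm u" 2] by (simp add: min_absorb1)
  finally show ?thesis .
qed

lemma jump_remainder_measurable[measurable]:
  "(\<lambda>(y, u). jump_remainder f g y u) \<in> borel_measurable (borel \<Otimes>\<^sub>M borel)"
  unfolding jump_remainder_def by measurable

end

lemma (in levy_jumps) integrable_jump_remainder: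
  assumes "test_function f g B"
  shows "integrable \<nu> (jump_remainder f g y)"
proof -
  interpret test_function f g B by fact
  show ?thesis
  proof (rule Bochner_Integration.integrable_bound)
    show "integrable \<nu> (\<lambda>u. 2 * B * min 1 ((norm u)\<^sup>2))" using integrable_weight by simp
    show "AE u in \<nu>. norm (jump_remainder f g y u) \<le> norm (2 * B * min 1 ((norm u)\<^sup>2))"
      using jump_remainder_bound[of y] by (intro AE_I2) (auto intro: order_trans[OF _ abs_ge_self])
  qed measurable
qed

text \<open>The characteristic function of \<open>gaussian\<close>; without a normalizing constant
  this identity is exact.\<close>

definition gauss_kernel :: "'a::euclidean_space \<Rightarrow> real" where
  "gauss_kernel y = exp (- (1/2) * (norm y)\<^sup>2)"

lemma gauss_kernel_measurable[measurable]: "gauss_kernel \<in> borel_measurable borel"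
  unfolding gauss_kernel_def by measurable

lemma gauss_kernel_pos: "0 < gauss_kernel y" and gauss_kernel_nonneg[simp]: "0 \<le> gauss_kernel y"
  by (auto simp: gauss_kernel_def)

lemma integrable_gauss_kernel': "integrable lborel (gauss_kernel :: 'a::euclidean_space \<Rightarrow> real)"
  unfolding gauss_kernel_def by (rule integrable_gauss_kernel) simp

lemma integrable_norm_gauss_kernel: "integrable lborel (\<lambda>y::'a::euclidean_space. gauss_kernel y * norm y)"
proof (rule Bochner_Integration.integrable_bound)
  show "integrable lborel (\<lambda>y::'a. exp 1 * exp (- (1/4) * (norm y)\<^sup>2))"
    using integrable_gauss_kernel[of "1/4"] by simp
  show "AE y::'a in lborel. norm (gauss_kernel y * norm y) \<le> norm (exp 1 * exp (- (1/4) * (norm y)\<^sup>2))"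
  proof (rule AE_I2)
    fix y :: 'a
    \<comment> \<open>Half of the Gaussian exponent is spent on absorbing the factor
      \<open>norm y\<close>, and the other half keeps the bound integrable.\<close>
    have "norm y \<le> 1 + (norm y)\<^sup>2 / 4"
      using zero_le_power2[of "norm y / 2 - 1"] by (simp add: power2_diff power_divide)
    moreover have "norm y \<le> exp (norm y)" using exp_ge_add_one_self[of "norm y"] by linarith
    ultimately have "norm y \<le> exp (1 + (norm y)\<^sup>2 / 4)" by (meson exp_le_cancel_iff order_trans)
    then have "gauss_kernel y * norm y \<le> gauss_kernel y * exp (1 + (norm y)\<^sup>2 / 4)" by (intro mult_left_mono) auto
    also have "\<dots> = exp 1 * exp (- (1/4) * (norm y)\<^sup>2)"
      by (simp add: gauss_kernel_def exp_add[symmetric])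
    finally show "norm (gauss_kernel y * norm y) \<le> norm (exp 1 * exp (- (1/4) * (norm y)\<^sup>2))" by simp
  qed
qed simp

definition gauss_mass :: "'a::euclidean_space itself \<Rightarrow> real" where
  "gauss_mass _ = (LINT y|(lborel :: 'a measure). gauss_kernel y)"

text \<open>Allows the common factor \<open>gauss_mass\<close> to be cancelled from the Stein
  identity after the smoothing has been removed.\<close>

lemma gauss_mass_pos: "0 < gauss_mass TYPE('a::euclidean_space)"
proof -
  have "gauss_mass TYPE('a) \<noteq> 0"
  proof
    assume "gauss_mass TYPE('a) = 0"
    then have "AE y::'a in lborel. gauss_kernel y = 0"
      unfolding gauss_mass_def by (subst (asm) integral_nonneg_eq_0_iff_AE[OF integrable_gauss_kernel']) auto
    then have "AE y::'a in lborel. False"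
      using gauss_kernel_pos by (auto simp: less_le)
    then show False by (simp add: AE_iff_measurable[where N=UNIV])
  qed
  moreover have "0 \<le> gauss_mass TYPE('a)" by (simp add: gauss_mass_def)
  ultimately show ?thesis by simp
qed

section \<open>Convolution with a scaled Gaussian kernel\<close>

context test_function
begin

text \<open>The Gaussian kernel is not normalized: \<open>smooth h\<close> tends to \<open>gauss_mass\<close> times \<open>f\<close>.\<close>

definition smooth :: "real \<Rightarrow> 'a \<Rightarrow> real" where
  "smooth h x = (LINT z|lborel. gauss_kernel z * f (x - h *\<^sub>R z))"

definition smooth_grad :: "real \<Rightarrow> 'a \<Rightarrow> 'a" where
  "smooth_grad h x = (LINT z|lborel. gauss_kernel z *\<^sub>R g (x - h *\<^sub>R z))"

lemma integrable_against_kernel: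
  fixes q :: "'a \<Rightarrow> 'b::{banach, second_countable_topology}"
  assumes "q \<in> borel_measurable borel" "\<And>z. norm (q z) \<le> K"
  shows "integrable lborel (\<lambda>z. gauss_kernel z *\<^sub>R q z)"
proof (rule Bochner_Integration.integrable_bound)
  have K: "0 \<le> K" by (rule order_trans[OF norm_ge_zero assms(2)])
  show "integrable lborel (\<lambda>z::'a. K * gauss_kernel z)" by (simp add: integrable_gauss_kernel')
  show "AE z in lborel. norm (gauss_kernel z *\<^sub>R q z) \<le> norm (K * gauss_kernel z)"
  proof (rule AE_I2)
    fix z
    show "norm (gauss_kernel z *\<^sub>R q z) \<le> norm (K * gauss_kernel z)"
      using mult_left_mono[OF assms(2)[of z] gauss_kernel_nonneg[of z]] K by (simp add: mult.commute[of K] abs_mult)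
  qed
qed (use assms in simp)

lemma integrable_smooth: "integrable lborel (\<lambda>z. gauss_kernel z * f (x - h *\<^sub>R z))"
  using integrable_against_kernel[of "\<lambda>z. f (x - h *\<^sub>R z)" B] f_bound by simp

lemma integrable_smooth_grad: "integrable lborel (\<lambda>z. gauss_kernel z *\<^sub>R g (x - h *\<^sub>R z))"
  using integrable_against_kernel[of "\<lambda>z. g (x - h *\<^sub>R z)" B] g_bound by simp

lemma inner_smooth_grad: "v \<bullet> smooth_grad h x = (LINT z|lborel. gauss_kernel z * (v \<bullet> g (x - h *\<^sub>R z)))"
  unfolding smooth_grad_def using integral_inner_right[OF integrable_smooth_grad[of x h], of v] by simp

lemma DERIV_smooth: "((\<lambda>s. smooth h (y + s *\<^sub>R v)) has_real_derivative v \<bullet> smooth_grad h (y + s *\<^sub>R v)) (at s)"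
  unfolding smooth_def inner_smooth_grad
proof (rule DERIV_integral[where a="s - 1" and b="s + 1" and w="\<lambda>z. norm v * B * gauss_kernel z"])
  fix t and z :: 'a
  have "((\<lambda>s. f ((y - h *\<^sub>R z) + s *\<^sub>R v)) has_real_derivative v \<bullet> g ((y - h *\<^sub>R z) + t *\<^sub>R v)) (at t)"
    by (rule DERIV_line)
  then show "((\<lambda>t. gauss_kernel z * f (y + t *\<^sub>R v - h *\<^sub>R z)) has_real_derivative gauss_kernel z * (v \<bullet> g (y + t *\<^sub>R v - h *\<^sub>R z))) (at t)"
    by (intro DERIV_cmult) (simp add: algebra_simps)
  have "\<bar>v \<bullet> g (y + t *\<^sub>R v - h *\<^sub>R z)\<bar> \<le> norm v * B"
    by (intro order_trans[OF Cauchy_Schwarz_ineq2] mult_left_mono g_bound) auto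
  then show "\<bar>gauss_kernel z * (v \<bullet> g (y + t *\<^sub>R v - h *\<^sub>R z))\<bar> \<le> norm v * B * gauss_kernel z"
    by (simp add: abs_mult mult.commute mult_left_mono)
qed (auto simp: integrable_smooth integrable_gauss_kernel')

text \<open>Split \<open>x\<close> into \<open>x - h *\<^sub>R z\<close> and
  \<open>h *\<^sub>R z\<close>: the first part is covered by \<open>xg_bound\<close> at the shifted
  point, and the second grows only like \<open>norm z\<close>, which the kernel integrates. So
  smoothing preserves the substitute for a first moment, uniformly for bounded
  \<open>h\<close>.\<close>

lemma smooth_grad_bound: "\<bar>x \<bullet> smooth_grad h x\<bar> \<le> B * gauss_mass TYPE('a) + \<bar>h\<bar> * B * (LINT z|(lborel::'a measure). gauss_kernel z * norm z)"
proof -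
  have i1: "integrable lborel (\<lambda>z. gauss_kernel z * (x \<bullet> g (x - h *\<^sub>R z)))"
    using integrable_inner_right[OF integrable_smooth_grad[of x h], of x] by simp
  have i2: "integrable lborel (\<lambda>z::'a. B * gauss_kernel z + \<bar>h\<bar> * B * (gauss_kernel z * norm z))"
    by (simp add: integrable_gauss_kernel' integrable_norm_gauss_kernel)
  have "norm (x \<bullet> smooth_grad h x) \<le> (LINT z|(lborel::'a measure). B * gauss_kernel z + \<bar>h\<bar> * B * (gauss_kernel z * norm z))"
    unfolding inner_smooth_grad
  proof (rule Bochner_Integration.integral_norm_bound_integral[OF i1 i2])
    fix z :: 'a
    have "x \<bullet> g (x - h *\<^sub>R z) = (x - h *\<^sub>R z) \<bullet> g (x - h *\<^sub>R z) + h * (z \<bullet> g (x - h *\<^sub>R z))"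
      by (simp add: inner_diff_left)
    also have "\<bar>\<dots>\<bar> \<le> \<bar>(x - h *\<^sub>R z) \<bullet> g (x - h *\<^sub>R z)\<bar> + \<bar>h\<bar> * \<bar>z \<bullet> g (x - h *\<^sub>R z)\<bar>"
      by (rule order_trans[OF abs_triangle_ineq]) (simp add: abs_mult)
    also have "\<dots> \<le> B + \<bar>h\<bar> * (norm z * B)"
      by (intro add_mono mult_left_mono xg_bound order_trans[OF Cauchy_Schwarz_ineq2] g_bound) auto
    finally have "gauss_kernel z * \<bar>x \<bullet> g (x - h *\<^sub>R z)\<bar> \<le> gauss_kernel z * (B + \<bar>h\<bar> * (norm z * B))"
      by (intro mult_left_mono) auto
    then show "norm (gauss_kernel z * (x \<bullet> g (x - h *\<^sub>R z))) \<le> B * gauss_kernel z + \<bar>h\<bar> * B * (gauss_kernel z * norm z)"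
      by (simp add: abs_mult algebra_simps)
  qed
  also have "\<dots> = B * gauss_mass TYPE('a) + \<bar>h\<bar> * B * (LINT z|(lborel::'a measure). gauss_kernel z * norm z)"
    unfolding gauss_mass_def by (simp add: integrable_gauss_kernel' integrable_norm_gauss_kernel)
  finally show ?thesis by simp
qed

lemma jump_remainder_smooth:
  "jump_remainder (smooth h) (smooth_grad h) y u = (LINT z|lborel. gauss_kernel z * jump_remainder f g (y - h *\<^sub>R z) u)"
proof -
  have i1: "integrable lborel (\<lambda>z. gauss_kernel z * (u \<bullet> g (y - h *\<^sub>R z)))"
    using integrable_inner_right[OF integrable_smooth_grad[of y h], of u] by simp
  have "jump_remainder (smooth h) (smooth_grad h) y u = (LINT z|lborel. gauss_kernel z * f (y + u - h *\<^sub>R z) - gauss_kernel z * f (y - h *\<^sub>R z) -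
    gauss_kernel z * (u \<bullet> g (y - h *\<^sub>R z)) * indicator {u. norm u \<le> 1} u)"
    unfolding jump_remainder_def inner_commute[of "smooth_grad h y"] inner_smooth_grad
    using i1 integrable_smooth by (simp add: smooth_def)
  also have "\<dots> = (LINT z|lborel. gauss_kernel z * jump_remainder f g (y - h *\<^sub>R z) u)"
    by (intro Bochner_Integration.integral_cong refl) (simp add: jump_remainder_def algebra_simps inner_commute)
  finally show ?thesis .
qed

text \<open>Independent of \<open>h\<close> and \<open>y\<close>, hence a dominating function both
  for the jump integral and for the expectation when \<open>h\<close> tends to
  \<open>0\<close>.\<close>

lemma jump_remainder_smooth_bound:
  "\<bar>jump_remainder (smooth h) (smooth_grad h) y u\<bar> \<le> gauss_mass TYPE('a) * (2 * B * min 1 ((norm u)\<^sup>2))"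
proof -
  have "norm (LINT z|lborel. gauss_kernel z * jump_remainder f g (y - h *\<^sub>R z) u) \<le> (LINT z|(lborel::'a measure). gauss_kernel z * (2 * B * min 1 ((norm u)\<^sup>2)))"
  proof (rule Bochner_Integration.integral_norm_bound_integral)
    show "integrable lborel (\<lambda>z. gauss_kernel z * jump_remainder f g (y - h *\<^sub>R z) u)"
      using integrable_against_kernel[of "\<lambda>z. jump_remainder f g (y - h *\<^sub>R z) u" "2 * B * min 1 ((norm u)\<^sup>2)"] jump_remainder_bound by simp
    show "norm (gauss_kernel z * jump_remainder f g (y - h *\<^sub>R z) u) \<le> gauss_kernel z * (2 * B * min 1 ((norm u)\<^sup>2))" for z
      using jump_remainder_bound by (simp add: abs_mult mult_left_mono)
  qed (auto simp: integrable_gauss_kernel')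
  then show ?thesis by (simp add: jump_remainder_smooth gauss_mass_def)
qed

lemma kernel_limit:
  fixes q :: "'a \<Rightarrow> 'b::{banach, second_countable_topology}"
  assumes q: "continuous_on UNIV q" "\<And>z. norm (q z) \<le> K" and h: "h \<longlonglongrightarrow> 0"
  shows "(\<lambda>n. LINT z|lborel. gauss_kernel z *\<^sub>R q (y - h n *\<^sub>R z)) \<longlonglongrightarrow> gauss_mass TYPE('a) *\<^sub>R q y"
proof -
  have [measurable]: "q \<in> borel_measurable borel" by (rule borel_measurable_continuous_onI[OF q(1)])
  have "(\<lambda>n. LINT z|lborel. gauss_kernel z *\<^sub>R q (y - h n *\<^sub>R z)) \<longlonglongrightarrow> (LINT z|(lborel :: 'a measure). gauss_kernel z *\<^sub>R q y)"
  proof (rule integral_dominated_convergence[where w="\<lambda>z. K * gauss_kernel z"])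
    show "AE z in lborel. (\<lambda>n. gauss_kernel z *\<^sub>R q (y - h n *\<^sub>R z)) \<longlonglongrightarrow> gauss_kernel z *\<^sub>R q y"
    proof (rule AE_I2, intro tendsto_intros)
      fix z :: 'a
      have "(\<lambda>n. y - h n *\<^sub>R z) \<longlonglongrightarrow> y - 0 *\<^sub>R z" by (intro tendsto_intros h)
      then show "(\<lambda>n. q (y - h n *\<^sub>R z)) \<longlonglongrightarrow> q y"
        using continuous_on_tendsto_compose[OF q(1), of "\<lambda>n. y - h n *\<^sub>R z" "y" sequentially] by simp
    qed
    show "AE z in lborel. norm (gauss_kernel z *\<^sub>R q (y - h n *\<^sub>R z)) \<le> K * gauss_kernel z" for n
      using q(2) by (intro AE_I2) (simp add: mult.commute[of K] mult_left_mono)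
  qed (auto simp: integrable_gauss_kernel')
  then show ?thesis by (simp add: gauss_mass_def integrable_gauss_kernel')
qed

lemma smooth_grad_limit: "h \<longlonglongrightarrow> 0 \<Longrightarrow> (\<lambda>n. smooth_grad (h n) y) \<longlonglongrightarrow> gauss_mass TYPE('a) *\<^sub>R g y"
  unfolding smooth_grad_def by (rule kernel_limit[OF continuous_g g_bound])

lemma jump_remainder_smooth_limit:
  assumes "h \<longlonglongrightarrow> 0"
  shows "(\<lambda>n. jump_remainder (smooth (h n)) (smooth_grad (h n)) y u) \<longlonglongrightarrow> gauss_mass TYPE('a) * jump_remainder f g y u"
proof -
  have "continuous_on UNIV (\<lambda>y. jump_remainder f g y u)"
    unfolding jump_remainder_def
    by (intro continuous_intros continuous_on_compose2[OF continuous_f] continuous_on_compose2[OF continuous_g]) auto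
  from kernel_limit[OF this, of "2 * B * min 1 ((norm u)\<^sup>2)", OF _ assms] show ?thesis
    unfolding jump_remainder_smooth using jump_remainder_bound[of _ u] by simp
qed

text \<open>The Fourier transform of \<open>f\<close> at the frequency \<open>z / h\<close>,
  weighted so that a standard Gaussian \<open>z\<close> reproduces \<open>smooth h\<close>; the
  power of \<open>h\<close> is the Jacobian of \<open>y = x - h *\<^sub>R z\<close>.\<close>

definition fourier :: "real \<Rightarrow> 'a \<Rightarrow> complex" where
  "fourier h z = complex_of_real (1 / h ^ DIM('a)) * (CLINT y|lborel. complex_of_real (f y) * iexp (- (((1 / h) *\<^sub>R z) \<bullet> y)))"

lemma fourier_measurable[measurable]: "fourier h \<in> borel_measurable borel"
  unfolding fourier_def by measurable

lemma fourier_bound: "0 < h \<Longrightarrow> cmod (fourier h z) \<le> (1 / h ^ DIM('a)) * (LINT y|lborel. \<bar>f y\<bar>)"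
proof -
  have "cmod (CLINT y|lborel. complex_of_real (f y) * iexp (- (((1 / h) *\<^sub>R z) \<bullet> y))) \<le> (LINT y|lborel. \<bar>f y\<bar>)"
    by (rule order_trans[OF integral_norm_bound]) (simp add: norm_mult)
  then show "0 < h \<Longrightarrow> ?thesis" unfolding fourier_def by (simp add: norm_mult norm_divide norm_power divide_right_mono)
qed

lemma exponential_mixture_fourier: "0 < h \<Longrightarrow> exponential_mixture gaussian (fourier h) (\<lambda>z. (1 / h) *\<^sub>R z)"
proof unfold_locales
  assume h: "0 < h"
  interpret G: prob_space "gaussian :: 'a measure" by (rule prob_space_gaussian)
  show "\<exists>A. countable A \<and> A \<subseteq> sets (gaussian::'a measure) \<and> \<Union> A = space (gaussian::'a measure) \<and> (\<forall>a\<in>A. emeasure (gaussian::'a measure) a \<noteq> \<infinity>)"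
    using G.sigma_finite_countable by blast
  let ?K = "(1 / h ^ DIM('a)) * (LINT y|lborel. \<bar>f y\<bar>)"
  show "integrable gaussian (\<lambda>z. cmod (fourier h z) * (1 + (norm ((1 / h) *\<^sub>R z))\<^sup>2))"
  proof (rule Bochner_Integration.integrable_bound)
    show "integrable gaussian (\<lambda>z::'a. ?K * (1 + (1 / h)\<^sup>2 * (norm z)\<^sup>2))"
      using integrable_gaussian_norm_power2 by (intro integrable_mult_right Bochner_Integration.integrable_add) auto
    show "AE z in gaussian. norm (cmod (fourier h z) * (1 + (norm ((1 / h) *\<^sub>R z))\<^sup>2)) \<le> norm (?K * (1 + (1 / h)\<^sup>2 * (norm z)\<^sup>2))"
    proof (rule AE_I2)
      fix z :: 'a
      have "cmod (fourier h z) * (1 + (norm ((1 / h) *\<^sub>R z))\<^sup>2) \<le> ?K * (1 + (1 / h)\<^sup>2 * (norm z)\<^sup>2)"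
        using fourier_bound[OF h, of z] h by (intro mult_mono) (auto simp: power_divide intro!: divide_nonneg_nonneg)
      then show "norm (cmod (fourier h z) * (1 + (norm ((1 / h) *\<^sub>R z))\<^sup>2)) \<le> norm (?K * (1 + (1 / h)\<^sup>2 * (norm z)\<^sup>2))"
        using h by (simp add: add_nonneg_nonneg)
    qed
  qed simp
qed simp_all

text \<open>After the change of variables the kernel at \<open>(x - y) / h\<close> is written as a
  Gaussian average of exponentials by \<open>cf_gaussian\<close>. The integrals over
  \<open>y\<close> and \<open>z\<close> can be exchanged because \<open>f\<close> is integrable and
  the exponentials have modulus one; the inner integral is then the Fourier transform of
  \<open>f\<close>.\<close>

lemma smooth_eq_mix:
  assumes h: "0 < h"
  shows "smooth h x = exponential_mixture.mix gaussian (fourier h) (\<lambda>z. (1 / h) *\<^sub>R z) x"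
proof -
  interpret G: prob_space "gaussian :: 'a measure" by (rule prob_space_gaussian)
  interpret P: pair_sigma_finite "lborel :: 'a measure" "gaussian :: 'a measure" ..
  interpret E: exponential_mixture gaussian "fourier h" "\<lambda>z. (1 / h) *\<^sub>R z"
    by (rule exponential_mixture_fourier[OF h])
  let ?k = "\<lambda>y z. Re (complex_of_real (f y) * iexp (((1 / h) *\<^sub>R z) \<bullet> (x - y)))"
  have int: "integrable (lborel \<Otimes>\<^sub>M gaussian) (\<lambda>(y, z). ?k y z)"
  proof (rule Bochner_Integration.integrable_bound)
    have "integrable (lborel \<Otimes>\<^sub>M gaussian) (\<lambda>(y::'a, z::'a). f y * 1)"
      by (rule P.integrable_product) (use f_integrable in auto)
    then show "integrable (lborel \<Otimes>\<^sub>M gaussian) (\<lambda>(y::'a, z::'a). f y * 1)" .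
    show "AE w in lborel \<Otimes>\<^sub>M gaussian. norm (case w of (y, z) \<Rightarrow> ?k y z) \<le> norm (case w of (y, z) \<Rightarrow> f y * 1)"
      by (intro AE_I2, clarify, simp only: real_norm_def, rule order_trans[OF abs_Re_le_cmod]) (simp add: norm_mult)
  qed measurable
  have "smooth h x = (LINT z|lborel. gauss_kernel ((1 / h) *\<^sub>R (x - (x + (- h) *\<^sub>R z))) * f (x + (- h) *\<^sub>R z))"
    using h by (simp add: smooth_def)
  also have "\<dots> = (1 / h ^ DIM('a)) * (LINT y|lborel. gauss_kernel ((1 / h) *\<^sub>R (x - y)) * f y)"
  proof -
    have "(LINT y|lborel. gauss_kernel ((1 / h) *\<^sub>R (x - y)) * f y) =
      (LINT y|density (distr lborel borel (\<lambda>z. x + (- h) *\<^sub>R z)) (\<lambda>_. ennreal (\<bar>- h\<bar> ^ DIM('a))). gauss_kernel ((1 / h) *\<^sub>R (x - y)) * f y)"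
      using lborel_affine[of "- h" x] h by simp
    also have "\<dots> = h ^ DIM('a) * (LINT z|lborel. gauss_kernel ((1 / h) *\<^sub>R (x - (x + (- h) *\<^sub>R z))) * f (x + (- h) *\<^sub>R z))"
      using h by (subst integral_density; (subst integral_distr)?) auto
    finally show ?thesis using h by simp
  qed
  also have "(LINT y|lborel. gauss_kernel ((1 / h) *\<^sub>R (x - y)) * f y) = (LINT y|lborel. LINT z|gaussian. ?k y z)"
  proof (intro Bochner_Integration.integral_cong refl)
    fix y
    have i: "integrable gaussian (\<lambda>z. iexp (((1 / h) *\<^sub>R z) \<bullet> (x - y)))"
      by (rule G.integrable_const_bound[where B=1]) auto
    have "(LINT z|gaussian. ?k y z) = Re (CLINT z|gaussian. complex_of_real (f y) * iexp (((1 / h) *\<^sub>R z) \<bullet> (x - y)))"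
      using i by (intro integral_Re integrable_mult_right) auto
    also have "(CLINT z|gaussian. complex_of_real (f y) * iexp (((1 / h) *\<^sub>R z) \<bullet> (x - y))) =
        complex_of_real (f y) * (CLINT z|gaussian. iexp (((1 / h) *\<^sub>R (x - y)) \<bullet> z))"
      by (subst integral_mult_right_zero[symmetric]) (simp add: inner_commute)
    also have "(CLINT z|gaussian. iexp (((1 / h) *\<^sub>R (x - y)) \<bullet> z)) = complex_of_real (gauss_kernel ((1 / h) *\<^sub>R (x - y)))"
      unfolding cf_gaussian gauss_kernel_def by simp
    also have "Re (complex_of_real (f y) * complex_of_real (gauss_kernel ((1 / h) *\<^sub>R (x - y)))) = gauss_kernel ((1 / h) *\<^sub>R (x - y)) * f y"
      by simp
    finally show "gauss_kernel ((1 / h) *\<^sub>R (x - y)) * f y = (LINT z|gaussian. ?k y z)"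
      by (rule sym)
  qed
  also have "\<dots> = (LINT z|gaussian. LINT y|lborel. ?k y z)"
    by (rule P.Fubini_integral[OF int, symmetric])
  also have "(1 / h ^ DIM('a)) * \<dots> = (LINT z|gaussian. (1 / h ^ DIM('a)) * (LINT y|lborel. ?k y z))"
    by simp
  also have "\<dots> = E.mix x"
    unfolding E.mix_def
  proof (intro Bochner_Integration.integral_cong refl)
    fix z :: 'a
    have i: "integrable lborel (\<lambda>y. complex_of_real (f y) * iexp (- (((1 / h) *\<^sub>R z) \<bullet> y)))"
      by (rule Bochner_Integration.integrable_bound[OF f_integrable]) (auto simp: norm_mult)
    have "(LINT y|lborel. ?k y z) = (LINT y|lborel. Re (iexp (((1 / h) *\<^sub>R z) \<bullet> x) * (complex_of_real (f y) * iexp (- (((1 / h) *\<^sub>R z) \<bullet> y)))))"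
      by (intro Bochner_Integration.integral_cong refl arg_cong[where f=Re]) (simp add: inner_diff_right exp_diff exp_minus field_simps)
    also have "\<dots> = Re (iexp (((1 / h) *\<^sub>R z) \<bullet> x) * (CLINT y|lborel. complex_of_real (f y) * iexp (- (((1 / h) *\<^sub>R z) \<bullet> y))))"
      using i by (subst integral_Re) auto
    finally have "(1 / h ^ DIM('a)) * (LINT y|lborel. ?k y z) = Re (complex_of_real (1 / h ^ DIM('a)) * (iexp (((1 / h) *\<^sub>R z) \<bullet> x) * (CLINT y|lborel. complex_of_real (f y) * iexp (- (((1 / h) *\<^sub>R z) \<bullet> y)))))"
      by (simp only: Re_complex_of_real times_complex.sel Im_complex_of_real)
    then show "(1 / h ^ DIM('a)) * (LINT y|lborel. ?k y z) = Re (fourier h z * iexp (((1 / h) *\<^sub>R z) \<bullet> x))"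
      by (simp only: fourier_def mult_ac)
  qed
  finally show ?thesis .
qed

text \<open>Both vector fields give the directional derivatives of the same function, so uniqueness
  of derivatives replaces a second exchange of integrals.\<close>

lemma smooth_grad_eq_mix_grad:
  assumes h: "0 < h"
  shows "smooth_grad h x = exponential_mixture.mix_grad gaussian (fourier h) (\<lambda>z. (1 / h) *\<^sub>R z) x"
proof -
  interpret E: exponential_mixture gaussian "fourier h" "\<lambda>z. (1 / h) *\<^sub>R z"
    by (rule exponential_mixture_fourier[OF h])
  have "v \<bullet> smooth_grad h x = v \<bullet> E.mix_grad x" for v
    using DERIV_smooth[of h x v 0] E.DERIV_mix[of x v 0] DERIV_unique
    unfolding smooth_eq_mix[OF h] by fastforce
  then show ?thesis by (metis vector_eq_ldot)
qed

end

section \<open>From the characteristic function to the Stein identity\<close>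

lemma has_real_derivative_Re_mult:
  assumes "(f has_vector_derivative D) (at t)"
  shows "((\<lambda>t. Re (a * f t)) has_real_derivative Re (a * D)) (at t)"
  unfolding has_real_derivative_iff_has_vector_derivative
  using bounded_linear.has_vector_derivative[OF bounded_linear_compose[OF bounded_linear_Re bounded_linear_mult_right] assms] .

context test_function
begin

lemma smooth_measurable[measurable]: "smooth h \<in> borel_measurable borel"
  and smooth_grad_measurable[measurable]: "smooth_grad h \<in> borel_measurable borel"
  unfolding smooth_def[abs_def] smooth_grad_def[abs_def] by measurable

lemma smooth_bound: "\<bar>smooth h x\<bar> \<le> gauss_mass TYPE('a) * B"
proof -
  have "norm (smooth h x) \<le> (LINT z|(lborel::'a measure). gauss_kernel z * B)"
    unfolding smooth_def
    by (rule Bochner_Integration.integral_norm_bound_integral[OF integrable_smooth])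
      (auto simp: integrable_gauss_kernel' f_bound abs_mult mult_left_mono)
  then show ?thesis by (simp add: gauss_mass_def)
qed

lemma norm_smooth_grad_bound: "norm (smooth_grad h x) \<le> gauss_mass TYPE('a) * B"
proof -
  have "norm (smooth_grad h x) \<le> (LINT z|(lborel::'a measure). gauss_kernel z * B)"
    unfolding smooth_grad_def
    by (rule Bochner_Integration.integral_norm_bound_integral[OF integrable_smooth_grad])
      (auto simp: integrable_gauss_kernel' g_bound mult_left_mono)
  then show ?thesis by (simp add: gauss_mass_def)
qed

end

locale levy_law = levy_dilation \<nu>' \<nu> b mean
  for \<nu>' \<nu> :: "'a::euclidean_space measure" and b mean :: 'a +
  fixes \<mu> :: "'a measure"
  assumes prob_\<mu>: "prob_space \<mu>" and sets_\<mu>[measurable_cong]: "sets \<mu> = sets borel"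
begin

sublocale \<mu>: prob_space \<mu> by (rule prob_\<mu>)

definition \<phi> :: "'a \<Rightarrow> complex" where
  "\<phi> \<xi> = (CLINT y|\<mu>. iexp (\<xi> \<bullet> y))"

lemma norm_\<phi>_le: "cmod (\<phi> \<xi>) \<le> 1"
proof -
  have "cmod (\<phi> \<xi>) \<le> (LINT y|\<mu>. cmod (iexp (\<xi> \<bullet> y)))" unfolding \<phi>_def by (rule integral_norm_bound)
  then show ?thesis by (simp add: \<mu>.prob_space)
qed

lemma continuous_\<phi>: "continuous_on UNIV \<phi>"
  unfolding continuous_on_sequentially
proof (intro allI ballI impI, elim conjE)
  fix x :: "nat \<Rightarrow> 'a" and x0 assume x: "x \<longlonglongrightarrow> x0"
  have "(\<lambda>n. CLINT y|\<mu>. iexp (x n \<bullet> y)) \<longlonglongrightarrow> (CLINT y|\<mu>. iexp (x0 \<bullet> y))"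
  proof (rule integral_dominated_convergence[where w="\<lambda>_. 1"])
    show "AE y in \<mu>. (\<lambda>n. iexp (x n \<bullet> y)) \<longlonglongrightarrow> iexp (x0 \<bullet> y)"
      by (intro AE_I2 tendsto_intros x)
  qed auto
  then show "(\<phi> \<circ> x) \<longlonglongrightarrow> \<phi> x0" by (simp add: \<phi>_def comp_def)
qed

lemma \<phi>_measurable[measurable]: "\<phi> \<in> borel_measurable borel"
  by (rule borel_measurable_continuous_onI[OF continuous_\<phi>])

lemma integral_mix_scaled:
  assumes "exponential_mixture N F l"
  shows "(LINT y|\<mu>. exponential_mixture.mix N F l (t *\<^sub>R y)) = (LINT z|N. Re (F z * \<phi> (t *\<^sub>R l z)))"
proof -
  interpret E: exponential_mixture N F l by fact
  interpret N: sigma_finite_measure N by (rule E.sigma_finite_N)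
  interpret P: pair_sigma_finite N \<mu> ..
  let ?h = "\<lambda>z y. Re (F z * iexp (l z \<bullet> (t *\<^sub>R y)))"
  have int: "integrable (N \<Otimes>\<^sub>M \<mu>) (\<lambda>(z, y). ?h z y)"
  proof (rule Bochner_Integration.integrable_bound)
    show "integrable (N \<Otimes>\<^sub>M \<mu>) (\<lambda>(z, y). cmod (F z) * (1 + (norm (l z))\<^sup>2) * 1)"
      by (intro P.integrable_product E.integrable_moment) simp
    have "\<bar>?h z y\<bar> \<le> cmod (F z) * (1 + (norm (l z))\<^sup>2)" for z y
      by (rule order_trans[OF abs_Re_le_cmod]) (simp add: norm_mult mult_le_cancel_left1)
    then show "AE w in N \<Otimes>\<^sub>M \<mu>. norm (case w of (z, y) \<Rightarrow> ?h z y) \<le> norm (case w of (z, y) \<Rightarrow> cmod (F z) * (1 + (norm (l z))\<^sup>2) * 1)"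
      by (intro AE_I2) (auto simp del: times_complex.sel intro: order_trans[OF _ abs_ge_self])
  qed measurable
  have "(LINT y|\<mu>. E.mix (t *\<^sub>R y)) = (LINT z|N. LINT y|\<mu>. ?h z y)"
    unfolding E.mix_def by (rule P.Fubini_integral[OF int])
  also have "\<dots> = (LINT z|N. Re (F z * \<phi> (t *\<^sub>R l z)))"
  proof (intro Bochner_Integration.integral_cong refl)
    fix z
    have i: "integrable \<mu> (\<lambda>y. iexp (l z \<bullet> (t *\<^sub>R y)))"
      by (rule \<mu>.integrable_const_bound[where B=1]) auto
    have "(LINT y|\<mu>. ?h z y) = Re (CLINT y|\<mu>. F z * iexp (l z \<bullet> (t *\<^sub>R y)))"
      using i by (intro integral_Re integrable_mult_right) auto
    then show "(LINT y|\<mu>. ?h z y) = Re (F z * \<phi> (t *\<^sub>R l z))"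
      by (simp add: \<phi>_def)
  qed
  finally show ?thesis .
qed

lemma integral_stein_mixture:
  assumes "exponential_mixture N F l"
  shows "(LINT y|\<mu>. stein (exponential_mixture.mix N F l) (exponential_mixture.mix_grad N F l) y) =
    (LINT z|N. Re (F z * (exponent (l z) * \<phi> (l z))))"
proof -
  interpret E: exponential_mixture N F l by fact
  interpret L: levy_mixture \<nu>' "b - mean" N F l ..
  show ?thesis using L.integral_stein_mix[OF _ sets_\<mu>] \<mu>.finite_measure_axioms by (simp add: \<phi>_def mult.assoc)
qed

text \<open>Smoothing is what makes the frequency side differentiable under the integral: its
  Gaussian weight has the second moments that dominate the quadratically growing exponent.\<close>

lemma stein_identity_smooth:
  assumes cf: "\<And>\<xi>. \<phi> \<xi> = exp (image.exponent \<xi>)" and "test_function f g B" and h: "0 < h"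
  shows "(LINT y|\<mu>. y \<bullet> test_function.smooth_grad g h y) =
    (LINT y|\<mu>. stein (test_function.smooth f h) (test_function.smooth_grad g h) y)"
proof -
  interpret T: test_function f g B by fact
  note E = T.exponential_mixture_fourier[OF h]
  interpret E: exponential_mixture gaussian "T.fourier h" "\<lambda>z. (1 / h) *\<^sub>R z" by (rule E)
  let ?F = "T.fourier h" and ?l = "\<lambda>z::'a. (1 / h) *\<^sub>R z"
  have sm: "T.smooth h = E.mix" "T.smooth_grad h = E.mix_grad"
    using T.smooth_eq_mix[OF h] T.smooth_grad_eq_mix_grad[OF h] by auto
  let ?C = "B * gauss_mass TYPE('a) + \<bar>h\<bar> * B * (LINT z|(lborel::'a measure). gauss_kernel z * norm z)"
  \<comment> \<open>\<open>T.smooth_grad_bound\<close> bounds the gradient at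
    \<open>t *\<^sub>R y\<close> paired with \<open>t *\<^sub>R y\<close>. Since
    \<open>t > 1/2\<close>, pairing with \<open>y\<close> instead costs at most a factor
    \<open>2\<close>, and the dominating function is constant.\<close>
  have "((\<lambda>t. LINT y|\<mu>. T.smooth h (t *\<^sub>R y)) has_real_derivative (LINT y|\<mu>. y \<bullet> T.smooth_grad h (1 *\<^sub>R y))) (at 1)"
  proof (rule DERIV_integral[where a="1/2" and b=2 and w="\<lambda>_. 2 * ?C" and f'="\<lambda>t y. y \<bullet> T.smooth_grad h (t *\<^sub>R y)"])
    fix t :: real and y assume t: "t \<in> {1/2<..<2}"
    show "((\<lambda>t. T.smooth h (t *\<^sub>R y)) has_real_derivative y \<bullet> T.smooth_grad h (t *\<^sub>R y)) (at t)"
      using T.DERIV_smooth[of h 0 y t] by simp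
    have "t * \<bar>y \<bullet> T.smooth_grad h (t *\<^sub>R y)\<bar> \<le> ?C"
      using T.smooth_grad_bound[of "t *\<^sub>R y" h] t by (simp add: abs_mult)
    moreover have "(1/2) * \<bar>y \<bullet> T.smooth_grad h (t *\<^sub>R y)\<bar> \<le> t * \<bar>y \<bullet> T.smooth_grad h (t *\<^sub>R y)\<bar>"
      using t by (intro mult_right_mono) auto
    ultimately have "(1/2) * \<bar>y \<bullet> T.smooth_grad h (t *\<^sub>R y)\<bar> \<le> ?C" by (rule order_trans[rotated])
    then have "2 * ((1/2) * \<bar>y \<bullet> T.smooth_grad h (t *\<^sub>R y)\<bar>) \<le> 2 * ?C" by (intro mult_left_mono) auto
    then show "\<bar>y \<bullet> T.smooth_grad h (t *\<^sub>R y)\<bar> \<le> 2 * ?C" by (simp only: mult.assoc[symmetric])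
  next
    fix t :: real
    show "integrable \<mu> (\<lambda>y. T.smooth h (t *\<^sub>R y))"
      using T.smooth_bound[of h] by (intro \<mu>.integrable_const_bound[where B="gauss_mass TYPE('a) * B"]) auto
  qed auto
  then have 1: "((\<lambda>t. LINT z|gaussian. Re (?F z * \<phi> (t *\<^sub>R ?l z))) has_real_derivative (LINT y|\<mu>. y \<bullet> T.smooth_grad h y)) (at 1)"
    unfolding sm integral_mix_scaled[OF E] by simp
  \<comment> \<open>The factor \<open>8\<close> in the dominating function is \<open>2 * 4\<close>:
    for \<open>t\<close> in \<open>(1/2, 2)\<close> one has \<open>1 / t \<le> 2\<close>, and the
    quadratic growth factor increases at most fourfold.\<close>
  have 2: "((\<lambda>t. LINT z|gaussian. Re (?F z * \<phi> (t *\<^sub>R ?l z))) has_real_derivative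
     (LINT z|gaussian. Re (?F z * ((1 / 1) *\<^sub>R exponent (1 *\<^sub>R ?l z) * \<phi> (1 *\<^sub>R ?l z))))) (at 1)"
  proof (rule DERIV_integral[where a="1/2" and b=2 and
        f'="\<lambda>t z. Re (?F z * ((1 / t) *\<^sub>R exponent (t *\<^sub>R ?l z) * \<phi> (t *\<^sub>R ?l z)))" and w="\<lambda>z. 8 * exponent_bound * (cmod (?F z) * (1 + (norm (?l z))\<^sup>2))"])
    fix t :: real and z assume t: "t \<in> {1/2<..<2}"
    have "((exp \<circ> (\<lambda>t. image.exponent (t *\<^sub>R ?l z))) has_vector_derivative (1 / t) *\<^sub>R exponent (t *\<^sub>R ?l z) * exp (image.exponent (t *\<^sub>R ?l z))) (at t)"
      using t by (intro field_vector_diff_chain_at has_vector_derivative_exponent_image) auto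
    then have "((\<lambda>t. \<phi> (t *\<^sub>R ?l z)) has_vector_derivative (1 / t) *\<^sub>R exponent (t *\<^sub>R ?l z) * \<phi> (t *\<^sub>R ?l z)) (at t)"
      by (simp only: cf comp_def)
    then show "((\<lambda>t. Re (?F z * \<phi> (t *\<^sub>R ?l z))) has_real_derivative Re (?F z * ((1 / t) *\<^sub>R exponent (t *\<^sub>R ?l z) * \<phi> (t *\<^sub>R ?l z)))) (at t)"
      by (rule has_real_derivative_Re_mult)
    have "\<bar>Re (?F z * ((1 / t) *\<^sub>R exponent (t *\<^sub>R ?l z) * \<phi> (t *\<^sub>R ?l z)))\<bar> \<le> cmod (?F z) * (((1 / t) * cmod (exponent (t *\<^sub>R ?l z))) * cmod (\<phi> (t *\<^sub>R ?l z)))"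
      using t by (intro order_trans[OF abs_Re_le_cmod]) (simp add: norm_mult)
    also have "\<dots> \<le> cmod (?F z) * ((2 * (exponent_bound * (4 * (1 + (norm (?l z))\<^sup>2)))) * 1)"
    proof (intro mult_left_mono mult_mono norm_\<phi>_le)
      show "1 / t \<le> 2" using t by (simp add: divide_le_eq)
      have "t\<^sup>2 \<le> 2\<^sup>2" using t by (intro power_mono) auto
      then have "t\<^sup>2 * (norm (?l z))\<^sup>2 \<le> 2\<^sup>2 * (norm (?l z))\<^sup>2" by (intro mult_right_mono) auto
      moreover have "(norm (t *\<^sub>R ?l z))\<^sup>2 = t\<^sup>2 * (norm (?l z))\<^sup>2"
        unfolding norm_scaleR[of t] power_mult_distrib by simp
      ultimately have "1 + (norm (t *\<^sub>R ?l z))\<^sup>2 \<le> 4 * (1 + (norm (?l z))\<^sup>2)"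
        by (simp only:) simp
      then show "cmod (exponent (t *\<^sub>R ?l z)) \<le> exponent_bound * (4 * (1 + (norm (?l z))\<^sup>2))"
        by (rule order_trans[OF norm_exponent_le mult_left_mono[OF _ exponent_bound_nonneg]])
    qed (use t exponent_bound_nonneg in auto)
    also have "\<dots> = 8 * exponent_bound * (cmod (?F z) * (1 + (norm (?l z))\<^sup>2))"
      by (simp add: algebra_simps)
    finally show "\<bar>Re (?F z * ((1 / t) *\<^sub>R exponent (t *\<^sub>R ?l z) * \<phi> (t *\<^sub>R ?l z)))\<bar> \<le> 8 * exponent_bound * (cmod (?F z) * (1 + (norm (?l z))\<^sup>2))" .
  next
    fix t :: real
    show "integrable gaussian (\<lambda>z. Re (?F z * \<phi> (t *\<^sub>R ?l z)))"
    proof (rule E.integrable_dominated[where K=1])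
      fix z :: 'a
      have "\<bar>Re (?F z * \<phi> (t *\<^sub>R ?l z))\<bar> \<le> cmod (?F z) * (1 + (norm (?l z))\<^sup>2)"
        by (rule order_trans[OF abs_Re_le_cmod], unfold norm_mult, intro mult_left_mono order_trans[OF norm_\<phi>_le]) auto
      then show "norm (Re (?F z * \<phi> (t *\<^sub>R ?l z))) \<le> 1 * (cmod (?F z) * (1 + (norm (?l z))\<^sup>2))" by simp
    qed measurable
  qed (use E.integrable_moment in auto)
  from DERIV_unique[OF 1 2] show ?thesis
    unfolding sm integral_stein_mixture[OF E] by simp
qed

text \<open>With \<open>h = 1/(n+1)\<close> both sides of the smoothed identity converge by
  dominated convergence to \<open>gauss_mass\<close> times the desired ones, since all bounds are
  uniform for \<open>h \<le> 1\<close>.\<close>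

lemma stein_identity:
  assumes cf: "\<And>\<xi>. \<phi> \<xi> = exp (image.exponent \<xi>)" and T: "test_function f g B"
  shows "(LINT y|\<mu>. y \<bullet> g y) = (LINT y|\<mu>. stein f g y)"
proof -
  interpret T: test_function f g B by fact
  let ?h = "\<lambda>n. inverse (real (Suc n))"
  have h: "?h \<longlonglongrightarrow> 0" by (rule LIMSEQ_inverse_real_of_nat)
  have h01: "0 < ?h n" "\<bar>?h n\<bar> \<le> 1" for n by (auto simp: inverse_le_1_iff)
  let ?m = "gauss_mass TYPE('a)"
  have m0: "0 < ?m" by (rule gauss_mass_pos)
  let ?R = "LINT z|(lborel::'a measure). gauss_kernel z * norm z"
  \<comment> \<open>The constant of \<open>smooth_grad_bound\<close> with
    \<open>\<bar>h\<bar>\<close> replaced by its upper bound \<open>1\<close>.\<close>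
  let ?C = "B * ?m + B * ?R"
  have R0: "0 \<le> ?R" by simp
  have 1: "(\<lambda>n. LINT y|\<mu>. y \<bullet> T.smooth_grad (?h n) y) \<longlonglongrightarrow> (LINT y|\<mu>. y \<bullet> (?m *\<^sub>R g y))"
  proof (rule integral_dominated_convergence[where w="\<lambda>_. ?C"])
    show "AE y in \<mu>. (\<lambda>n. y \<bullet> T.smooth_grad (?h n) y) \<longlonglongrightarrow> y \<bullet> (?m *\<^sub>R g y)"
      by (intro AE_I2 tendsto_intros T.smooth_grad_limit h)
    show "AE y in \<mu>. norm (y \<bullet> T.smooth_grad (?h n) y) \<le> ?C" for n
    proof (rule AE_I2)
      fix y
      have "\<bar>?h n\<bar> * B * ?R \<le> 1 * B * ?R"
        using h01[of n] T.B_nonneg R0 by (intro mult_right_mono) auto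
      then show "norm (y \<bullet> T.smooth_grad (?h n) y) \<le> ?C"
        using T.smooth_grad_bound[of y "?h n"] by simp
    qed
  qed auto
  have 2: "(\<lambda>n. LINT y|\<mu>. stein (T.smooth (?h n)) (T.smooth_grad (?h n)) y) \<longlonglongrightarrow> (LINT y|\<mu>. ?m * stein f g y)"
  proof (rule integral_dominated_convergence[where w="\<lambda>_. norm (b - mean) * (?m * B) + ?m * (2 * B * (LINT u|\<nu>'. min 1 ((norm u)\<^sup>2)))"])
    show "AE y in \<mu>. (\<lambda>n. stein (T.smooth (?h n)) (T.smooth_grad (?h n)) y) \<longlonglongrightarrow> ?m * stein f g y"
    proof (rule AE_I2)
      fix y
      have "(\<lambda>n. LINT u|\<nu>'. jump_remainder (T.smooth (?h n)) (T.smooth_grad (?h n)) y u) \<longlonglongrightarrow> (LINT u|\<nu>'. ?m * jump_remainder f g y u)"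
      proof (rule integral_dominated_convergence[where w="\<lambda>u. ?m * (2 * B * min 1 ((norm u)\<^sup>2))"])
        show "integrable \<nu>' (\<lambda>u. ?m * (2 * B * min 1 ((norm u)\<^sup>2)))" using integrable_weight by simp
        show "AE u in \<nu>'. (\<lambda>n. jump_remainder (T.smooth (?h n)) (T.smooth_grad (?h n)) y u) \<longlonglongrightarrow> ?m * jump_remainder f g y u"
          by (intro AE_I2 T.jump_remainder_smooth_limit h)
        show "AE u in \<nu>'. norm (jump_remainder (T.smooth (?h n)) (T.smooth_grad (?h n)) y u) \<le> ?m * (2 * B * min 1 ((norm u)\<^sup>2))" for n
          using T.jump_remainder_smooth_bound by (intro AE_I2) simp
        show "jump_remainder (T.smooth (?h n)) (T.smooth_grad (?h n)) y \<in> borel_measurable \<nu>'" for n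
          unfolding jump_remainder_def[abs_def] by measurable
      qed measurable
      moreover have "(\<lambda>n. (b - mean) \<bullet> T.smooth_grad (?h n) y) \<longlonglongrightarrow> (b - mean) \<bullet> (?m *\<^sub>R g y)"
        by (intro tendsto_intros T.smooth_grad_limit h)
      ultimately have "(\<lambda>n. stein (T.smooth (?h n)) (T.smooth_grad (?h n)) y) \<longlonglongrightarrow> (b - mean) \<bullet> (?m *\<^sub>R g y) + (LINT u|\<nu>'. ?m * jump_remainder f g y u)"
        unfolding stein_def by (rule tendsto_add[rotated])
      then show "(\<lambda>n. stein (T.smooth (?h n)) (T.smooth_grad (?h n)) y) \<longlonglongrightarrow> ?m * stein f g y"
        by (simp add: stein_def distrib_left)
    qed
    show "AE y in \<mu>. norm (stein (T.smooth (?h n)) (T.smooth_grad (?h n)) y) \<le> norm (b - mean) * (?m * B) + ?m * (2 * B * (LINT u|\<nu>'. min 1 ((norm u)\<^sup>2)))" for n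
    proof (rule AE_I2)
      fix y
      have "\<bar>(b - mean) \<bullet> T.smooth_grad (?h n) y\<bar> \<le> norm (b - mean) * (?m * B)"
        by (intro order_trans[OF Cauchy_Schwarz_ineq2] mult_left_mono T.norm_smooth_grad_bound) auto
      moreover have "norm (LINT u|\<nu>'. jump_remainder (T.smooth (?h n)) (T.smooth_grad (?h n)) y u) \<le> (LINT u|\<nu>'. ?m * (2 * B * min 1 ((norm u)\<^sup>2)))"
      proof (rule Bochner_Integration.integral_norm_bound_integral)
        show i: "integrable \<nu>' (\<lambda>u. ?m * (2 * B * min 1 ((norm u)\<^sup>2)))" using integrable_weight by simp
        show "norm (jump_remainder (T.smooth (?h n)) (T.smooth_grad (?h n)) y u) \<le> ?m * (2 * B * min 1 ((norm u)\<^sup>2))" for u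
          using T.jump_remainder_smooth_bound by simp
        show "integrable \<nu>' (jump_remainder (T.smooth (?h n)) (T.smooth_grad (?h n)) y)"
        proof (rule Bochner_Integration.integrable_bound[OF i])
          show "AE u in \<nu>'. norm (jump_remainder (T.smooth (?h n)) (T.smooth_grad (?h n)) y u) \<le> norm (?m * (2 * B * min 1 ((norm u)\<^sup>2)))"
            using T.jump_remainder_smooth_bound by (intro AE_I2) (auto intro: order_trans[OF _ abs_ge_self])
          show "jump_remainder (T.smooth (?h n)) (T.smooth_grad (?h n)) y \<in> borel_measurable \<nu>'"
            unfolding jump_remainder_def[abs_def] by measurable
        qed
      qed
      ultimately show "norm (stein (T.smooth (?h n)) (T.smooth_grad (?h n)) y) \<le> norm (b - mean) * (?m * B) + ?m * (2 * B * (LINT u|\<nu>'. min 1 ((norm u)\<^sup>2)))"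
        unfolding stein_def by simp
    qed
    show "(\<lambda>y. stein (T.smooth (?h n)) (T.smooth_grad (?h n)) y) \<in> borel_measurable \<mu>" for n
      unfolding stein_def jump_remainder_def[abs_def] by measurable
    show "(\<lambda>y. ?m * stein f g y) \<in> borel_measurable \<mu>"
      unfolding stein_def by measurable
  qed simp
  have "(LINT y|\<mu>. y \<bullet> (?m *\<^sub>R g y)) = (LINT y|\<mu>. ?m * stein f g y)"
    using LIMSEQ_unique[OF 1[unfolded stein_identity_smooth[OF cf T h01(1)]] 2] .
  then show ?thesis using m0 by simp
qed

end

section \<open>From the Stein identity to the characteristic function\<close>

lemma norm_add_power2_le: "(norm (x + y))\<^sup>2 \<le> 2 * (norm x)\<^sup>2 + 2 * (norm y)\<^sup>2"
proof -
  have "(norm (x + y))\<^sup>2 \<le> (norm x + norm y)\<^sup>2" by (intro power_mono norm_triangle_ineq) simp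
  also have "\<dots> \<le> 2 * (norm x)\<^sup>2 + 2 * (norm y)\<^sup>2"
    using sum_squares_bound[of "norm x" "norm y"] by (simp add: power2_sum)
  finally show ?thesis .
qed

lemma exponential_mixture_gaussian:
  fixes \<xi> :: "'a::euclidean_space"
  shows "exponential_mixture gaussian (\<lambda>_. iexp \<theta>) (\<lambda>z. \<xi> + s *\<^sub>R z)"
proof
  interpret G: prob_space "gaussian :: 'a measure" by (rule prob_space_gaussian)
  show "\<exists>A. countable A \<and> A \<subseteq> sets (gaussian::'a measure) \<and> \<Union> A = space (gaussian::'a measure) \<and> (\<forall>a\<in>A. emeasure (gaussian::'a measure) a \<noteq> \<infinity>)"
    using G.sigma_finite_countable by blast
  show "integrable gaussian (\<lambda>z. cmod (iexp \<theta>) * (1 + (norm (\<xi> + s *\<^sub>R z))\<^sup>2))"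
  proof (rule Bochner_Integration.integrable_bound)
    show "integrable gaussian (\<lambda>z::'a. 1 + 2 * (norm \<xi>)\<^sup>2 + 2 * s\<^sup>2 * (norm z)\<^sup>2)"
      using integrable_gaussian_norm_power2 by (intro Bochner_Integration.integrable_add integrable_mult_right) auto
    show "AE z in gaussian. norm (cmod (iexp \<theta>) * (1 + (norm (\<xi> + s *\<^sub>R z))\<^sup>2)) \<le> norm (1 + 2 * (norm \<xi>)\<^sup>2 + 2 * s\<^sup>2 * (norm z)\<^sup>2)"
    proof (rule AE_I2)
      fix z
      show "norm (cmod (iexp \<theta>) * (1 + (norm (\<xi> + s *\<^sub>R z))\<^sup>2)) \<le> norm (1 + 2 * (norm \<xi>)\<^sup>2 + 2 * s\<^sup>2 * (norm z)\<^sup>2)"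
        using norm_add_power2_le[of \<xi> "s *\<^sub>R z"] by (simp add: power_mult_distrib)
    qed
  qed simp
qed simp_all

text \<open>Averaging \<open>iexp (s * (z \<bullet> x))\<close> over a standard Gaussian
  \<open>z\<close> gives \<open>exp (- (norm (s *\<^sub>R x))\<^sup>2 / 2)\<close>, hence the
  damping \<open>s\<^sup>2 / 2\<close>.\<close>

lemma mix_gaussian:
  fixes \<xi> x :: "'a::euclidean_space"
  shows "exponential_mixture.mix gaussian (\<lambda>_. iexp \<theta>) (\<lambda>z. \<xi> + s *\<^sub>R z) x = test_cos \<xi> \<theta> (s\<^sup>2 / 2) x"
proof -
  interpret E: exponential_mixture gaussian "\<lambda>_. iexp \<theta>" "\<lambda>z. \<xi> + s *\<^sub>R z" by (rule exponential_mixture_gaussian)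
  interpret G: prob_space "gaussian :: 'a measure" by (rule prob_space_gaussian)
  have i: "integrable gaussian (\<lambda>z. iexp ((s *\<^sub>R x) \<bullet> z))"
    by (rule G.integrable_const_bound[where B=1]) auto
  have "E.mix x = (LINT z|gaussian. Re (iexp (\<theta> + \<xi> \<bullet> x) * iexp ((s *\<^sub>R x) \<bullet> z)))"
    unfolding E.mix_def
    by (intro Bochner_Integration.integral_cong refl arg_cong[where f=Re])
      (simp add: exp_add[symmetric] inner_add_left inner_commute algebra_simps)
  also have "\<dots> = Re (CLINT z|gaussian. iexp (\<theta> + \<xi> \<bullet> x) * iexp ((s *\<^sub>R x) \<bullet> z))"
    using i by (intro integral_Re integrable_mult_right) auto
  also have "(CLINT z|gaussian. iexp (\<theta> + \<xi> \<bullet> x) * iexp ((s *\<^sub>R x) \<bullet> z)) = iexp (\<theta> + \<xi> \<bullet> x) * complex_of_real (exp (- (norm (s *\<^sub>R x))\<^sup>2 / 2))"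
    unfolding cf_gaussian[symmetric] by simp
  also have "Re \<dots> = test_cos \<xi> \<theta> (s\<^sup>2 / 2) x"
    by (simp add: test_cos_def Re_exp power_mult_distrib power2_norm_eq_inner add.commute)
  finally show ?thesis .
qed

lemma mix_grad_gaussian:
  fixes \<xi> x :: "'a::euclidean_space"
  shows "exponential_mixture.mix_grad gaussian (\<lambda>_. iexp \<theta>) (\<lambda>z. \<xi> + s *\<^sub>R z) x = test_cos_grad \<xi> \<theta> (s\<^sup>2 / 2) x"
proof -
  interpret E: exponential_mixture gaussian "\<lambda>_. iexp \<theta>" "\<lambda>z. \<xi> + s *\<^sub>R z" by (rule exponential_mixture_gaussian)
  have "v \<bullet> test_cos_grad \<xi> \<theta> (s\<^sup>2 / 2) x = v \<bullet> E.mix_grad x" for v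
    using GDERIV_imp_DERIV_line[OF GDERIV_test_cos, of \<xi> \<theta> "s\<^sup>2 / 2" x v 0] E.DERIV_mix[of x v 0] DERIV_unique
    unfolding mix_gaussian by fastforce
  then show ?thesis by (metis vector_eq_ldot)
qed

section \<open>The differential equation of \<open>\<phi>\<close> along rays\<close>

context levy_law
begin

text \<open>The value that \<open>t\<close> times the derivative of
  \<open>\<phi> (t *\<^sub>R \<xi>)\<close> must have, taken at the point
  \<open>t *\<^sub>R \<xi>\<close>.\<close>

definition flow :: "'a \<Rightarrow> complex" where
  "flow \<xi> = exponent \<xi> * \<phi> \<xi>"

lemma continuous_flow: "continuous_on UNIV flow"
  unfolding flow_def[abs_def] by (intro continuous_intros exponent_continuous continuous_\<phi>)

lemma flow_measurable[measurable]: "flow \<in> borel_measurable borel"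
  by (rule borel_measurable_continuous_onI[OF continuous_flow])

lemma norm_flow_le: "cmod (flow \<xi>) \<le> exponent_bound * (1 + (norm \<xi>)\<^sup>2)"
  using mult_mono[OF norm_exponent_le norm_\<phi>_le, of \<xi> \<xi>] exponent_bound_nonneg by (simp add: flow_def norm_mult)

context
  assumes stein_cos: "\<And>\<xi> \<theta> \<delta>. 0 < \<delta> \<Longrightarrow>
    (LINT y|\<mu>. y \<bullet> test_cos_grad \<xi> \<theta> \<delta> y) = (LINT y|\<mu>. stein (test_cos \<xi> \<theta> \<delta>) (test_cos_grad \<xi> \<theta> \<delta>) y)"
begin

text \<open>On the space side the derivative is the pairing of \<open>y\<close> with the gradient at
  \<open>t *\<^sub>R y\<close>. By \<open>test_cos_grad_scale\<close> this is \<open>1/t\<close>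
  times the left-hand side of the Stein identity for the dilated test function, and the right-hand
  side is evaluated by the mixture formula.\<close>

lemma DERIV_smoothed_\<phi>:
  assumes s: "0 < s" and t: "0 < t"
  shows "((\<lambda>t. LINT z|gaussian. Re (iexp \<theta> * \<phi> (t *\<^sub>R (\<xi> + s *\<^sub>R z)))) has_real_derivative
    (1 / t) * (LINT z|gaussian. Re (iexp \<theta> * flow (t *\<^sub>R (\<xi> + s *\<^sub>R z))))) (at t)"
proof -
  \<comment> \<open>The first damping belongs to the function that is differentiated, the second to
    its dilate, to which the Stein identity is applied.\<close>
  have \<delta>: "0 < s\<^sup>2 / 2" "0 < (t * s)\<^sup>2 / 2" using s t by auto
  obtain B where "test_function (test_cos \<xi> \<theta> (s\<^sup>2 / 2)) (test_cos_grad \<xi> \<theta> (s\<^sup>2 / 2)) B"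
    using schwartz_test_function[OF test_cos_schwartz[OF \<delta>(1)]] gradient_test_cos by metis
  then interpret T: test_function "test_cos \<xi> \<theta> (s\<^sup>2 / 2)" "test_cos_grad \<xi> \<theta> (s\<^sup>2 / 2)" B .
  note E = exponential_mixture_gaussian[of \<theta> \<xi> s]
  have H: "(LINT y|\<mu>. test_cos \<xi> \<theta> (s\<^sup>2 / 2) (t *\<^sub>R y)) = (LINT z|gaussian. Re (iexp \<theta> * \<phi> (t *\<^sub>R (\<xi> + s *\<^sub>R z))))" for t
    using integral_mix_scaled[OF E] unfolding mix_gaussian .
  have "((\<lambda>t. LINT y|\<mu>. test_cos \<xi> \<theta> (s\<^sup>2 / 2) (t *\<^sub>R y)) has_real_derivative (LINT y|\<mu>. y \<bullet> test_cos_grad \<xi> \<theta> (s\<^sup>2 / 2) (t *\<^sub>R y))) (at t)"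
  proof (rule DERIV_integral[where a="t/2" and b="2*t" and w="\<lambda>_. B / (t / 2)"])
    fix r y assume r: "r \<in> {t/2<..<2*t}"
    show "((\<lambda>t. test_cos \<xi> \<theta> (s\<^sup>2 / 2) (t *\<^sub>R y)) has_real_derivative y \<bullet> test_cos_grad \<xi> \<theta> (s\<^sup>2 / 2) (r *\<^sub>R y)) (at r)"
      using T.DERIV_line[of 0 y r] by simp
    have "r * \<bar>y \<bullet> test_cos_grad \<xi> \<theta> (s\<^sup>2 / 2) (r *\<^sub>R y)\<bar> \<le> B"
      using T.xg_bound[of "r *\<^sub>R y"] r t by (simp add: abs_mult)
    moreover have "(t / 2) * \<bar>y \<bullet> test_cos_grad \<xi> \<theta> (s\<^sup>2 / 2) (r *\<^sub>R y)\<bar> \<le> r * \<bar>y \<bullet> test_cos_grad \<xi> \<theta> (s\<^sup>2 / 2) (r *\<^sub>R y)\<bar>"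
      using r by (intro mult_right_mono) auto
    ultimately have "(t / 2) * \<bar>y \<bullet> test_cos_grad \<xi> \<theta> (s\<^sup>2 / 2) (r *\<^sub>R y)\<bar> \<le> B" by (rule order_trans[rotated])
    then show "\<bar>y \<bullet> test_cos_grad \<xi> \<theta> (s\<^sup>2 / 2) (r *\<^sub>R y)\<bar> \<le> B / (t / 2)"
      using t by (subst pos_le_divide_eq) (auto simp: mult.commute)
  next
    fix r :: real
    show "integrable \<mu> (\<lambda>y. test_cos \<xi> \<theta> (s\<^sup>2 / 2) (r *\<^sub>R y))"
      using T.f_bound by (intro \<mu>.integrable_const_bound[where B=B]) auto
  qed (use t in auto)
  moreover have "(LINT y|\<mu>. y \<bullet> test_cos_grad \<xi> \<theta> (s\<^sup>2 / 2) (t *\<^sub>R y)) = (1 / t) * (LINT z|gaussian. Re (iexp \<theta> * flow (t *\<^sub>R (\<xi> + s *\<^sub>R z))))"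
  proof -
    have "t * (LINT y|\<mu>. y \<bullet> test_cos_grad \<xi> \<theta> (s\<^sup>2 / 2) (t *\<^sub>R y)) = (LINT y|\<mu>. y \<bullet> test_cos_grad (t *\<^sub>R \<xi>) \<theta> ((t * s)\<^sup>2 / 2) y)"
      unfolding test_cos_grad_scale by simp
    also have "\<dots> = (LINT z|gaussian. Re (iexp \<theta> * (exponent (t *\<^sub>R \<xi> + (t * s) *\<^sub>R z) * \<phi> (t *\<^sub>R \<xi> + (t * s) *\<^sub>R z))))"
      unfolding stein_cos[OF \<delta>(2)] using integral_stein_mixture[OF exponential_mixture_gaussian[of \<theta> "t *\<^sub>R \<xi>" "t * s"]]
      unfolding mix_gaussian[abs_def] mix_grad_gaussian[abs_def] .
    also have "\<dots> = (LINT z|gaussian. Re (iexp \<theta> * flow (t *\<^sub>R (\<xi> + s *\<^sub>R z))))"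
      by (simp add: flow_def scaleR_add_right)
    finally show ?thesis using t by (simp add: field_simps)
  qed
  ultimately show ?thesis unfolding H by simp
qed

text \<open>Uniform in \<open>s \<le> 1\<close> and \<open>t \<le> T\<close>, so that one
  Gaussian-integrable function dominates both the limit in \<open>s\<close> and the integrals over
  compact ranges of \<open>t\<close>.\<close>

lemma moment_bound: "0 \<le> s \<Longrightarrow> s \<le> 1 \<Longrightarrow> 0 \<le> t \<Longrightarrow> t \<le> T \<Longrightarrow>
  1 + (norm (t *\<^sub>R (\<xi> + s *\<^sub>R z)))\<^sup>2 \<le> 1 + T\<^sup>2 * (2 * (norm \<xi>)\<^sup>2 + 2 * (norm z)\<^sup>2)" for \<xi> z :: 'a
proof -
  assume s: "0 \<le> s" "s \<le> 1" and t: "0 \<le> t" "t \<le> T"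
  have "(norm (s *\<^sub>R z))\<^sup>2 \<le> (norm z)\<^sup>2" using s by (intro power_mono) (auto intro: mult_left_le_one_le)
  then have "(norm (\<xi> + s *\<^sub>R z))\<^sup>2 \<le> 2 * (norm \<xi>)\<^sup>2 + 2 * (norm z)\<^sup>2"
    using norm_add_power2_le[of \<xi> "s *\<^sub>R z"] by linarith
  moreover have "t\<^sup>2 \<le> T\<^sup>2" using t by (intro power_mono) auto
  ultimately have "t\<^sup>2 * (norm (\<xi> + s *\<^sub>R z))\<^sup>2 \<le> T\<^sup>2 * (2 * (norm \<xi>)\<^sup>2 + 2 * (norm z)\<^sup>2)"
    by (intro mult_mono) auto
  then show ?thesis by (simp add: power_mult_distrib)
qed

lemma integrable_moment_bound: "integrable gaussian (\<lambda>z::'a. exponent_bound * (1 + T\<^sup>2 * (2 * (norm \<xi>)\<^sup>2 + 2 * (norm z)\<^sup>2)))"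
proof -
  interpret G: prob_space "gaussian :: 'a measure" by (rule prob_space_gaussian)
  show ?thesis
    using integrable_gaussian_norm_power2 by (intro integrable_mult_right Bochner_Integration.integrable_add) auto
qed

lemma norm_smoothed_flow_le:
  assumes "0 \<le> s" "s \<le> 1" "0 \<le> t" "t \<le> T"
  shows "\<bar>Re (iexp \<theta> * flow (t *\<^sub>R (\<xi> + s *\<^sub>R z)))\<bar> \<le> exponent_bound * (1 + T\<^sup>2 * (2 * (norm \<xi>)\<^sup>2 + 2 * (norm z)\<^sup>2))"
proof -
  have "\<bar>Re (iexp \<theta> * flow (t *\<^sub>R (\<xi> + s *\<^sub>R z)))\<bar> \<le> cmod (flow (t *\<^sub>R (\<xi> + s *\<^sub>R z)))"
    by (rule order_trans[OF abs_Re_le_cmod]) (simp add: norm_mult)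
  also have "\<dots> \<le> exponent_bound * (1 + T\<^sup>2 * (2 * (norm \<xi>)\<^sup>2 + 2 * (norm z)\<^sup>2))"
    by (rule order_trans[OF norm_flow_le mult_left_mono[OF moment_bound[OF assms] exponent_bound_nonneg]])
  finally show ?thesis .
qed

text \<open>The values and the derivatives of the smoothed functions converge pointwise as
  \<open>s\<close> tends to \<open>0\<close>, which does not by itself differentiate the limit. In
  integrated form dominated convergence is enough; \<open>t0 > 0\<close> keeps \<open>1 / t\<close>
  bounded.\<close>

lemma has_integral_flow:
  assumes t: "0 < t0" "t0 \<le> t1"
  shows "((\<lambda>t. (1 / t) * Re (iexp \<theta> * flow (t *\<^sub>R \<xi>))) has_integral
    Re (iexp \<theta> * \<phi> (t1 *\<^sub>R \<xi>)) - Re (iexp \<theta> * \<phi> (t0 *\<^sub>R \<xi>))) {t0..t1}"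
proof -
  interpret G: prob_space "gaussian :: 'a measure" by (rule prob_space_gaussian)
  let ?s = "\<lambda>n. inverse (real (Suc n))"
  have s: "0 < ?s n" "?s n \<le> 1" for n by (auto simp: inverse_le_1_iff)
  have s_lim: "?s \<longlonglongrightarrow> 0" by (rule LIMSEQ_inverse_real_of_nat)
  have pt: "(\<lambda>n. q (t *\<^sub>R (\<xi> + ?s n *\<^sub>R z))) \<longlonglongrightarrow> q (t *\<^sub>R \<xi>)"
    if "continuous_on UNIV q" for q :: "'a \<Rightarrow> complex" and t z
  proof -
    have "(\<lambda>n. t *\<^sub>R (\<xi> + ?s n *\<^sub>R z)) \<longlonglongrightarrow> t *\<^sub>R (\<xi> + 0 *\<^sub>R z)" by (intro tendsto_intros s_lim)
    then show ?thesis using continuous_on_tendsto_compose[OF that, of _ "t *\<^sub>R \<xi>" sequentially] by simp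
  qed
  let ?D = "\<lambda>n t. (1 / t) * (LINT z|gaussian. Re (iexp \<theta> * flow (t *\<^sub>R (\<xi> + ?s n *\<^sub>R z))))"
  let ?H = "\<lambda>n t. LINT z|gaussian. Re (iexp \<theta> * \<phi> (t *\<^sub>R (\<xi> + ?s n *\<^sub>R z)))"
  have int: "(?D n has_integral ?H n t1 - ?H n t0) {t0..t1}" for n
    using t DERIV_smoothed_\<phi>[OF s(1)]
    by (intro fundamental_theorem_of_calculus)
      (auto simp: has_real_derivative_iff_has_vector_derivative[symmetric] intro: has_field_derivative_at_within)
  have Hlim: "(\<lambda>n. ?H n t) \<longlonglongrightarrow> Re (iexp \<theta> * \<phi> (t *\<^sub>R \<xi>))" for t
  proof -
    have "(\<lambda>n. ?H n t) \<longlonglongrightarrow> (LINT z|(gaussian::'a measure). Re (iexp \<theta> * \<phi> (t *\<^sub>R \<xi>)))"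
    proof (rule integral_dominated_convergence[where w="\<lambda>_. 1"])
      show "AE z in gaussian. (\<lambda>n. Re (iexp \<theta> * \<phi> (t *\<^sub>R (\<xi> + ?s n *\<^sub>R z)))) \<longlonglongrightarrow> Re (iexp \<theta> * \<phi> (t *\<^sub>R \<xi>))"
        by (intro AE_I2 tendsto_Re tendsto_mult tendsto_const pt continuous_\<phi>)
      show "AE z in gaussian. norm (Re (iexp \<theta> * \<phi> (t *\<^sub>R (\<xi> + ?s n *\<^sub>R z)))) \<le> 1" for n
        using norm_\<phi>_le by (intro AE_I2, unfold real_norm_def, intro order_trans[OF abs_Re_le_cmod]) (simp add: norm_mult)
    qed auto
    then show ?thesis by (simp add: G.prob_space[simplified])
  qed
  have Dlim: "(\<lambda>n. ?D n t) \<longlonglongrightarrow> (1 / t) * Re (iexp \<theta> * flow (t *\<^sub>R \<xi>))" if "t \<in> {t0..t1}" for t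
  proof (intro tendsto_mult tendsto_const)
    have "(\<lambda>n. LINT z|gaussian. Re (iexp \<theta> * flow (t *\<^sub>R (\<xi> + ?s n *\<^sub>R z)))) \<longlonglongrightarrow> (LINT z|(gaussian::'a measure). Re (iexp \<theta> * flow (t *\<^sub>R \<xi>)))"
    proof (rule integral_dominated_convergence[OF _ _ integrable_moment_bound[of t1 \<xi>]])
      show "AE z in gaussian. (\<lambda>n. Re (iexp \<theta> * flow (t *\<^sub>R (\<xi> + ?s n *\<^sub>R z)))) \<longlonglongrightarrow> Re (iexp \<theta> * flow (t *\<^sub>R \<xi>))"
        by (intro AE_I2 tendsto_Re tendsto_mult tendsto_const pt continuous_flow)
      show "AE z in gaussian. norm (Re (iexp \<theta> * flow (t *\<^sub>R (\<xi> + ?s n *\<^sub>R z)))) \<le> exponent_bound * (1 + t1\<^sup>2 * (2 * (norm \<xi>)\<^sup>2 + 2 * (norm z)\<^sup>2))" for n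
        using s[of n] t that by (intro AE_I2, unfold real_norm_def, intro norm_smoothed_flow_le) auto
    qed auto
    then show "(\<lambda>n. LINT z|gaussian. Re (iexp \<theta> * flow (t *\<^sub>R (\<xi> + ?s n *\<^sub>R z)))) \<longlonglongrightarrow> Re (iexp \<theta> * flow (t *\<^sub>R \<xi>))"
      by (simp add: G.prob_space[simplified])
  qed
  let ?K = "(1 / t0) * (LINT z|(gaussian::'a measure). exponent_bound * (1 + t1\<^sup>2 * (2 * (norm \<xi>)\<^sup>2 + 2 * (norm z)\<^sup>2)))"
  have bd: "norm (?D n t) \<le> ?K" if "t \<in> {t0..t1}" for n t
  proof -
    have "norm (LINT z|gaussian. Re (iexp \<theta> * flow (t *\<^sub>R (\<xi> + ?s n *\<^sub>R z)))) \<le> (LINT z|(gaussian::'a measure). exponent_bound * (1 + t1\<^sup>2 * (2 * (norm \<xi>)\<^sup>2 + 2 * (norm z)\<^sup>2)))"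
    proof (rule Bochner_Integration.integral_norm_bound_integral[OF _ integrable_moment_bound])
      show b: "norm (Re (iexp \<theta> * flow (t *\<^sub>R (\<xi> + ?s n *\<^sub>R z)))) \<le> exponent_bound * (1 + t1\<^sup>2 * (2 * (norm \<xi>)\<^sup>2 + 2 * (norm z)\<^sup>2))" for z
        using s[of n] t that by (unfold real_norm_def, intro norm_smoothed_flow_le) auto
      show "integrable gaussian (\<lambda>z. Re (iexp \<theta> * flow (t *\<^sub>R (\<xi> + ?s n *\<^sub>R z))))"
        by (rule Bochner_Integration.integrable_bound[OF integrable_moment_bound[of t1 \<xi>]])
          (measurable, intro AE_I2 order_trans[OF b], simp)
    qed
    moreover have "0 \<le> 1 / t" "1 / t \<le> 1 / t0" using t that by (auto simp: frac_le)
    ultimately have "(1 / t) * norm (LINT z|gaussian. Re (iexp \<theta> * flow (t *\<^sub>R (\<xi> + ?s n *\<^sub>R z)))) \<le> ?K"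
      using t by (intro mult_mono) auto
    then show ?thesis using t that by (simp add: abs_mult)
  qed
  have g: "(\<lambda>t. (1 / t) * Re (iexp \<theta> * flow (t *\<^sub>R \<xi>))) integrable_on {t0..t1}"
    and lim: "(\<lambda>n. integral {t0..t1} (?D n)) \<longlonglongrightarrow> integral {t0..t1} (\<lambda>t. (1 / t) * Re (iexp \<theta> * flow (t *\<^sub>R \<xi>)))"
    using dominated_convergence[of ?D "{t0..t1}" "\<lambda>_. ?K" "\<lambda>t. (1 / t) * Re (iexp \<theta> * flow (t *\<^sub>R \<xi>))"] int bd Dlim
    by (blast intro: integrable_const_ivl)+
  have "integral {t0..t1} (?D n) = ?H n t1 - ?H n t0" for n
    using int by (rule integral_unique)
  with lim have "integral {t0..t1} (\<lambda>t. (1 / t) * Re (iexp \<theta> * flow (t *\<^sub>R \<xi>))) = Re (iexp \<theta> * \<phi> (t1 *\<^sub>R \<xi>)) - Re (iexp \<theta> * \<phi> (t0 *\<^sub>R \<xi>))"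
    using LIMSEQ_unique[OF _ tendsto_diff[OF Hlim Hlim]] by simp
  with integrable_integral[OF g] show ?thesis by simp
qed

text \<open>Continuity of \<open>flow\<close> turns the integral equation back into a differential
  one. The base point \<open>t / 2\<close> stays away from the singularity at
  \<open>0\<close>.\<close>

lemma DERIV_\<phi>_phase:
  assumes t: "0 < t"
  shows "((\<lambda>t. Re (iexp \<theta> * \<phi> (t *\<^sub>R \<xi>))) has_real_derivative (1 / t) * Re (iexp \<theta> * flow (t *\<^sub>R \<xi>))) (at t)"
proof -
  let ?f = "\<lambda>t. (1 / t) * Re (iexp \<theta> * flow (t *\<^sub>R \<xi>))"
  have eq: "integral {t/2..r} ?f + Re (iexp \<theta> * \<phi> ((t/2) *\<^sub>R \<xi>)) = Re (iexp \<theta> * \<phi> (r *\<^sub>R \<xi>))" if "r \<in> {t/2<..<2*t}" for r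
    using integral_unique[OF has_integral_flow[of "t/2" r \<theta> \<xi>]] t that by simp
  have "continuous_on {t/2..2*t} ?f"
    using t by (intro continuous_intros continuous_on_compose2[OF continuous_flow]) auto
  then have "((\<lambda>r. integral {t/2..r} ?f) has_real_derivative ?f t) (at t within {t/2..2*t})"
    by (rule integral_has_real_derivative) (use t in auto)
  moreover have "at t within {t/2..2*t} = at t" using t by (intro at_within_interior) auto
  ultimately have "((\<lambda>r. integral {t/2..r} ?f + Re (iexp \<theta> * \<phi> ((t/2) *\<^sub>R \<xi>))) has_real_derivative ?f t) (at t)"
    by (auto intro!: derivative_eq_intros)
  then show ?thesis
    by (rule has_field_derivative_transform_within_open[where S="{t/2<..<2*t}"]) (use t eq in auto)
qed

lemma has_vector_derivative_\<phi>:
  assumes t: "0 < t"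
  shows "((\<lambda>t. \<phi> (t *\<^sub>R \<xi>)) has_vector_derivative (1 / t) *\<^sub>R flow (t *\<^sub>R \<xi>)) (at t)"
proof -
  \<comment> \<open>The phase \<open>0\<close> yields the real part; the phase
    \<open>- (pi / 2)\<close> multiplies by \<open>- \<i>\<close>, and the real part of
    \<open>- \<i> * w\<close> is the imaginary part of \<open>w\<close>.\<close>
  have i: "iexp (- (pi / 2)) = - \<i>" by (simp add: complex_eq_iff Re_exp Im_exp)
  have "((\<lambda>t. Re (\<phi> (t *\<^sub>R \<xi>))) has_real_derivative (1 / t) * Re (flow (t *\<^sub>R \<xi>))) (at t)"
    using DERIV_\<phi>_phase[OF t, of 0 \<xi>] by simp
  moreover have "((\<lambda>t. Im (\<phi> (t *\<^sub>R \<xi>))) has_real_derivative (1 / t) * Im (flow (t *\<^sub>R \<xi>))) (at t)"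
    using DERIV_\<phi>_phase[OF t, of "- (pi / 2)" \<xi>] unfolding i by simp
  ultimately show ?thesis
    by (simp add: has_vector_derivative_complex_iff)
qed

text \<open>Multiplication by the integrating factor makes the derivative vanish for
  \<open>t > 0\<close>, so the product is constant. At \<open>t = 0\<close> the equation is
  singular; this point is the exceptional set, where continuity suffices and the product has the
  value \<open>1\<close>.\<close>

lemma \<phi>_eq_exp: "\<phi> \<xi> = exp (image.exponent \<xi>)"
proof -
  let ?u = "\<lambda>t. \<phi> (t *\<^sub>R \<xi>) * exp (- image.exponent (t *\<^sub>R \<xi>))"
  have cont: "continuous_on {0..1} ?u"
    by (intro continuous_intros continuous_on_compose2[OF continuous_\<phi>] continuous_on_compose2[OF image.exponent_continuous]) auto
  have der: "(?u has_vector_derivative 0) (at t)" if t: "0 < t" for t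
  proof -
    have "((exp \<circ> (\<lambda>t. - image.exponent (t *\<^sub>R \<xi>))) has_vector_derivative - ((1 / t) *\<^sub>R exponent (t *\<^sub>R \<xi>)) * exp (- image.exponent (t *\<^sub>R \<xi>))) (at t)"
      using t by (intro field_vector_diff_chain_at has_vector_derivative_minus has_vector_derivative_exponent_image) auto
    from has_vector_derivative_mult[OF has_vector_derivative_\<phi>[OF t, of \<xi>] this]
    show ?thesis by (simp add: comp_def flow_def algebra_simps)
  qed
  have "?u 1 = ?u 0"
  proof (rule has_derivative_zero_unique_strong_interval[where k="{0}" and a=0 and b=1])
    show "(?u has_derivative (\<lambda>h. 0)) (at x within {0..1})" if "x \<in> {0..1} - {0}" for x
      using has_vector_derivative_at_within[OF der[of x]] that by (simp add: has_vector_derivative_def)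
  qed (use cont in auto)
  moreover have "\<phi> 0 = 1" by (simp add: \<phi>_def \<mu>.prob_space)
  moreover have "image.exponent 0 = 0" by (simp add: image.exponent_def levy_kernel_def)
  ultimately have "\<phi> \<xi> * exp (- image.exponent \<xi>) = 1" by simp
  then show ?thesis by (simp add: exp_minus field_simps)
qed

end

end

section \<open>The equivalence for the law of \<open>X\<close>\<close>

lemma (in levy_law) integral_stein:
  assumes "test_function f g B"
  shows "(LINT y|\<mu>. stein f g y) = (LINT y|\<mu>. b \<bullet> g y) - (LINT y|\<mu>. mean \<bullet> g y) + (LINT y|\<mu>. LINT u|\<nu>'. jump_remainder f g y u)"
proof -
  interpret T: test_function f g B by fact
  \<comment> \<open>Both linear terms and the jump term are bounded in \<open>y\<close>, so the
    expectation splits even if \<open>\<mu>\<close> has no first moment.\<close>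
  have lin: "integrable \<mu> (\<lambda>y. v \<bullet> g y)" for v
    by (rule \<mu>.integrable_const_bound[where B="norm v * B"])
      (auto intro!: AE_I2 order_trans[OF Cauchy_Schwarz_ineq2] mult_left_mono T.g_bound)
  have jump: "integrable \<mu> (\<lambda>y. LINT u|\<nu>'. jump_remainder f g y u)"
  proof (rule \<mu>.integrable_const_bound)
    show "AE y in \<mu>. norm (LINT u|\<nu>'. jump_remainder f g y u) \<le> (LINT u|\<nu>'. 2 * B * min 1 ((norm u)\<^sup>2))"
      using integrable_weight T.jump_remainder_bound
      by (intro AE_I2 Bochner_Integration.integral_norm_bound_integral integrable_jump_remainder[OF assms]) auto
  qed measurable
  show ?thesis unfolding stein_def
    using lin[of b] lin[of mean] jump by (simp add: inner_diff_left)
qed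

theorem theorem3p4:
  fixes M :: "'w measure" and X :: "'w \<Rightarrow> 'a::euclidean_space" and b :: 'a
    and \<nu> \<sigma> \<nu>' :: "'a measure" and k :: "'a \<Rightarrow> real \<Rightarrow> real"
  assumes "prob_space M" and "X \<in> borel_measurable M"
    and "levy_measure \<nu>"
    and "finite_measure \<sigma>" and "sets \<sigma> = sets (restrict_space borel (sphere 0 1))"
    and "has_polar_decomposition \<nu> \<sigma> (\<lambda>x. radial_measure (k x))"
    and "\<And>x r. x \<in> sphere 0 1 \<Longrightarrow> r > 0 \<Longrightarrow> 0 \<le> k x r"
    and "\<And>x. x \<in> sphere 0 1 \<Longrightarrow> continuous_on {0<..} (k x)"
    and "\<And>x. x \<in> sphere 0 1 \<Longrightarrow> antimono_on {0<..} (k x)"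
    and "\<And>r. r > 0 \<Longrightarrow> continuous_on (sphere 0 1) (\<lambda>x. k x r)"
    and "\<And>x. x \<in> sphere 0 1 \<Longrightarrow> ((\<lambda>\<epsilon>. \<epsilon> * k x \<epsilon>) \<longlongrightarrow> k x 1) (at_right 0)"
    and "\<And>x. x \<in> sphere 0 1 \<Longrightarrow> (k x \<longlongrightarrow> 0) at_top"
    and "(\<integral>\<^sup>+r\<in>{0<..}. ennreal (min 1 (r\<^sup>2) * (SUP x\<in>sphere 0 1. k x r) / r) \<partial>lborel) < \<infinity>"
    and "\<And>xs x a. (\<And>n::nat. xs n \<in> sphere 0 1) \<Longrightarrow> x \<in> sphere 0 1 \<Longrightarrow> xs \<longlonglongrightarrow> x \<Longrightarrow> a > 0 \<Longrightarrow>
      \<exists>L. (\<forall>n. ((\<lambda>R. total_variation a R (\<lambda>r. k (xs n) r - k x r)) \<longlongrightarrow> L n) at_top) \<and>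
          L \<longlonglongrightarrow> 0"
    and "has_polar_decomposition \<nu>' \<sigma> (\<lambda>x. decreasing_stieltjes_measure (k x))"
    and "(\<integral>\<^sup>+u. ennreal (min 1 ((norm u)\<^sup>2)) \<partial>\<nu>') < \<infinity>"
  shows "(\<forall>f\<in>schwartz_space.
            (LINT \<omega>|M. X \<omega> \<bullet> gradient f (X \<omega>)) =
              (LINT \<omega>|M. b \<bullet> gradient f (X \<omega>))
            - (LINT \<omega>|M. LINT x|\<sigma>. (gradient f (X \<omega>) \<bullet> x) * k x 1)
            + (LINT \<omega>|M. LINT u|\<nu>'. f (X \<omega> + u) - f (X \<omega>)
                 - (gradient f (X \<omega>) \<bullet> u) * indicator {u. norm u \<le> 1} u))
         \<longleftrightarrow> self_decomposable M X b \<nu>"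
proof -
  note prob = assms(1) and X[measurable] = assms(2) and levy = assms(3)
  have dist: "(\<lambda>x. k x r) \<in> borel_measurable \<sigma>" if "0 < r" for r
    by (subst measurable_cong_sets[OF assms(5) refl])
      (rule borel_measurable_continuous_on_restrict[OF assms(10)[OF that]])
  interpret P: polar_levy \<sigma> \<nu>' k
    by (intro polar_levy.intro) (fact assms(4,5,7-9,12,15,16) dist)+
  define m where "m = (LINT x|\<sigma>. k x 1 *\<^sub>R x)"
  define \<mu> where "\<mu> = distr M borel X"
  \<comment> \<open>By \<open>P.integral_direction\<close> the vector \<open>m\<close>, read off
    from the Stein identity, is the truncation correction required of \<open>mean\<close> in
    \<open>levy_dilation\<close>.\<close>
  interpret L: levy_law \<nu>' \<nu> b m \<mu>
  proof (intro levy_law.intro levy_law_axioms.intro levy_dilation.intro levy_dilation_axioms.intro levy_jumps.intro)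
    show "m = (LINT u|\<nu>'. (indicator {u. 1 < norm u} u / norm u) *\<^sub>R u)"
      by (simp add: m_def P.integral_direction)
    show "\<nu> = distr (\<nu>' \<Otimes>\<^sub>M dilation_measure) borel (\<lambda>(u, t). t *\<^sub>R u)"
      by (rule P.dilation_image[OF assms(6)])
    show "prob_space \<mu>" unfolding \<mu>_def by (rule prob_space.prob_space_distr[OF prob X])
  qed (use levy P.sets_\<nu>' P.emeasure_\<nu>'_0 P.levy' in \<open>auto simp: levy_measure_def \<mu>_def\<close>)
  \<comment> \<open>Compactness of the sphere bounds \<open>k x 1\<close>; with
    \<open>\<sigma>\<close> finite the vector integral exists, and inner products may be taken
    outside it.\<close>
  have "continuous_on (sphere 0 1) (\<lambda>x. k x 1 *\<^sub>R x)"
    by (intro continuous_intros assms(10)) simp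
  from compact_imp_bounded[OF compact_continuous_image[OF this compact_sphere]]
  obtain K where "\<forall>y\<in>(\<lambda>x. k x 1 *\<^sub>R x) ` sphere 0 1. norm y \<le> K"
    unfolding bounded_iff by blast
  then have K: "norm (k x 1 *\<^sub>R x) \<le> K" if "x \<in> sphere 0 1" for x
    using that by blast
  have int_m: "integrable \<sigma> (\<lambda>x. k x 1 *\<^sub>R x)"
  proof (rule P.\<sigma>.integrable_const_bound[where B=K])
    show "(\<lambda>x. k x 1 *\<^sub>R x) \<in> borel_measurable \<sigma>"
      by (intro borel_measurable_scaleR dist P.ident_\<sigma>) simp
  qed (use K P.space_\<sigma> in auto)
  have dir: "(LINT x|\<sigma>. (v \<bullet> x) * k x 1) = m \<bullet> v" for v
    using integral_inner_right[OF int_m, of v] by (simp add: m_def inner_commute mult.commute)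
  \<comment> \<open>Transfers the identity from \<open>M\<close> to the law of \<open>X\<close>; its
    drift, correction and jump terms together form the integral of \<open>L.stein\<close>.\<close>
  have iff: "((LINT \<omega>|M. X \<omega> \<bullet> gradient f (X \<omega>)) =
              (LINT \<omega>|M. b \<bullet> gradient f (X \<omega>))
            - (LINT \<omega>|M. LINT x|\<sigma>. (gradient f (X \<omega>) \<bullet> x) * k x 1)
            + (LINT \<omega>|M. LINT u|\<nu>'. f (X \<omega> + u) - f (X \<omega>)
                 - (gradient f (X \<omega>) \<bullet> u) * indicator {u. norm u \<le> 1} u)) \<longleftrightarrow>
      (LINT y|\<mu>. y \<bullet> gradient f y) = (LINT y|\<mu>. L.stein f (gradient f) y)" if f: "f \<in> schwartz_space" for f
  proof -
    obtain B where B: "test_function f (gradient f) B" using schwartz_test_function[OF f] .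
    then interpret T: test_function f "gradient f" B .
    have "(LINT \<omega>|M. q (X \<omega>)) = (LINT y|\<mu>. q y)" if "q \<in> borel_measurable borel" for q :: "'a \<Rightarrow> real"
      unfolding \<mu>_def using X that by (simp add: integral_distr)
    from this[of "\<lambda>y. y \<bullet> gradient f y"] this[of "\<lambda>y. b \<bullet> gradient f y"] this[of "\<lambda>y. m \<bullet> gradient f y"]
      this[of "\<lambda>y. LINT u|\<nu>'. jump_remainder f (gradient f) y u"]
    show ?thesis unfolding L.integral_stein[OF B] dir jump_remainder_def[symmetric] by simp
  qed
  have cf: "characteristic_function M X \<xi> = L.\<phi> \<xi>" for \<xi>
    unfolding characteristic_function_def L.\<phi>_def unfolding \<mu>_def using X by (subst integral_distr) auto
  \<comment> \<open>The existential part of self-decomposability is witnessed by the given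
    \<open>\<sigma>\<close> and \<open>k\<close>, so only the formula for the characteristic
    function remains.\<close>
  have sd: "self_decomposable M X b \<nu> \<longleftrightarrow> (\<forall>\<xi>. L.\<phi> \<xi> = exp (L.image.exponent \<xi>))"
    unfolding self_decomposable_def cf L.image.exponent_def levy_kernel_def
  proof (intro iffI conjI levy exI[of _ \<sigma>] exI[of _ k])
    show "\<forall>x\<in>sphere 0 1. \<forall>r>0. 0 \<le> k x r" "\<forall>x\<in>sphere 0 1. antimono_on {0<..} (k x)"
      "\<forall>r>0. (\<lambda>x. k x r) \<in> borel_measurable \<sigma>"
      using assms(7,9) dist by auto
    show "finite_measure \<sigma>" "sets \<sigma> = sets (restrict_space borel (sphere 0 1))"
      "has_polar_decomposition \<nu> \<sigma> (\<lambda>x. radial_measure (k x))"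
      by (fact assms(4-6))+
  qed (elim conjE, assumption)+
  show ?thesis unfolding sd
  proof
    assume *: "\<forall>f\<in>schwartz_space.
            (LINT \<omega>|M. X \<omega> \<bullet> gradient f (X \<omega>)) =
              (LINT \<omega>|M. b \<bullet> gradient f (X \<omega>))
            - (LINT \<omega>|M. LINT x|\<sigma>. (gradient f (X \<omega>) \<bullet> x) * k x 1)
            + (LINT \<omega>|M. LINT u|\<nu>'. f (X \<omega> + u) - f (X \<omega>)
                 - (gradient f (X \<omega>) \<bullet> u) * indicator {u. norm u \<le> 1} u)"
    show "\<forall>\<xi>. L.\<phi> \<xi> = exp (L.image.exponent \<xi>)"
    proof (intro allI L.\<phi>_eq_exp)
      fix \<xi> :: 'a and \<theta> \<delta> :: real assume "0 < \<delta>"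
      from test_cos_schwartz[OF this, of \<xi> \<theta>] * iff
      show "(LINT y|\<mu>. y \<bullet> test_cos_grad \<xi> \<theta> \<delta> y) = (LINT y|\<mu>. L.stein (test_cos \<xi> \<theta> \<delta>) (test_cos_grad \<xi> \<theta> \<delta>) y)"
        unfolding gradient_test_cos[symmetric] by blast
    qed
  next
    assume "\<forall>\<xi>. L.\<phi> \<xi> = exp (L.image.exponent \<xi>)"
    then have "(LINT y|\<mu>. y \<bullet> gradient f y) = (LINT y|\<mu>. L.stein f (gradient f) y)" if "f \<in> schwartz_space" for f
      using schwartz_test_function[OF that] L.stein_identity by blast
    with iff show "\<forall>f\<in>schwartz_space.
            (LINT \<omega>|M. X \<omega> \<bullet> gradient f (X \<omega>)) =
              (LINT \<omega>|M. b \<bullet> gradient f (X \<omega>))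
            - (LINT \<omega>|M. LINT x|\<sigma>. (gradient f (X \<omega>) \<bullet> x) * k x 1)
            + (LINT \<omega>|M. LINT u|\<nu>'. f (X \<omega> + u) - f (X \<omega>)
                 - (gradient f (X \<omega>) \<bullet> u) * indicator {u. norm u \<le> 1} u)"
      by blast
  qed
qed

end
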